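(* Let $(G_n)$ be a sequence of finite graphs with all degrees bounded by an absolute constant $D$ and with $|V(G_n)|\to\infty$, and suppose $(G_n)$ is local-global convergent, with local-global limit the graphing $\mathcal{G}$. Then $$\mathrm{cost}(\mathcal{G})=\mathrm{cc}\big((G_n)\big).$$ Moreover, the rewirings can be chosen so that their edge densities exist: for every $\varepsilon>0$ there is a rewiring $(H_n)$ of $(G_n)$ such that the limit $\lim_{n\to\infty}|E(H_n)|/|V(H_n)|$ exists and is at most $\mathrm{cc}\big((G_n)\big)+\varepsilon$.
   Context: Fix a degree bound $D$. Graphs are simple and undirected; graph distance between vertices in different components is $\infty$. **Graphing.** Let $X$ be a Polish space with a Borel probability measure $\mu$. A graphing (with degree bound $D$) is a graph $\mathcal{G}$ with vertex set $V(\mathcal{G})=X$ and (symmetric) Borel edge set $E(\mathcal{G})\subset X\times X$, all degrees at most $D$, such that $\int_A e(x,B)\,d\mu(x)=\int_B e(x,A)\,d\mu(x)$ for all measurable $A,B\subseteq X$, where $e(x,S)$ is the number of edges from $x$ to $S$. A finite graph is a graphing with $\mu$ uniform on its vertex set. **Local-global convergence.** For $r,k\in\mathbb{N}$ let $U_r^k$ be the finite set of isomorphism classes of rooted connected graphs of radius at most $r$ (from the root), with degrees at most $D$, whose vertices are colored with colors in $\{1,\dots,k\}$. For a graphing $\mathcal{G}$ (in particular for a finite graph) and a Borel coloring $\varphi:X\to\{1,\dots,k\}$, let $P_{\mathcal{G},r}[\varphi]$ be the probability measure on $U_r^k$ which is the distribution of the $\varphi$-colored $r$-ball of $\mathcal{G}$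 around $x$, rooted at $x$, for a $\mu$-random $x$. Let $Q^k_{\mathcal{G},r}$ be the closure, in total variation distance, of $\{P_{\mathcal{G},r}[\varphi]: \varphi:X\to\{1,\dots,k\}\text{ Borel}\}$. A sequence $(G_n)$ of finite graphs is local-global convergent if for all $r,k$ the compact sets $Q^k_{G_n,r}$ converge in the Hausdorff distance (with respect to total variation) on the space of probability measures on $U_r^k$. A graphing $\mathcal{G}$ is a local-global limit of $(G_n)$ if $Q^k_{G_n,r}\to Q^k_{\mathcal{G},r}$ in Hausdorff distance for all $r,k$. (Every local-global convergent sequence has a graphing as a limit; it is unique up to having the same sets $Q^k_{\mathcal{G},r}$.) **Cost.** For graphings $\mathcal{G},\mathcal{H}$ on the same $(X,\mu)$ (possibly with different finite degree bounds) write $\mathcal{H}\sim\mathcal{G}$ if for $\mu$-almost every $x$ the connected components of $x$ in $\mathcal{G}$ and in $\mathcal{H}$ have the same vertex set. Then $$\mathrm{cost}(\mathcal{G})=\tfrac12\inf\Big\{\int_X\deg_{\mathcal{H}}(x)\,d\mu(x)\ :\ \mathcal{H}\sim\mathcal{G}\Big\}.$$ **Combinatorial cost.** A rewiring of $(G_n)$ is a sequence of graphs $(H_n)$ with $V(H_n)=V(G_n)$ for which there is $L\in\mathbb{N}$ such that for all $n$ and all $x,y\in V(G_n)$, $\frac1L d_{H_n}(x,y)\le d_{G_n}(x,y)\le L\,d_{H_n}(x,y)$. The combinatorial cost is $$\mathrm{cc}\big((G_n)\big)=\inf\Big\{\liminf_{n\to\infty}\frac{|E(H_n)|}{|V(H_n)|}\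 :\ (H_n)\text{ a rewiring of }(G_n)\Big\}.$$ *)

theory Defs
  imports "HOL-Probability.Probability"
begin

section \<open>Graphs\<close>

text \<open>A graph is given by its vertex set and its edge set, a symmetric relation: an undirected
  edge joining \<open>x\<close> and \<open>y\<close> is represented by the two pairs \<open>(x, y)\<close> and \<open>(y, x)\<close>.\<close>

definition simple_graph :: "'v set \<Rightarrow> ('v \<times> 'v) set \<Rightarrow> bool" where
  "simple_graph V E \<longleftrightarrow> E \<subseteq> V \<times> V \<and> sym E \<and> irrefl E"

definition degree_bounded :: "nat \<Rightarrow> 'v set \<Rightarrow> ('v \<times> 'v) set \<Rightarrow> bool" where
  "degree_bounded D V E \<longleftrightarrow> (\<forall>x\<in>V. finite (E `` {x}) \<and> card (E `` {x}) \<le> D)"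

text \<open>In the following definition the infimum of the empty set is \<open>\<infinity>\<close>.\<close>

definition graph_dist :: "('v \<times> 'v) set \<Rightarrow> 'v \<Rightarrow> 'v \<Rightarrow> enat" where
  "graph_dist E x y = (INF n\<in>{n. (x, y) \<in> E ^^ n}. enat n)"

definition component :: "('v \<times> 'v) set \<Rightarrow> 'v \<Rightarrow> 'v set" where
  "component E x = {y. graph_dist E x y < \<infinity>}"

definition undirected_edges :: "('v \<times> 'v) set \<Rightarrow> 'v set set" where
  "undirected_edges E = (\<lambda>(x, y). {x, y}) ` E"

definition edge_density :: "'v set \<Rightarrow> ('v \<times> 'v) set \<Rightarrow> real" where
  "edge_density V E = real (card (undirected_edges E)) / real (card V)"


section \<open>Graphings\<close>

text \<open>The vertex set of the graphing is the whole Polish space \<open>'a\<close>; \<open>borel\<close> in the condition on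
  \<open>E\<close> is the Borel sigma-algebra of the product space.\<close>

definition graphing :: "nat \<Rightarrow> 'a::polish_space measure \<Rightarrow> ('a \<times> 'a) set \<Rightarrow> bool" where
  "graphing D M E \<longleftrightarrow>
     prob_space M \<and> sets M = sets borel \<and>
     simple_graph UNIV E \<and> E \<in> sets borel \<and> degree_bounded D UNIV E \<and>
     (\<forall>A\<in>sets M. \<forall>B\<in>sets M.
        (\<integral>\<^sup>+x\<in>A. of_nat (card (E `` {x} \<inter> B)) \<partial>M) = (\<integral>\<^sup>+x\<in>B. of_nat (card (E `` {x} \<inter> A)) \<partial>M))"

definition cost :: "'a::polish_space measure \<Rightarrow> ('a \<times> 'a) set \<Rightarrow> real" where
  "cost M E = 1/2 * Inf {\<integral>x. real (card (H `` {x})) \<partial>M | H D.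
     graphing D M H \<and> (AE x in M. component E x = component H x)}"


section \<open>Rooted coloured graphs up to isomorphism\<close>

record 'v rc_graph =
  verts :: "'v set"
  edges :: "('v \<times> 'v) set"
  rc_root :: 'v
  colour :: "'v \<Rightarrow> nat"

definition rc_wf :: "'v rc_graph \<Rightarrow> bool" where
  "rc_wf G \<longleftrightarrow> simple_graph (verts G) (edges G) \<and> rc_root G \<in> verts G"

text \<open>Only the colours of vertices matter; values of \<open>colour\<close> elsewhere are irrelevant.\<close>

definition rc_iso :: "'v rc_graph \<Rightarrow> 'w rc_graph \<Rightarrow> bool" where
  "rc_iso G H \<longleftrightarrow> (\<exists>f. bij_betw f (verts G) (verts H) \<and> f (rc_root G) = rc_root H \<and>
     (\<forall>x\<in>verts G. \<forall>y\<in>verts G. (x, y) \<in> edges G \<longleftrightarrow> (f x, f y) \<in> edges H) \<and>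
     (\<forall>x\<in>verts G. colour H (f x) = colour G x))"

text \<open>The isomorphism class of a countable rooted coloured graph is represented by the set of all its
  copies with vertices in \<open>nat\<close>. All graphs of bounded degree and finite radius are finite,
  so they have such copies.\<close>

definition iso_class :: "'v rc_graph \<Rightarrow> nat rc_graph set" where
  "iso_class G = {H. rc_wf H \<and> rc_iso G H}"

text \<open>The condition on distances from the root expresses both connectedness and the bound on
  the radius.\<close>

definition rc_bounded :: "nat \<Rightarrow> nat \<Rightarrow> nat \<Rightarrow> 'v rc_graph \<Rightarrow> bool" where
  "rc_bounded D r k G \<longleftrightarrow> rc_wf G \<and> degree_bounded D (verts G) (edges G) \<and>
     (\<forall>v\<in>verts G. graph_dist (edges G) (rc_root G) v \<le> enat r) \<and> colour G ` verts G \<subseteq> {1..k}"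

definition U_classes :: "nat \<Rightarrow> nat \<Rightarrow> nat \<Rightarrow> nat rc_graph set set" where
  "U_classes D r k = iso_class ` {G :: nat rc_graph. rc_bounded D r k G}"

definition ball_vertices :: "('v \<times> 'v) set \<Rightarrow> nat \<Rightarrow> 'v \<Rightarrow> 'v set" where
  "ball_vertices E r x = {y. graph_dist E x y \<le> enat r}"

definition coloured_ball :: "('v \<times> 'v) set \<Rightarrow> ('v \<Rightarrow> nat) \<Rightarrow> nat \<Rightarrow> 'v \<Rightarrow> 'v rc_graph" where
  "coloured_ball E \<phi> r x =
     \<lparr>verts = ball_vertices E r x,
      edges = E \<inter> (ball_vertices E r x \<times> ball_vertices E r x),
      rc_root = x, colour = \<phi>\<rparr>"


section \<open>Total variation and Hausdorff distance\<close>

definition tv_dist :: "'u set \<Rightarrow> 'u measure \<Rightarrow> 'u measure \<Rightarrow> real" where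
  "tv_dist U P Q = (SUP A\<in>Pow U. \<bar>measure P A - measure Q A\<bar>)"

abbreviation prob_measures :: "'u set \<Rightarrow> 'u measure set" where
  "prob_measures U \<equiv> space (prob_algebra (count_space U))"

abbreviation tv_topology :: "'u set \<Rightarrow> 'u measure topology" where
  "tv_topology U \<equiv> Metric_space.mtopology (prob_measures U) (tv_dist U)"

text \<open>Used for non-empty sets \<open>A\<close> and \<open>B\<close> and bounded \<open>d\<close> only.\<close>

definition hausdorff_dist :: "('b \<Rightarrow> 'b \<Rightarrow> real) \<Rightarrow> 'b set \<Rightarrow> 'b set \<Rightarrow> real" where
  "hausdorff_dist d A B = max (SUP a\<in>A. INF b\<in>B. d a b) (SUP b\<in>B. INF a\<in>A. d a b)"


section \<open>Local-global convergence\<close>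

text \<open>The vertex set is \<open>space M\<close>. For graphings \<open>M\<close> is the given Borel measure, for finite graphs it is
  the uniform measure on the vertex set, with all subsets measurable.\<close>

definition ball_distr ::
  "nat \<Rightarrow> nat \<Rightarrow> nat \<Rightarrow> 'v measure \<Rightarrow> ('v \<times> 'v) set \<Rightarrow> ('v \<Rightarrow> nat) \<Rightarrow> nat rc_graph set measure" where
  "ball_distr D r k M E \<phi> =
     distr M (count_space (U_classes D r k)) (\<lambda>x. iso_class (coloured_ball E \<phi> r x))"

definition Q_set ::
  "nat \<Rightarrow> nat \<Rightarrow> nat \<Rightarrow> 'v measure \<Rightarrow> ('v \<times> 'v) set \<Rightarrow> nat rc_graph set measure set" where
  "Q_set D r k M E =
     tv_topology (U_classes D r k) closure_of
       (ball_distr D r k M E ` (M \<rightarrow>\<^sub>M count_space {1..k}))"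

text \<open>There are no colourings with \<open>k = 0\<close> colours, so only \<open>k > 0\<close> is considered.\<close>

definition local_global_convergent ::
  "nat \<Rightarrow> (nat \<Rightarrow> 'v set) \<Rightarrow> (nat \<Rightarrow> ('v \<times> 'v) set) \<Rightarrow> bool" where
  "local_global_convergent D V G \<longleftrightarrow>
     (\<forall>r. \<forall>k>0. \<exists>K. K \<noteq> {} \<and> compactin (tv_topology (U_classes D r k)) K \<and>
        (\<lambda>n. hausdorff_dist (tv_dist (U_classes D r k))
                (Q_set D r k (uniform_count_measure (V n)) (G n)) K) \<longlonglongrightarrow> 0)"

definition local_global_limit ::
  "nat \<Rightarrow> (nat \<Rightarrow> 'v set) \<Rightarrow> (nat \<Rightarrow> ('v \<times> 'v) set) \<Rightarrow> 'a::polish_space measure \<Rightarrow> ('a \<times> 'a) set \<Rightarrow> bool"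
where
  "local_global_limit D V G M E \<longleftrightarrow>
     (\<forall>r. \<forall>k>0.
        (\<lambda>n. hausdorff_dist (tv_dist (U_classes D r k))
                (Q_set D r k (uniform_count_measure (V n)) (G n)) (Q_set D r k M E)) \<longlonglongrightarrow> 0)"


section \<open>Combinatorial cost\<close>

text \<open>The bi-Lipschitz inequalities are stated without division.\<close>

definition rewiring ::
  "(nat \<Rightarrow> 'v set) \<Rightarrow> (nat \<Rightarrow> ('v \<times> 'v) set) \<Rightarrow> (nat \<Rightarrow> ('v \<times> 'v) set) \<Rightarrow> bool" where
  "rewiring V G H \<longleftrightarrow> (\<forall>n. simple_graph (V n) (H n)) \<and>
     (\<exists>L::nat. L > 0 \<and> (\<forall>n. \<forall>x\<in>V n. \<forall>y\<in>V n.
        graph_dist (H n) x y \<le> enat L * graph_dist (G n) x y \<and>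
        graph_dist (G n) x y \<le> enat L * graph_dist (H n) x y))"

definition combinatorial_cost :: "(nat \<Rightarrow> 'v set) \<Rightarrow> (nat \<Rightarrow> ('v \<times> 'v) set) \<Rightarrow> ereal" where
  "combinatorial_cost V G =
     Inf {liminf (\<lambda>n. ereal (edge_density (V n) (H n))) | H. rewiring V G H}"


section \<open>Well-definedness\<close>

lemma graph_dist_le_iff: "graph_dist E x y \<le> enat r \<longleftrightarrow> (\<exists>n\<le>r. (x, y) \<in> E ^^ n)"
proof
  assume *: "graph_dist E x y \<le> enat r"
  let ?S = "enat ` {n. (x, y) \<in> E ^^ n}"
  have "?S \<noteq> {}"
  proof
    assume "?S = {}"
    then show False using * by (simp only: graph_dist_def) (simp add: top_enat_def)
  qed
  then have "Inf ?S \<in> ?S" unfolding Inf_enat_def by (auto intro: LeastI)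
  then show "\<exists>n\<le>r. (x, y) \<in> E ^^ n" using * by (auto simp: graph_dist_def)
next
  assume "\<exists>n\<le>r. (x, y) \<in> E ^^ n"
  then obtain n where "n \<le> r" "(x, y) \<in> E ^^ n" by blast
  then have "graph_dist E x y \<le> enat n" unfolding graph_dist_def by (intro INF_lower) auto
  then show "graph_dist E x y \<le> enat r" using \<open>n \<le> r\<close> order_trans by fastforce
qed

lemma component_eq: "component E x = E\<^sup>* `` {x}"
proof -
  have "graph_dist E x y < \<infinity> \<longleftrightarrow> (\<exists>r. graph_dist E x y \<le> enat r)" for y
    by (cases "graph_dist E x y") auto
  then have "graph_dist E x y < \<infinity> \<longleftrightarrow> (\<exists>n. (x, y) \<in> E ^^ n)" for y
    unfolding graph_dist_le_iff by blast
  then show ?thesis by (auto simp: component_def rtrancl_power)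
qed

lemma ball_vertices_0: "ball_vertices E 0 x = {x}"
  by (auto simp: ball_vertices_def graph_dist_le_iff)

lemma ball_vertices_Suc:
  "ball_vertices E (Suc r) x = insert x (\<Union>y\<in>ball_vertices E r x. E `` {y})"
proof (intro equalityI subsetI)
  fix z assume "z \<in> ball_vertices E (Suc r) x"
  then obtain n where n: "n \<le> Suc r" "(x, z) \<in> E ^^ n"
    by (auto simp: ball_vertices_def graph_dist_le_iff)
  show "z \<in> insert x (\<Union>y\<in>ball_vertices E r x. E `` {y})"
  proof (cases n)
    case 0
    then show ?thesis using n by auto
  next
    case (Suc m)
    then obtain y where "(x, y) \<in> E ^^ m" "(y, z) \<in> E" using n by auto
    then show ?thesis using Suc n by (auto simp: ball_vertices_def graph_dist_le_iff)
  qed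
next
  fix z assume "z \<in> insert x (\<Union>y\<in>ball_vertices E r x. E `` {y})"
  then consider "z = x" | y n where "n \<le> r" "(x, y) \<in> E ^^ n" "(y, z) \<in> E"
    by (auto simp: ball_vertices_def graph_dist_le_iff)
  then show "z \<in> ball_vertices E (Suc r) x"
  proof cases
    case 1
    then show ?thesis by (auto simp: ball_vertices_def graph_dist_le_iff intro!: exI[of _ 0])
  next
    case 2
    then have "(x, z) \<in> E ^^ Suc n" by auto
    then show ?thesis using 2 unfolding ball_vertices_def graph_dist_le_iff
      by (auto intro!: exI[of _ "Suc n"] simp del: relpow.simps)
  qed
qed

fun ball_bound :: "nat \<Rightarrow> nat \<Rightarrow> nat" where
  "ball_bound D 0 = 1"
| "ball_bound D (Suc r) = Suc (ball_bound D r * D)"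

lemma ball_vertices_bound:
  assumes "simple_graph V E" "degree_bounded D V E" "x \<in> V"
  shows "finite (ball_vertices E r x) \<and> card (ball_vertices E r x) \<le> ball_bound D r \<and>
    ball_vertices E r x \<subseteq> V"
proof (induction r)
  case 0
  then show ?case using assms by (simp add: ball_vertices_0)
next
  case (Suc r)
  let ?B = "ball_vertices E r x" and ?U = "\<Union>y\<in>ball_vertices E r x. E `` {y}"
  have deg: "finite (E `` {y})" "card (E `` {y}) \<le> D" if "y \<in> ?B" for y
    using Suc that assms(2) by (auto simp: degree_bounded_def)
  have fin: "finite ?U" using Suc deg by blast
  have "card ?U \<le> (\<Sum>y\<in>?B. card (E `` {y}))" using Suc by (intro card_UN_le) auto
  also have "\<dots> \<le> (\<Sum>y\<in>?B. D)" using deg by (intro sum_mono) auto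
  also have "\<dots> \<le> ball_bound D r * D" using Suc by simp
  finally have "card (insert x ?U) \<le> Suc (ball_bound D r * D)"
    using card_insert_le_m1 fin by (simp add: card_insert_if)
  then show ?case using fin assms unfolding ball_vertices_Suc by (auto simp: simple_graph_def)
qed

lemma rc_iso_sym:
  assumes "rc_iso G H" "rc_root G \<in> verts G"
  shows "rc_iso H G"
proof -
  obtain f where f: "bij_betw f (verts G) (verts H)" "f (rc_root G) = rc_root H"
    "\<And>x y. x \<in> verts G \<Longrightarrow> y \<in> verts G \<Longrightarrow> (x, y) \<in> edges G \<longleftrightarrow> (f x, f y) \<in> edges H"
    "\<And>x. x \<in> verts G \<Longrightarrow> colour H (f x) = colour G x"
    using assms(1) unfolding rc_iso_def by blast
  let ?g = "inv_into (verts G) f"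
  have g: "?g y \<in> verts G" "f (?g y) = y" if "y \<in> verts H" for y
    using f(1) that by (auto simp: bij_betw_def inv_into_into f_inv_into_f)
  have "?g (rc_root H) = rc_root G"
    using inv_into_f_f[OF bij_betw_imp_inj_on[OF f(1)] assms(2)] f(2) by simp
  moreover have "(x, y) \<in> edges H \<longleftrightarrow> (?g x, ?g y) \<in> edges G"
    if "x \<in> verts H" "y \<in> verts H" for x y
    using f(3)[OF g(1)[OF that(1)] g(1)[OF that(2)]] g(2)[OF that(1)] g(2)[OF that(2)] by simp
  moreover have "colour G (?g x) = colour H x" if "x \<in> verts H" for x
    using f(4)[OF g(1)[OF that]] g(2)[OF that] by simp
  ultimately show ?thesis
    unfolding rc_iso_def using bij_betw_inv_into[OF f(1)] by blast
qed

lemma rc_iso_trans: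
  assumes "rc_iso G H" "rc_iso H K"
  shows "rc_iso G K"
proof -
  obtain f where f: "bij_betw f (verts G) (verts H)" "f (rc_root G) = rc_root H"
    "\<And>x y. x \<in> verts G \<Longrightarrow> y \<in> verts G \<Longrightarrow> (x, y) \<in> edges G \<longleftrightarrow> (f x, f y) \<in> edges H"
    "\<And>x. x \<in> verts G \<Longrightarrow> colour H (f x) = colour G x"
    using assms(1) unfolding rc_iso_def by blast
  obtain g where g: "bij_betw g (verts H) (verts K)" "g (rc_root H) = rc_root K"
    "\<And>x y. x \<in> verts H \<Longrightarrow> y \<in> verts H \<Longrightarrow> (x, y) \<in> edges H \<longleftrightarrow> (g x, g y) \<in> edges K"
    "\<And>x. x \<in> verts H \<Longrightarrow> colour K (g x) = colour H x"
    using assms(2) unfolding rc_iso_def by blast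
  have "f x \<in> verts H" if "x \<in> verts G" for x using f(1) that by (auto simp: bij_betw_def)
  then show ?thesis unfolding rc_iso_def
    using f g bij_betw_trans[OF f(1) g(1)] by (intro exI[of _ "g \<circ> f"]) auto
qed

lemma iso_class_eq:
  assumes "rc_iso G H" "rc_root G \<in> verts G"
  shows "iso_class G = iso_class H"
proof -
  have "rc_iso G K \<longleftrightarrow> rc_iso H K" for K :: "nat rc_graph"
    using assms(1) rc_iso_sym[OF assms] rc_iso_trans[of G H K] rc_iso_trans[of H G K] by blast
  then show ?thesis by (simp add: iso_class_def)
qed

lemma rc_bounded_finite:
  assumes "rc_bounded D r k G"
  shows "finite (verts G)" "card (verts G) \<le> ball_bound D r"
proof -
  have "verts G \<subseteq> ball_vertices (edges G) r (rc_root G)"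
    using assms by (auto simp: rc_bounded_def ball_vertices_def)
  moreover have "finite (ball_vertices (edges G) r (rc_root G)) \<and>
      card (ball_vertices (edges G) r (rc_root G)) \<le> ball_bound D r"
    using ball_vertices_bound[of "verts G" "edges G" D "rc_root G" r] assms
    by (auto simp: rc_bounded_def rc_wf_def)
  ultimately show "finite (verts G)" "card (verts G) \<le> ball_bound D r"
    by (meson card_mono finite_subset order_trans)+
qed

text \<open>Every finite rooted coloured graph has a copy on an initial segment of \<open>nat\<close>.\<close>

lemma rc_copy:
  fixes G :: "'v rc_graph"
  assumes "rc_wf G" "finite (verts G)"
  obtains H :: "nat rc_graph" and f where "rc_wf H" "verts H = {..<card (verts G)}"
    "bij_betw f (verts G) (verts H)" "f (rc_root G) = rc_root H"
    "edges H = (\<lambda>(x, y). (f x, f y)) ` edges G"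
    "colour H = (\<lambda>i. if i < card (verts G) then colour G (inv_into (verts G) f i) else 0)"
    "rc_iso G H"
proof -
  obtain f where f: "bij_betw f (verts G) {..<card (verts G)}"
    using ex_bij_betw_finite_nat[OF assms(2)] by (auto simp: atLeast0LessThan)
  define H :: "nat rc_graph" where "H = \<lparr>verts = {..<card (verts G)},
    edges = (\<lambda>(x, y). (f x, f y)) ` edges G, rc_root = f (rc_root G),
    colour = (\<lambda>i. if i < card (verts G) then colour G (inv_into (verts G) f i) else 0)\<rparr>"
  have inj: "inj_on f (verts G)" and im: "f x < card (verts G)" if "x \<in> verts G" for x
    using f that by (auto simp: bij_betw_def)
  have inj: "inj_on f (verts G)" using f by (simp add: bij_betw_def)
  have sub: "edges G \<subseteq> verts G \<times> verts G" "sym (edges G)" "irrefl (edges G)" "rc_root G \<in> verts G"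
    using assms by (auto simp: rc_wf_def simple_graph_def)
  have ed: "(f x, f y) \<in> edges H \<longleftrightarrow> (x, y) \<in> edges G" if "x \<in> verts G" "y \<in> verts G" for x y
  proof
    assume "(f x, f y) \<in> edges H"
    then obtain a b where ab: "(a, b) \<in> edges G" "f x = f a" "f y = f b" by (auto simp: H_def)
    then have "x = a" "y = b" using inj_onD[OF inj] sub(1) that by blast+
    then show "(x, y) \<in> edges G" using ab by simp
  qed (force simp: H_def)
  have "simple_graph (verts H) (edges H)"
    unfolding simple_graph_def
  proof (intro conjI)
    show "edges H \<subseteq> verts H \<times> verts H" using sub im by (fastforce simp: H_def)
    show "sym (edges H)" using sub(2) by (fastforce simp: H_def sym_def)
    show "irrefl (edges H)" using sub(1,3) inj by (fastforce simp: H_def irrefl_def inj_on_def)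
  qed
  then have wf: "rc_wf H" using im sub(4) by (auto simp: rc_wf_def H_def)
  have iso: "rc_iso G H"
    unfolding rc_iso_def using ed f im inj by (intro exI[of _ f]) (auto simp: H_def)
  show ?thesis
    by (rule that[of H f]) (use wf iso f in \<open>auto simp: H_def\<close>)
qed

lemma relpow_map:
  assumes "(x, y) \<in> E ^^ n" "\<And>a b. (a, b) \<in> E \<Longrightarrow> (f a, f b) \<in> F"
  shows "(f x, f y) \<in> F ^^ n"
  using assms(1) by (induction n arbitrary: y) (use assms(2) in auto)

lemma rc_bounded_copy:
  fixes G :: "'v rc_graph"
  assumes "rc_bounded D r k G"
  obtains H :: "nat rc_graph" where "rc_bounded D r k H" "rc_iso G H"
    "verts H \<subseteq> {..<ball_bound D r}" "\<And>i. i \<notin> verts H \<Longrightarrow> colour H i = 0"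
proof -
  have wf: "rc_wf G" using assms by (simp add: rc_bounded_def)
  obtain H f where H: "rc_wf H" "verts H = {..<card (verts G)}"
    "bij_betw f (verts G) (verts H)" "f (rc_root G) = rc_root H"
    "edges H = (\<lambda>(x, y). (f x, f y)) ` edges G"
    "colour H = (\<lambda>i. if i < card (verts G) then colour G (inv_into (verts G) f i) else 0)"
    "rc_iso G H"
    using rc_copy[OF wf rc_bounded_finite(1)[OF assms]] .
  have sub: "edges G \<subseteq> verts G \<times> verts G" using wf by (auto simp: rc_wf_def simple_graph_def)
  have surj: "\<exists>x\<in>verts G. v = f x" if "v \<in> verts H" for v
    using H(3) that by (auto simp: bij_betw_def)
  have inj: "inj_on f (verts G)" using H(3) by (simp add: bij_betw_def)
  have "finite (edges H `` {v}) \<and> card (edges H `` {v}) \<le> D" if v: "v \<in> verts H" for v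
  proof -
    obtain x where x: "x \<in> verts G" "v = f x" using surj[OF v] by blast
    have "edges H `` {v} \<subseteq> f ` (edges G `` {x})"
      using x sub inj_onD[OF inj] by (fastforce simp: H(5))
    moreover have "finite (edges G `` {x})" "card (edges G `` {x}) \<le> D"
      using assms x by (auto simp: rc_bounded_def degree_bounded_def)
    ultimately show ?thesis
      by (meson card_image_le card_mono finite_imageI finite_subset order_trans)
  qed
  moreover have "graph_dist (edges H) (rc_root H) v \<le> enat r" if v: "v \<in> verts H" for v
  proof -
    obtain x where x: "x \<in> verts G" "v = f x" using surj[OF v] by blast
    then obtain n where "n \<le> r" "(rc_root G, x) \<in> edges G ^^ n"
      using assms by (auto simp: rc_bounded_def graph_dist_le_iff)
    moreover have "(f (rc_root G), f x) \<in> edges H ^^ n"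
      using \<open>(rc_root G, x) \<in> edges G ^^ n\<close> by (rule relpow_map) (force simp: H(5))
    ultimately show ?thesis using x H(4) by (auto simp: graph_dist_le_iff)
  qed
  moreover have "colour H v \<in> {1..k}" if v: "v \<in> verts H" for v
  proof -
    have "inv_into (verts G) f v \<in> verts G" using surj[OF v] by (auto intro: inv_into_into)
    then have "colour G (inv_into (verts G) f v) \<in> {1..k}"
      using assms unfolding rc_bounded_def by blast
    then show ?thesis using v by (simp add: H(2,6))
  qed
  ultimately have "rc_bounded D r k H"
    using H(1) unfolding rc_bounded_def degree_bounded_def by blast
  then show ?thesis
    using rc_bounded_finite(2)[OF assms] H(2,6,7) by (intro that[of H]) auto
qed

lemma finite_U_classes: "finite (U_classes D r k)"
proof -
  let ?N = "{..<ball_bound D r}"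
  let ?C = "{c :: nat \<Rightarrow> nat. \<forall>i. (i \<in> ?N \<longrightarrow> c i \<in> {0..k}) \<and> (i \<notin> ?N \<longrightarrow> c i = 0)}"
  let ?T = "Pow ?N \<times> Pow (?N \<times> ?N) \<times> ?N \<times> ?C"
  let ?mk = "\<lambda>(V, E, x, c). \<lparr>verts = V, edges = E, rc_root = x, colour = c\<rparr>"
  have "finite ?C" by (rule finite_set_of_finite_funs) simp_all
  then have "finite ?T" by simp
  moreover have "U_classes D r k \<subseteq> (\<lambda>t. iso_class (?mk t)) ` ?T"
  proof
    fix u assume "u \<in> U_classes D r k"
    then obtain G :: "nat rc_graph" where G: "rc_bounded D r k G" "u = iso_class G"
      by (auto simp: U_classes_def)
    obtain H :: "nat rc_graph" where H: "rc_bounded D r k H" "rc_iso G H" "verts H \<subseteq> ?N"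
      "\<And>i. i \<notin> verts H \<Longrightarrow> colour H i = 0"
      by (rule rc_bounded_copy[OF G(1)]) blast
    have "u = iso_class H"
      unfolding G(2) using G(1) H(2) by (intro iso_class_eq) (simp_all add: rc_bounded_def rc_wf_def)
    then have "u = iso_class (?mk (verts H, edges H, rc_root H, colour H))" by (cases H) simp
    moreover have "(verts H, edges H, rc_root H, colour H) \<in> ?T"
    proof -
      have wf: "edges H \<subseteq> verts H \<times> verts H" "rc_root H \<in> verts H"
        using H(1) by (simp_all add: rc_bounded_def rc_wf_def simple_graph_def)
      have "colour H i \<le> k" if "i \<in> verts H" for i
        using H(1) that unfolding rc_bounded_def by (simp add: image_subset_iff)
      then have "colour H i \<in> {0..k}" for i
        using H(4)[of i] by (cases "i \<in> verts H") simp_all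
      moreover have "colour H i = 0" if "i \<notin> ?N" for i
        using H(3) H(4)[of i] that by blast
      ultimately have "colour H \<in> ?C" by blast
      moreover have "edges H \<in> Pow (?N \<times> ?N)" "rc_root H \<in> ?N" using wf H(3) by blast+
      ultimately show ?thesis using H(3) by blast
    qed
    ultimately show "u \<in> (\<lambda>t. iso_class (?mk t)) ` ?T" by (rule image_eqI)
  qed
  ultimately show ?thesis by (rule finite_surj)
qed

lemma relpow_ball:
  assumes "(x, y) \<in> E ^^ n" "n \<le> r"
  shows "(x, y) \<in> (E \<inter> (ball_vertices E r x \<times> ball_vertices E r x)) ^^ n"
  using assms
proof (induction n arbitrary: y)
  case 0
  then show ?case by simp
next
  case (Suc n)
  then obtain z where z: "(x, z) \<in> E ^^ n" "(z, y) \<in> E" by auto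
  then have "z \<in> ball_vertices E r x" "y \<in> ball_vertices E r x"
    using Suc.prems unfolding ball_vertices_def graph_dist_le_iff
    by (auto intro: exI[of _ n] exI[of _ "Suc n"] simp del: relpow.simps)
  then show ?case using Suc.IH[OF z(1)] Suc.prems z by auto
qed

lemma iso_class_coloured_ball:
  assumes "simple_graph V E" "degree_bounded D V E" "x \<in> V" "\<phi> \<in> V \<rightarrow> {1..k}"
  shows "iso_class (coloured_ball E \<phi> r x) \<in> U_classes D r k"
proof -
  let ?B = "coloured_ball E \<phi> r x"
  have sub: "ball_vertices E r x \<subseteq> V" using ball_vertices_bound[OF assms(1-3)] by blast
  have x: "x \<in> ball_vertices E r x"
    by (auto simp: ball_vertices_def graph_dist_le_iff intro!: exI[of _ 0])
  have "finite (edges ?B `` {y}) \<and> card (edges ?B `` {y}) \<le> D" if "y \<in> verts ?B" for y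
  proof -
    have "edges ?B `` {y} \<subseteq> E `` {y}" by (auto simp: coloured_ball_def)
    moreover have "finite (E `` {y})" "card (E `` {y}) \<le> D"
      using assms(2) that sub by (auto simp: degree_bounded_def coloured_ball_def)
    ultimately show ?thesis by (meson card_mono finite_subset order_trans)
  qed
  moreover have "graph_dist (edges ?B) x y \<le> enat r" if y: "y \<in> verts ?B" for y
  proof -
    obtain n where n: "n \<le> r" "(x, y) \<in> E ^^ n"
      using y unfolding coloured_ball_def by (auto simp: ball_vertices_def graph_dist_le_iff)
    then show ?thesis using relpow_ball[OF n(2,1)]
      by (auto simp: coloured_ball_def graph_dist_le_iff)
  qed
  moreover have "rc_wf ?B"
    using assms(1) x by (auto simp: rc_wf_def simple_graph_def coloured_ball_def sym_def irrefl_def)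
  moreover have "colour ?B ` verts ?B \<subseteq> {1..k}"
    using assms(4) sub by (auto simp: coloured_ball_def)
  ultimately have B: "rc_bounded D r k ?B"
    unfolding rc_bounded_def degree_bounded_def by (auto simp: coloured_ball_def)
  obtain H :: "nat rc_graph" where H: "rc_bounded D r k H" "rc_iso ?B H"
    using rc_bounded_copy[OF B] by metis
  have "iso_class ?B = iso_class H"
    using B H(2) by (intro iso_class_eq) (auto simp: rc_bounded_def rc_wf_def)
  then show ?thesis using H(1) by (auto simp: U_classes_def)
qed

lemma Metric_space_tv_dist:
  assumes U: "finite U"
  shows "Metric_space (prob_measures U) (tv_dist U)"
proof
  have fin: "finite (f ` Pow U)" for f :: "'a set \<Rightarrow> real" using U by simp
  have le: "\<bar>measure P A - measure Q A\<bar> \<le> tv_dist U P Q" if "A \<subseteq> U" for P Q A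
    unfolding tv_dist_def using that fin by (intro cSUP_upper bdd_above_finite) auto
  fix P Q R :: "'a measure"
  show "0 \<le> tv_dist U P Q" using le[of "{}" P Q] by simp
  show "tv_dist U P Q = tv_dist U Q P" by (simp add: tv_dist_def abs_minus_commute)
  show "tv_dist U P Q = 0 \<longleftrightarrow> P = Q" if "P \<in> prob_measures U" "Q \<in> prob_measures U"
  proof
    assume "P = Q"
    then show "tv_dist U P Q = 0" by (simp add: tv_dist_def cSUP_const[OF Pow_not_empty])
  next
    assume 0: "tv_dist U P Q = 0"
    have s: "sets P = Pow U" "sets Q = Pow U" "prob_space P" "prob_space Q"
      using that by (auto simp: space_prob_algebra)
    then interpret P: prob_space P + Q: prob_space Q by auto
    show "P = Q"
    proof (rule measure_eqI)
      fix A assume "A \<in> sets P"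
      then have "measure P A = measure Q A" using le[of A P Q] 0 s by auto
      then show "emeasure P A = emeasure Q A"
        by (simp add: P.emeasure_eq_measure Q.emeasure_eq_measure)
    qed (simp add: s)
  qed
  show "tv_dist U P R \<le> tv_dist U P Q + tv_dist U Q R"
    unfolding tv_dist_def[of U P R]
  proof (rule cSUP_least)
    fix A assume "A \<in> Pow U"
    then show "\<bar>measure P A - measure R A\<bar> \<le> tv_dist U P Q + tv_dist U Q R"
      using le[of A P Q] le[of A Q R] by auto
  qed auto
qed

end

theory Submission
  imports Defs "HOL-Analysis.Analysis"
begin

text \<open>Both inequalities follow from one transfer principle. Let \<open>H\<close> be \<open>L\<close>-bi-Lipschitz equivalent to a
  bounded degree graph \<open>G\<close>. A proper colouring of the \<open>2L\<close>-th power of \<open>G\<close> with boundedly many colours,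
  refined by the set of colours of the \<open>H\<close>-neighbours of each vertex, encodes \<open>H\<close>, and \<open>H\<close> is recovered
  from the coloured graph by a local rule which yields an \<open>L\<close>-bi-Lipschitz equivalent graph for every
  colouring. Replacing the colouring by one on another graph with nearly the same local statistics
  thus moves rewirings from the graphing to the finite graphs and back, almost preserving the edge
  density. On the graphing side, any \<open>H \<sim> G\<close> is approximated by bi-Lipschitz equivalent graphings.

  Borel measurability of local rules rests on the fact that a Borel relation with sections of bounded
  size is covered by finitely many Borel functions, which is derived from Lusin's separation of
  disjoint analytic sets. That the constructed graphings conserve mass follows by decomposing
  them into injective maps moving along boundedly many edges of the given graphing.\<close>

section \<open>Separation of analytic sets and Borel sets with bounded sections\<close>

text \<open>Equality of components, the only condition in the cost of a graphing, bounds no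
  distances, while a rewiring needs one constant \<open>L\<close> for all n. Hence cost is first
  approximated by bi-Lipschitz equivalent graphings, and from then on \<open>L\<close> is fixed. The
  repair is what makes decoding safe for every colouring: an arbitrary colouring decodes to some set
  of pairs at distance at most \<open>L\<close>, which need not connect neighbours in the original
  graph, so an edge is put back wherever the decoded graph offers no path of at most
  \<open>L\<close> pairs between its ends. For the encoding of an \<open>L\<close>-bi-Lipschitz
  equivalent graph nothing is put back. Whether such a path exists is decided within radius
  \<open>L * L\<close>, as each of its at most \<open>L\<close> pairs spans at most \<open>L\<close>
  edges; so only statistics of that radius, with \<open>colour_count D L\<close> colours, are
  compared. All degrees obtained are at most \<open>ball_bound D L\<close>, so a mean degree is a
  sum of that many tail probabilities and changes by at most that factor times the total variation
  distance. Finite graphs and graphings are both instances of \<open>enumerated_graph\<close>, so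
  one lemma transfers in both directions.\<close>

definition closed_projection :: "'z::topological_space set \<Rightarrow> bool" where
  "closed_projection S \<longleftrightarrow> (\<exists>F::('z \<times> (nat \<Rightarrow> nat discrete)) set. closed F \<and> S = fst ` F)"

lemma closed_projection_closed: "closed S \<Longrightarrow> closed_projection S"
  unfolding closed_projection_def
  by (intro exI[of _ "S \<times> UNIV"]) (auto intro: closed_Times simp: image_iff)

text \<open>The type \<open>nat \<Rightarrow> nat discrete\<close> is Baire space, so
  \<open>closed_projection\<close> describes analytic sets. For a union, coordinate 0 of the witness
  names the set \<open>S n\<close> and the shifted remaining coordinates witness membership in it.
  Writing this as an intersection of implications keeps it closed, because singletons of
  \<open>nat discrete\<close> are open.\<close>

lemma closed_projection_UN:
  fixes S :: "nat \<Rightarrow> 'z::topological_space set"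
  assumes "\<And>n. closed_projection (S n)"
  shows "closed_projection (\<Union>n. S n)"
proof -
  obtain F :: "nat \<Rightarrow> ('z \<times> (nat \<Rightarrow> nat discrete)) set" where F: "\<And>n. closed (F n)" "\<And>n. S n = fst ` F n"
    using assms unfolding closed_projection_def by metis
  let ?g = "\<lambda>p::'z \<times> (nat \<Rightarrow> nat discrete). (fst p, \<lambda>k. snd p (Suc k))"
  have coord: "continuous_on UNIV (\<lambda>p::'z \<times> (nat \<Rightarrow> nat discrete). snd p k)" for k
    by (rule continuous_on_product_then_coordinatewise) (intro continuous_intros)
  have "continuous_on UNIV ?g"
    by (intro continuous_intros coord)
  then have "closed (?g -` F n)" for n
    using F(1) by (simp add: closed_vimage)
  moreover have "closed ((\<lambda>p::'z \<times> (nat \<Rightarrow> nat discrete). snd p 0) -` (- {discrete n}))" for n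
    by (intro closed_vimage coord) (simp add: closed_def open_discrete)
  ultimately have "closed (\<Inter>n. (\<lambda>p. snd p 0) -` (- {discrete n}) \<union> ?g -` F n)"
    by (intro closed_INT ballI closed_Un)
  moreover have "(\<Union>n. S n) = fst ` (\<Inter>n. (\<lambda>p. snd p 0) -` (- {discrete n}) \<union> ?g -` F n)"
  proof (intro equalityI subsetI)
    fix z assume "z \<in> (\<Union>n. S n)"
    then obtain n \<alpha> where "(z, \<alpha>) \<in> F n" using F(2) by auto
    then have "(z, case_nat (discrete n) \<alpha>) \<in> (\<Inter>n. (\<lambda>p. snd p 0) -` (- {discrete n}) \<union> ?g -` F n)"
      by (auto simp: discrete_inject)
    then show "z \<in> fst ` (\<Inter>n. (\<lambda>p. snd p 0) -` (- {discrete n}) \<union> ?g -` F n)" by (rule image_eqI[rotated]) simp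
  next
    fix z assume "z \<in> fst ` (\<Inter>n. (\<lambda>p. snd p 0) -` (- {discrete n}) \<union> ?g -` F n)"
    then obtain \<alpha> where \<alpha>: "\<And>n. \<alpha> 0 = discrete n \<Longrightarrow> (z, \<lambda>k. \<alpha> (Suc k)) \<in> F n" by auto
    have "z \<in> S (of_discrete (\<alpha> 0))"
      using \<alpha>[of "of_discrete (\<alpha> 0)"] F(2)[of "of_discrete (\<alpha> 0)"]
      by (metis fst_conv image_eqI of_discrete_inverse)
    then show "z \<in> (\<Union>n. S n)" by blast
  qed
  ultimately show ?thesis unfolding closed_projection_def by blast
qed

text \<open>A single point of Baire space carries a whole sequence of witnesses: the one for
  \<open>S n\<close> sits at the coordinates \<open>prod_encode (n, k)\<close>.\<close>

lemma closed_projection_INT: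
  fixes S :: "nat \<Rightarrow> 'z::topological_space set"
  assumes "\<And>n. closed_projection (S n)"
  shows "closed_projection (\<Inter>n. S n)"
proof -
  obtain F :: "nat \<Rightarrow> ('z \<times> (nat \<Rightarrow> nat discrete)) set" where F: "\<And>n. closed (F n)" "\<And>n. S n = fst ` F n"
    using assms unfolding closed_projection_def by metis
  let ?g = "\<lambda>n (p::'z \<times> (nat \<Rightarrow> nat discrete)). (fst p, \<lambda>k. snd p (prod_encode (n, k)))"
  have coord: "continuous_on UNIV (\<lambda>p::'z \<times> (nat \<Rightarrow> nat discrete). snd p k)" for k
    by (rule continuous_on_product_then_coordinatewise) (intro continuous_intros)
  have "continuous_on UNIV (?g n)" for n
    by (intro continuous_intros coord)
  then have "closed (?g n -` F n)" for n
    using F(1) by (simp add: closed_vimage)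
  then have "closed (\<Inter>n. ?g n -` F n)"
    by (intro closed_INT ballI)
  moreover have "(\<Inter>n. S n) = fst ` (\<Inter>n. ?g n -` F n)"
  proof (intro equalityI subsetI)
    fix z assume "z \<in> (\<Inter>n. S n)"
    then have "\<forall>n. \<exists>\<alpha>. (z, \<alpha>) \<in> F n" using F(2) by fastforce
    then obtain \<alpha> where \<alpha>: "\<And>n. (z, \<alpha> n) \<in> F n" by metis
    let ?\<beta> = "\<lambda>j. case prod_decode j of (n, k) \<Rightarrow> \<alpha> n k"
    have "(z, ?\<beta>) \<in> (\<Inter>n. ?g n -` F n)" using \<alpha> by simp
    then show "z \<in> fst ` (\<Inter>n. ?g n -` F n)" by (rule image_eqI[rotated]) simp
  next
    fix z assume "z \<in> fst ` (\<Inter>n. ?g n -` F n)"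
    then obtain \<alpha> where "\<And>n. (z, \<lambda>k. \<alpha> (prod_encode (n, k))) \<in> F n" by auto
    then have "z \<in> S n" for n unfolding F(2) by (metis fst_conv image_eqI)
    then show "z \<in> (\<Inter>n. S n)" by blast
  qed
  ultimately show ?thesis unfolding closed_projection_def by blast
qed

lemma closed_projection_open:
  fixes S :: "'z::metric_space set"
  assumes "open S"
  shows "closed_projection S"
\<comment> \<open>A proper open set is the union of the closed sets of points at distance at least
  1/(n+1) from its complement. The whole space is treated apart because \<open>infdist\<close> to
  the empty set is 0.\<close>
proof (cases "S = UNIV")
  case True
  then show ?thesis by (simp add: closed_projection_closed)
next
  case False
  have "S = (\<Union>n. {x. infdist x (- S) \<ge> 1 / real (Suc n)})"
  proof (intro equalityI subsetI)
    fix x assume "x \<in> S"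
    then have "infdist x (- S) > 0"
      using infdist_pos_not_in_closed[of "- S" x] assms False by (auto simp: closed_def)
    then obtain n where "inverse (real (Suc n)) < infdist x (- S)" using reals_Archimedean by blast
    then show "x \<in> (\<Union>n. {x. infdist x (- S) \<ge> 1 / real (Suc n)})"
      by (auto simp: inverse_eq_divide intro!: exI[of _ n])
  next
    fix x assume "x \<in> (\<Union>n. {x. infdist x (- S) \<ge> 1 / real (Suc n)})"
    then obtain n where "infdist x (- S) \<ge> 1 / real (Suc n)" by blast
    then have "infdist x (- S) > 0" by (smt (verit) divide_pos_pos of_nat_0_less_iff zero_less_Suc)
    then show "x \<in> S" by (metis ComplI infdist_zero less_irrefl)
  qed
  moreover have "closed_projection (\<Union>n. {x. infdist x (- S) \<ge> 1 / real (Suc n)})"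
    by (intro closed_projection_UN closed_projection_closed closed_Collect_le continuous_intros)
  ultimately show ?thesis by simp
qed

text \<open>Analytic sets are not closed under complements, so the induction over the sigma-algebra
  carries the claim for a set and for its complement together.\<close>

lemma closed_projection_borel:
  fixes S :: "'z::metric_space set"
  assumes "S \<in> sets borel"
  shows "closed_projection S"
proof -
  have "S \<in> sigma_sets UNIV {S. open S}" using assms by (simp add: borel_def)
  then have "closed_projection S \<and> closed_projection (- S)"
  proof induction
    case (Basic a)
    then show ?case by (auto intro: closed_projection_open closed_projection_closed)
  next
    case Empty
    then show ?case by (auto intro: closed_projection_closed)
  next
    case (Compl a)
    then show ?case by (simp add: Compl_eq_Diff_UNIV[symmetric])
  next
    case (Union a)
    moreover have "- (\<Union>i. a i) = (\<Inter>i. - a i)" by blast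
    ultimately show ?case by (simp add: closed_projection_UN closed_projection_INT)
  qed
  then show ?thesis by blast
qed

section \<open>Lusin separation\<close>

definition borel_separated :: "'x::topological_space set \<Rightarrow> 'x set \<Rightarrow> bool" where
  "borel_separated P Q \<longleftrightarrow> (\<exists>B\<in>sets borel. P \<subseteq> B \<and> Q \<inter> B = {})"

text \<open>From separators of the single pairs one forms a countable union of countable
  intersections. It is used contrapositively: if two unions cannot be separated, neither can some
  pair of pieces.\<close>

lemma borel_separated_UN:
  assumes "\<And>(m::nat) (n::nat). borel_separated (P m) (Q n)"
  shows "borel_separated (\<Union>m. P m) (\<Union>n. Q n)"
proof -
  obtain B where B: "\<And>m n. B m n \<in> sets borel" "\<And>m n. P m \<subseteq> B m n" "\<And>m n. Q n \<inter> B m n = {}"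
    using assms unfolding borel_separated_def by metis
  have "(\<Inter>n. B m n) \<in> sets borel" for m using B(1) by (intro sets.countable_INT) auto
  then have "(\<Union>m. \<Inter>n. B m n) \<in> sets borel" by (intro sets.countable_UN'') auto
  moreover have "(\<Union>m. P m) \<subseteq> (\<Union>m. \<Inter>n. B m n)" using B(2) by blast
  moreover have "(\<Union>n. Q n) \<inter> (\<Union>m. \<Inter>n. B m n) = {}" using B(3) by blast
  ultimately show ?thesis unfolding borel_separated_def by blast
qed

lemma dense_sequence:
  obtains d :: "nat \<Rightarrow> 'z::{metric_space, second_countable_topology}"
  where "\<And>x e. 0 < e \<Longrightarrow> \<exists>m. dist (d m) x < e"
proof -
  obtain X :: "'z set" where X: "countable X" "\<And>U. open U \<Longrightarrow> U \<noteq> {} \<Longrightarrow> \<exists>d\<in>X. d \<in> U"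
    by (rule countable_dense_setE) blast
  then have ne: "X \<noteq> {}" using X(2)[of UNIV] by auto
  have "\<exists>m. dist (from_nat_into X m) x < e" if "0 < e" for x e
  proof -
    obtain y where "y \<in> X" "y \<in> ball x e" using X(2)[of "ball x e"] \<open>0 < e\<close> by auto
    then show ?thesis using from_nat_into_surj[OF X(1), of y] by (auto simp: dist_commute)
  qed
  then show thesis by (rule that)
qed

text \<open>If no separating set exists, the two closed sets can be shrunk successively to points, the
  images of which are separated by disjoint open sets.\<close>

lemma closed_images_separated:
  fixes h :: "'z::{complete_space, second_countable_topology} \<Rightarrow> 'x::t2_space"
  assumes h: "continuous_on UNIV h" and cl: "closed F" "closed G" and disj: "h ` F \<inter> h ` G = {}"
  shows "borel_separated (h ` F) (h ` G)"
proof (rule ccontr)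
  assume ns: "\<not> ?thesis"
  obtain d :: "nat \<Rightarrow> 'z" where d: "\<And>x e. 0 < e \<Longrightarrow> \<exists>m. dist (d m) x < e"
    using dense_sequence by blast
  \<comment> \<open>The state of the recursion is a pair of closed sets that are not separated; the
    clause for n = 0 fixes the start, and \<open>?Q\<close> puts both sets of the next stage into
    balls of radius 1/(n+1).\<close>
  let ?P = "\<lambda>(n::nat) (A, B). closed A \<and> closed B \<and> \<not> borel_separated (h ` A) (h ` B) \<and>
    (n = 0 \<longrightarrow> A = F \<and> B = G)"
  let ?Q = "\<lambda>n (A, B) (A', B'). A' \<subseteq> A \<and> B' \<subseteq> B \<and>
    (\<exists>a. A' \<subseteq> cball a (1 / real (Suc n))) \<and> (\<exists>a. B' \<subseteq> cball a (1 / real (Suc n)))"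
  have "\<exists>f. \<forall>n. ?P n (f n) \<and> ?Q n (f n) (f (Suc n))"
  proof (rule dependent_nat_choice)
    show "\<exists>x. ?P 0 x" using ns cl by auto
  next
    fix x n assume x: "?P n x"
    obtain A B where AB: "x = (A, B)" by (cases x)
    let ?A = "\<lambda>m. A \<inter> cball (d m) (1 / real (Suc n))"
    let ?B = "\<lambda>m. B \<inter> cball (d m) (1 / real (Suc n))"
    have "\<exists>m. y \<in> cball (d m) (1 / real (Suc n))" for y
      using d[of "1 / real (Suc n)" y] by (auto intro: less_imp_le)
    then have cover: "S = (\<Union>m. S \<inter> cball (d m) (1 / real (Suc n)))" for S by blast
    have "\<not> (\<forall>m m'. borel_separated (h ` ?A m) (h ` ?B m'))"
    proof
      assume "\<forall>m m'. borel_separated (h ` ?A m) (h ` ?B m')"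
      then have "borel_separated (\<Union>m. h ` ?A m) (\<Union>m. h ` ?B m)"
        by (intro borel_separated_UN) blast
      then have "borel_separated (h ` A) (h ` B)"
        using cover[of A] cover[of B] by (metis image_UN)
      then show False using x AB by simp
    qed
    then obtain m m' where "\<not> borel_separated (h ` ?A m) (h ` ?B m')" by blast
    then show "\<exists>y. ?P (Suc n) y \<and> ?Q n x y"
      using x AB by (intro exI[of _ "(?A m, ?B m')"]) auto
  qed
  then obtain f where "\<forall>n. ?P n (f n) \<and> ?Q n (f n) (f (Suc n))" by (rule exE)
  note * = this[THEN spec]
  have f1: "?P n (f n)" and f2: "?Q n (f n) (f (Suc n))" for n
    using *[of n] by (rule conjunct1) (use *[of n] in \<open>rule conjunct2\<close>)
  define A where "A n = fst (f n)" for n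
  define B where "B n = snd (f n)" for n
  have P: "closed (A n)" "closed (B n)" "\<not> borel_separated (h ` A n) (h ` B n)" for n
    using f1[of n] by (auto simp: A_def B_def split: prod.splits)
  have Q: "A (Suc n) \<subseteq> A n" "B (Suc n) \<subseteq> B n" "\<exists>a. A (Suc n) \<subseteq> cball a (1 / real (Suc n))"
    "\<exists>a. B (Suc n) \<subseteq> cball a (1 / real (Suc n))" for n
    using f2[of n] by (auto simp: A_def B_def split: prod.splits)
  have AF: "A 0 = F" and BG: "B 0 = G" using f1[of 0] by (auto simp: A_def B_def split: prod.splits)
  have ne: "A n \<noteq> {}" "B n \<noteq> {}" for n
    using P(3)[of n] by (auto simp: borel_separated_def)
  have small: "\<exists>n. \<forall>x\<in>S n. \<forall>y\<in>S n. dist x y < e"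
    if "0 < e" and S: "\<And>n. \<exists>a. S (Suc n) \<subseteq> cball a (1 / real (Suc n))" for e and S :: "nat \<Rightarrow> 'z set"
  proof -
    obtain n where n: "inverse (real (Suc n)) < e / 2" using reals_Archimedean \<open>0 < e\<close> half_gt_zero by blast
    obtain a where a: "S (Suc n) \<subseteq> cball a (1 / real (Suc n))" using S by blast
    have "dist x y < e" if "x \<in> S (Suc n)" "y \<in> S (Suc n)" for x y
    proof -
      have "dist x a \<le> inverse (real (Suc n))" "dist a y \<le> inverse (real (Suc n))"
        using a that by (auto simp: inverse_eq_divide dist_commute mem_cball subset_iff)
      then show ?thesis using dist_triangle[of x y a] n by linarith
    qed
    then show ?thesis by blast
  qed
  have "A n \<subseteq> A m" "B n \<subseteq> B m" if "m \<le> n" for m n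
    using lift_Suc_antimono_le[of A, OF Q(1) that] lift_Suc_antimono_le[of B, OF Q(2) that] by blast+
  note decr = this
  obtain p where p: "\<And>n. p \<in> A n"
    using decreasing_closed_nest[of A, OF P(1) ne(1) decr(1) small[OF _ Q(3)]] by blast
  obtain q where q: "\<And>n. q \<in> B n"
    using decreasing_closed_nest[of B, OF P(2) ne(2) decr(2) small[OF _ Q(4)]] by blast
  have "h p \<noteq> h q" using p[of 0] q[of 0] AF BG disj by blast
  then obtain U V where UV: "open U" "open V" "h p \<in> U" "h q \<in> V" "U \<inter> V = {}"
    using hausdorff by metis
  have shrink: "\<exists>n. \<forall>m\<ge>n. S m \<subseteq> W"
    if "open W" "c \<in> W" and c: "\<And>n. c \<in> S n" and S: "\<And>n. \<exists>a. S (Suc n) \<subseteq> cball a (1 / real (Suc n))"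
      and dec: "\<And>m n. m \<le> n \<Longrightarrow> S n \<subseteq> S m" for c W and S :: "nat \<Rightarrow> 'z set"
  proof -
    obtain e where e: "0 < e" "ball c e \<subseteq> W" using \<open>open W\<close> \<open>c \<in> W\<close> open_contains_ball by blast
    obtain n where "\<forall>x\<in>S n. \<forall>y\<in>S n. dist x y < e" using small[OF e(1), of S] S by blast
    then have "S n \<subseteq> W" using c e(2) by (auto simp: subset_iff)
    then show ?thesis using dec by blast
  qed
  have "open (h -` U)" "open (h -` V)" using UV h by (auto simp: open_vimage)
  then obtain n n' where n: "\<forall>m\<ge>n. A m \<subseteq> h -` U" "\<forall>m\<ge>n'. B m \<subseteq> h -` V"
    using shrink[of "h -` U" p A, OF _ _ p Q(3) decr(1)] shrink[of "h -` V" q B, OF _ _ q Q(4) decr(2)]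
      UV by (auto simp: vimage_eq)
  have "h ` A (max n n') \<subseteq> U" "h ` B (max n n') \<subseteq> V"
    using n max.cobounded1[of n n'] max.cobounded2[of n' n] by blast+
  then have "borel_separated (h ` A (max n n')) (h ` B (max n n'))"
    unfolding borel_separated_def using UV by (intro bexI[of _ U]) auto
  then show False using P(3) by blast
qed

text \<open>A projection of a Borel set need not be Borel. Composing it with the projection that
  presents the Borel set as analytic exhibits both sets as images of closed sets under one
  continuous map on a Polish space.\<close>

lemma projections_separated:
  fixes S T :: "('x::{complete_space, second_countable_topology} \<times> 'y::{complete_space, second_countable_topology}) set"
  assumes "S \<in> sets borel" "T \<in> sets borel" "fst ` S \<inter> fst ` T = {}"
  shows "borel_separated (fst ` S) (fst ` T)"
proof -
  obtain F G :: "(('x \<times> 'y) \<times> (nat \<Rightarrow> nat discrete)) set" where F: "closed F" "S = fst ` F" and G: "closed G" "T = fst ` G"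
    using assms(1,2) closed_projection_borel unfolding closed_projection_def by metis
  have "borel_separated ((\<lambda>p. fst (fst p)) ` F) ((\<lambda>p. fst (fst p)) ` G)"
    using assms(3) by (intro closed_images_separated[OF _ F(1) G(1)] continuous_intros) (auto simp: F G image_image)
  then show ?thesis by (simp add: F G image_image)
qed

section \<open>Borel functions covering the sections of a Borel relation\<close>

text \<open>A point of the fibre is the limit of the centres of the first balls in which separating
  sets locate it.\<close>

lemma borel_uniformization_unique:
  fixes S :: "('x::{complete_space, second_countable_topology} \<times> 'y::{complete_space, second_countable_topology}) set"
  assumes S: "S \<in> sets borel" and uniq: "\<And>x y y'. (x, y) \<in> S \<Longrightarrow> (x, y') \<in> S \<Longrightarrow> y = y'"
  obtains g where "g \<in> borel_measurable borel" "\<And>x y. (x, y) \<in> S \<Longrightarrow> y = g x"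
proof -
  obtain d :: "nat \<Rightarrow> 'y" where d: "\<And>x e. 0 < e \<Longrightarrow> \<exists>m. dist (d m) x < e"
    using dense_sequence by blast
  let ?C = "\<lambda>m n. cball (d n) (1 / real (Suc m))"
  \<comment> \<open>Since sections of \<open>S\<close> have at most one point, the parts of
    \<open>S\<close> inside and outside a ball have disjoint projections. The separating set
    decides, for x in the projection of \<open>S\<close>, whether its point lies in the
    ball.\<close>
  have "\<exists>B. B \<in> sets borel \<and> fst ` (S \<inter> UNIV \<times> ?C m n) \<subseteq> B \<and> fst ` (S \<inter> UNIV \<times> (- ?C m n)) \<inter> B = {}" for m n
  proof -
    have "borel_separated (fst ` (S \<inter> UNIV \<times> ?C m n)) (fst ` (S \<inter> UNIV \<times> (- ?C m n)))"
    proof (rule projections_separated)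
      have "UNIV \<times> ?C m n \<in> sets (borel :: ('x \<times> 'y) measure)"
        by (intro borel_closed closed_Times) auto
      then show "S \<inter> UNIV \<times> ?C m n \<in> sets borel" using S by auto
      have "UNIV \<times> (- ?C m n) \<in> sets (borel :: ('x \<times> 'y) measure)"
        by (intro borel_open open_Times open_Compl) auto
      then show "S \<inter> UNIV \<times> (- ?C m n) \<in> sets borel" using S by auto
      show "fst ` (S \<inter> UNIV \<times> ?C m n) \<inter> fst ` (S \<inter> UNIV \<times> (- ?C m n)) = {}"
        using uniq by fastforce
    qed
    then show ?thesis unfolding borel_separated_def by blast
  qed
  then have "\<forall>m. \<exists>B. \<forall>n. B n \<in> sets borel \<and> fst ` (S \<inter> UNIV \<times> ?C m n) \<subseteq> B n \<and> fst ` (S \<inter> UNIV \<times> (- ?C m n)) \<inter> B n = {}"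
    by (intro allI choice) blast
  from choice[OF this] obtain B where BB: "\<forall>m n. B m n \<in> sets borel \<and> fst ` (S \<inter> UNIV \<times> ?C m n) \<subseteq> B m n \<and> fst ` (S \<inter> UNIV \<times> (- ?C m n)) \<inter> B m n = {}"
    by (rule exE)
  have B[measurable]: "\<And>m n. B m n \<in> sets borel"
    and B1: "\<And>m n. fst ` (S \<inter> UNIV \<times> ?C m n) \<subseteq> B m n"
    and B2: "\<And>m n. fst ` (S \<inter> UNIV \<times> (- ?C m n)) \<inter> B m n = {}"
    using BB by blast+
  define p where "p m x = d (LEAST n. x \<in> B m n)" for m x
  have [measurable]: "p m \<in> borel_measurable borel" for m
    unfolding p_def by (rule measurable_compose_countable[where f="\<lambda>n x. d n"]) measurable
  \<comment> \<open>Off the projection of \<open>S\<close> the centres need not converge; there the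
    sequence may be replaced by a constant one, so that the limit exists everywhere.\<close>
  define p' where "p' m x = (if Cauchy (\<lambda>m. p m x) then p m x else d 0)" for m x
  have [measurable]: "p' m \<in> borel_measurable borel" for m
    unfolding p'_def by measurable
  have "\<exists>l. (\<lambda>m. p' m x) \<longlonglongrightarrow> l" for x
    unfolding p'_def using Cauchy_convergent_iff[of "\<lambda>m. p m x"]
    by (cases "Cauchy (\<lambda>m. p m x)") (auto simp: convergent_def intro!: exI[of _ "d 0"])
  then obtain g where g: "\<And>x. (\<lambda>m. p' m x) \<longlonglongrightarrow> g x" by metis
  have "g \<in> borel_measurable borel"
    by (rule borel_measurable_LIMSEQ_metric[of p']) (use g in auto)
  moreover have "y = g x" if xy: "(x, y) \<in> S" for x y
  proof -
    have "dist (p m x) y \<le> 1 / real (Suc m)" for m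
    proof -
      obtain n where "dist (d n) y < 1 / real (Suc m)" using d[of "1 / real (Suc m)" y] by auto
      then have "(x, y) \<in> S \<inter> UNIV \<times> ?C m n" using xy by auto
      then have "x \<in> B m n" using B1[where m=m and n=n] by force
      then have "x \<in> B m (LEAST n. x \<in> B m n)" by (rule LeastI)
      then have "y \<in> ?C m (LEAST n. x \<in> B m n)" using B2[where m=m and n="LEAST n. x \<in> B m n"] xy by force
      then show ?thesis by (simp add: p_def)
    qed
    then have "(\<lambda>m. p m x) \<longlonglongrightarrow> y"
      by (intro metric_tendsto_imp_tendsto[OF LIMSEQ_Suc[OF lim_1_over_n[where 'a=real]]] always_eventually)
        (simp add: dist_real_def)
    moreover from this have "Cauchy (\<lambda>m. p m x)" by (rule LIMSEQ_imp_Cauchy)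
    then have "(\<lambda>m. p' m x) = (\<lambda>m. p m x)" by (simp add: p'_def)
    ultimately show "y = g x" using g[of x] LIMSEQ_unique by metis
  qed
  ultimately show thesis by (rule that)
qed

text \<open>Where the section has the maximal number of points, it is split by disjoint basic open
  sets into single points; elsewhere the bound on the number of points decreases.\<close>

lemma bounded_sections_enumeration:
  fixes E :: "('x::{complete_space, second_countable_topology} \<times> 'y::{complete_space, second_countable_topology}) set"
  assumes "E \<in> sets borel" "\<And>x. finite (E `` {x}) \<and> card (E `` {x}) \<le> D"
  shows "\<exists>f::nat \<Rightarrow> 'x \<Rightarrow> 'y. (\<forall>i. f i \<in> borel_measurable borel) \<and> (\<forall>x. E `` {x} \<subseteq> (\<lambda>i. f i x) ` {..<D})"
  using assms
proof (induction D arbitrary: E)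
  case 0
  have "E `` {x} = {}" for x using 0(2)[of x] by (metis card_0_eq le_zero_eq)
  then show ?case by (intro exI[of _ "\<lambda>_ _. undefined"]) simp
next
  case (Suc D)
  note [measurable] = Suc.prems(1)
  obtain \<B>' :: "'y set set" where \<B>': "countable \<B>'" "topological_basis \<B>'"
    using ex_countable_basis by blast
  define \<B> where "\<B> = from_nat_into (insert UNIV \<B>')"
  have range: "range \<B> = insert UNIV \<B>'" unfolding \<B>_def using \<B>'(1) by (intro range_from_nat_into) auto
  have "open (\<B> n)" for n
    using range \<B>'(2) topological_basis_open[of \<B>'] by (metis insert_iff open_UNIV rangeI)
  then have [measurable]: "\<B> n \<in> sets borel" for n by simp
  have basis: "\<exists>n. z \<in> \<B> n \<and> \<B> n \<subseteq> U" if "open U" "z \<in> U" for z U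
    using topological_basisE[OF \<B>'(2) that] range by (metis insertCI rangeE)
  \<comment> \<open>The first D + 1 entries of a list in \<open>T\<close> name pairwise disjoint
    basic open sets, and \<open>S \<tau>\<close> relates x to the sequences choosing a point of its
    section in each of them. Entries above D are pinned to \<open>undefined\<close>, which makes
    such a sequence unique. There are only countably many lists.\<close>
  define T where "T = {\<tau>::nat list. \<forall>i\<le>D. \<forall>j\<le>D. i \<noteq> j \<longrightarrow> \<B> (\<tau> ! i) \<inter> \<B> (\<tau> ! j) = {}}"
  define S where "S \<tau> = {(x, y::nat \<Rightarrow> 'y). (\<forall>i\<le>D. y i \<in> \<B> (\<tau> ! i) \<and> (x, y i) \<in> E) \<and>
    (\<forall>i>D. y i \<in> {undefined})}" for \<tau>
  have coord: "continuous_on UNIV (\<lambda>p::'x \<times> (nat \<Rightarrow> 'y). snd p i)" for i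
    by (rule continuous_on_product_then_coordinatewise) (intro continuous_intros)
  have [measurable]: "(\<lambda>p::'x \<times> (nat \<Rightarrow> 'y). snd p i) \<in> borel_measurable borel"
    "(\<lambda>p::'x \<times> (nat \<Rightarrow> 'y). fst p) \<in> borel_measurable borel" for i
    using coord by (auto intro!: borel_measurable_continuous_onI continuous_intros)
  have S_borel: "S \<tau> \<in> sets borel" for \<tau>
  proof -
    have "Measurable.pred borel (\<lambda>p::'x \<times> (nat \<Rightarrow> 'y). (\<forall>i\<in>{..D}. snd p i \<in> \<B> (\<tau> ! i) \<and> (fst p, snd p i) \<in> E) \<and>
      (\<forall>i\<in>{D<..}. snd p i \<in> {undefined}))"
      by measurable
    moreover have "S \<tau> = {p \<in> space borel. (\<forall>i\<in>{..D}. snd p i \<in> \<B> (\<tau> ! i) \<and> (fst p, snd p i) \<in> E) \<and>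
      (\<forall>i\<in>{D<..}. snd p i \<in> {undefined})}"
      unfolding S_def by (auto simp: space_borel)
    ultimately show ?thesis by (simp add: pred_def)
  qed
  have S_onto: "E `` {x} = y ` {..D}" if "\<tau> \<in> T" "(x, y) \<in> S \<tau>" for \<tau> x y
  proof -
    have "inj_on y {..D}"
      using that unfolding T_def S_def inj_on_def by (auto simp: set_eq_iff) metis
    then have "card (y ` {..D}) = Suc D" by (simp add: card_image)
    moreover have "y ` {..D} \<subseteq> E `` {x}" using that by (auto simp: S_def)
    ultimately show ?thesis using Suc.prems(2)[of x] by (metis card_seteq)
  qed
  have S_uniq: "y = y'" if \<tau>: "\<tau> \<in> T" and y: "(x, y) \<in> S \<tau>" "(x, y') \<in> S \<tau>" for \<tau> x y y'
  proof
    fix i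
    show "y i = y' i"
    proof (cases "i \<le> D")
      case True
      then have "y' i \<in> E `` {x}" using y by (auto simp: S_def)
      then obtain j where j: "j \<le> D" "y' i = y j" using S_onto[OF \<tau> y(1)] by auto
      then have "y' i \<in> \<B> (\<tau> ! i) \<inter> \<B> (\<tau> ! j)" using y True by (auto simp: S_def)
      then have "i = j" using \<tau> True j by (auto simp: T_def)
      then show ?thesis using j by simp
    next
      case False
      then show ?thesis using y by (auto simp: S_def)
    qed
  qed
  have "\<exists>g. g \<in> borel_measurable borel \<and> (\<tau> \<in> T \<longrightarrow> (\<forall>x y. (x, y) \<in> S \<tau> \<longrightarrow> y = g x))" for \<tau>
  proof (cases "\<tau> \<in> T")
    case True
    show ?thesis
      using borel_uniformization_unique[OF S_borel, of \<tau>] S_uniq[OF True] by metis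
  qed (auto intro!: exI[of _ "\<lambda>_. undefined"])
  then obtain g where g[measurable]: "\<And>\<tau>. g \<tau> \<in> borel_measurable borel"
    and gS: "\<And>\<tau> x y. \<tau> \<in> T \<Longrightarrow> (x, y) \<in> S \<tau> \<Longrightarrow> y = g \<tau> x" by metis
  have g_coord[measurable]: "(\<lambda>x. g \<tau> x i) \<in> borel_measurable borel" for \<tau> i
    using measurable_product_then_coordinatewise[OF g] .
  \<comment> \<open>Testing \<open>S\<close> at the Borel function \<open>g\<close> makes this
    domain visibly Borel; as a projection it would only be analytic.\<close>
  define dom where "dom n = {x. from_nat n \<in> T \<and> (x, g (from_nat n) x) \<in> S (from_nat n)}" for n
  have [measurable]: "dom n \<in> sets borel" for n
  proof -
    note S_borel[measurable]
    have "Measurable.pred borel (\<lambda>x. from_nat n \<in> T \<and> (x, g (from_nat n) x) \<in> S (from_nat n))"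
      by measurable
    then show ?thesis by (simp add: pred_def dom_def)
  qed
  define A where "A = (\<Union>n. dom n)"
  have [measurable]: "A \<in> sets borel" unfolding A_def by measurable
  define N where "N x = (LEAST n. x \<in> dom n)" for x
  have [measurable]: "N \<in> measurable borel (count_space UNIV)" unfolding N_def by measurable
  define E' where "E' = E \<inter> (- A) \<times> UNIV"
  have A_full: "x \<in> A" if x: "card (E `` {x}) = Suc D" for x
  proof -
    have fin: "finite (E `` {x})" using x card_ge_0_finite by force
    obtain y where y: "bij_betw y {0..<Suc D} (E `` {x})"
      using ex_bij_betw_nat_finite[OF fin] x by metis
    have "\<exists>e>0. \<forall>z\<in>E `` {x}. z \<noteq> y i \<longrightarrow> e \<le> dist (y i) z" for i
      using finite_set_avoid[OF fin, of "y i"] .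
    then obtain e where e: "\<And>i. e i > 0" "\<And>i z. z \<in> E `` {x} \<Longrightarrow> z \<noteq> y i \<Longrightarrow> e i \<le> dist (y i) z"
      by metis
    \<comment> \<open>As \<open>e i\<close> is at most the distance from \<open>y i\<close> to any
      other point of the section, balls with half these radii are disjoint.\<close>
    have "\<exists>n. y i \<in> \<B> n \<and> \<B> n \<subseteq> ball (y i) (e i / 2)" for i
      using basis[of "ball (y i) (e i / 2)" "y i"] e(1)[of i] by auto
    then obtain n where n: "\<And>i. y i \<in> \<B> (n i)" "\<And>i. \<B> (n i) \<subseteq> ball (y i) (e i / 2)" by metis
    define \<tau> where "\<tau> = map n [0..<Suc D]"
    have \<tau>: "\<tau> ! i = n i" if "i \<le> D" for i using that by (simp add: \<tau>_def nth_append)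
    have yE: "y i \<in> E `` {x}" if "i \<le> D" for i
      using y that unfolding bij_betw_def by auto
    have "\<B> (n i) \<inter> \<B> (n j) = {}" if ij: "i \<le> D" "j \<le> D" "i \<noteq> j" for i j
    proof (rule ccontr)
      assume "\<not> ?thesis"
      then obtain z where "dist (y i) z < e i / 2" "dist (y j) z < e j / 2"
        using n(2)[of i] n(2)[of j] by (auto simp: subset_iff)
      moreover have "y i \<noteq> y j" using y ij unfolding bij_betw_def inj_on_def by auto
      then have "e i \<le> dist (y i) (y j)" "e j \<le> dist (y j) (y i)" using e(2) yE ij by metis+
      ultimately show False using dist_triangle2[of "y i" "y j" z] by (simp add: dist_commute)
    qed
    then have \<tau>T: "\<tau> \<in> T" by (simp add: T_def \<tau>)
    define y' where "y' i = (if i \<le> D then y i else undefined)" for i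
    have "(x, y') \<in> S \<tau>" using n(1) \<tau> yE by (auto simp: S_def y'_def)
    then have "x \<in> dom (to_nat \<tau>)" using gS[OF \<tau>T] \<tau>T by (auto simp: dom_def)
    then show ?thesis by (auto simp: A_def)
  qed
  have "E' \<in> sets borel"
  proof -
    have "(- A) \<times> UNIV \<in> sets (borel \<Otimes>\<^sub>M borel :: ('x \<times> 'y) measure)" by measurable
    then show ?thesis using Suc.prems(1) unfolding E'_def borel_prod by blast
  qed
  moreover have "finite (E' `` {x}) \<and> card (E' `` {x}) \<le> D" for x
  proof (cases "x \<in> A")
    case True
    then have "E' `` {x} = {}" by (auto simp: E'_def)
    then show ?thesis by simp
  next
    case False
    then have "E' `` {x} = E `` {x}" by (auto simp: E'_def)
    then show ?thesis using Suc.prems(2)[of x] A_full[of x] False by (simp add: le_Suc_eq) blast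
  qed
  ultimately obtain f' :: "nat \<Rightarrow> 'x \<Rightarrow> 'y" where f'[measurable]: "\<And>i. f' i \<in> borel_measurable borel"
    and f'_E: "\<And>x. E' `` {x} \<subseteq> (\<lambda>i. f' i x) ` {..<D}"
    using Suc.IH[of E'] by metis
  define f where "f i x = (if x \<in> A then g (from_nat (N x)) x i else f' i x)" for i x
  have "f i \<in> borel_measurable borel" for i
  proof -
    have "(\<lambda>x. g (from_nat (N x)) x i) \<in> borel_measurable borel"
      by (rule measurable_compose_countable[of "\<lambda>n x. g (from_nat n) x i"]) measurable
    then show ?thesis unfolding f_def by measurable
  qed
  moreover have "E `` {x} \<subseteq> (\<lambda>i. f i x) ` {..<Suc D}" for x
  proof (cases "x \<in> A")
    case True
    then have "x \<in> dom (N x)" unfolding N_def A_def by (auto intro: LeastI)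
    then have "E `` {x} = g (from_nat (N x)) x ` {..D}"
      using S_onto[of "from_nat (N x)" x "g (from_nat (N x)) x"] by (simp add: dom_def)
    then show ?thesis using True by (auto simp: f_def lessThan_Suc_atMost)
  next
    case False
    then have "E' `` {x} = E `` {x}" by (auto simp: E'_def)
    then show ?thesis using f'_E[of x] False by (fastforce simp: f_def)
  qed
  ultimately show ?case by (intro exI[of _ f]) blast
qed

section \<open>Balls and bi-Lipschitz equivalent graphs\<close>

lemma mem_ball_vertices: "y \<in> ball_vertices E r x \<longleftrightarrow> (\<exists>n\<le>r. (x, y) \<in> E ^^ n)"
  by (simp add: ball_vertices_def graph_dist_le_iff)

lemma ball_vertices_self [simp]: "x \<in> ball_vertices E r x"
  unfolding mem_ball_vertices by (intro exI[of _ 0]) simp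

lemma ball_vertices_edge: "(x, y) \<in> E \<Longrightarrow> 0 < r \<Longrightarrow> y \<in> ball_vertices E r x"
  unfolding mem_ball_vertices by (intro exI[of _ 1]) simp

lemma relpow_subset: "(E :: ('a \<times> 'a) set) \<subseteq> F \<Longrightarrow> E ^^ n \<subseteq> F ^^ n"
  by (induction n) auto

lemma ball_vertices_mono:
  assumes "r \<le> s" "E \<subseteq> F"
  shows "ball_vertices E r x \<subseteq> ball_vertices F s x"
  using relpow_subset[OF assms(2)] assms(1) unfolding subset_iff mem_ball_vertices by (meson order_trans)

lemma ball_vertices_trans:
  assumes "y \<in> ball_vertices E r x" "z \<in> ball_vertices E s y"
  shows "z \<in> ball_vertices E (r + s) x"
proof -
  obtain m n where "m \<le> r" "(x, y) \<in> E ^^ m" "n \<le> s" "(y, z) \<in> E ^^ n"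
    using assms unfolding mem_ball_vertices by blast
  then show ?thesis unfolding mem_ball_vertices
    by (intro exI[of _ "m + n"]) (auto simp: relpow_add)
qed

lemma sym_relpow:
  assumes "sym E"
  shows "sym (E ^^ n)"
proof (induction n)
  case (Suc n)
  show ?case
  proof (rule symI)
    fix x y assume "(x, y) \<in> E ^^ Suc n"
    then obtain z where "(x, z) \<in> E ^^ n" "(z, y) \<in> E" by auto
    then have "(y, z) \<in> E" "(z, x) \<in> E ^^ n" using assms Suc.IH by (auto dest: symD)
    then show "(y, x) \<in> E ^^ Suc n" by (rule relpow_Suc_I2)
  qed
qed (auto simp: sym_def)

lemma ball_vertices_sym:
  assumes "sym E"
  shows "y \<in> ball_vertices E r x \<longleftrightarrow> x \<in> ball_vertices E r y"
  using sym_relpow[OF assms] unfolding mem_ball_vertices by (metis symE)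

lemma relpow_vertices: "E \<subseteq> V \<times> V \<Longrightarrow> (x, y) \<in> E ^^ n \<Longrightarrow> x \<noteq> y \<Longrightarrow> x \<in> V \<and> y \<in> V"
proof (cases n)
  case (Suc m)
  assume "E \<subseteq> V \<times> V" "(x, y) \<in> E ^^ n"
  then show ?thesis using Suc relpow_Suc_D2[of x y m E] by auto
qed simp

lemma ball_vertices_in:
  assumes "E \<subseteq> V \<times> V" "y \<in> ball_vertices E r x" "x \<noteq> y"
  shows "x \<in> V" "y \<in> V"
  using assms relpow_vertices[of E V x y] unfolding mem_ball_vertices by blast+

lemma ball_vertices_relpow_subst:
  assumes "\<And>a b. (a, b) \<in> R \<Longrightarrow> b \<in> ball_vertices E L a" "(x, y) \<in> R ^^ n"
  shows "y \<in> ball_vertices E (n * L) x"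
  using assms(2)
proof (induction n arbitrary: y)
  case 0
  then show ?case by simp
next
  case (Suc n)
  then obtain z where "(x, z) \<in> R ^^ n" "(z, y) \<in> R" by auto
  then show ?case
    using ball_vertices_trans[OF Suc.IH assms(1)] by (simp add: add.commute)
qed

lemma ball_vertices_subst:
  assumes "\<And>a b. (a, b) \<in> R \<Longrightarrow> b \<in> ball_vertices E L a"
  shows "ball_vertices R n x \<subseteq> ball_vertices E (n * L) x"
proof
  fix y assume "y \<in> ball_vertices R n x"
  then obtain m where m: "m \<le> n" "(x, y) \<in> R ^^ m" unfolding mem_ball_vertices by blast
  then show "y \<in> ball_vertices E (n * L) x"
    using ball_vertices_relpow_subst[OF assms m(2)]
      ball_vertices_mono[of "m * L" "n * L" E E x] by auto
qed

section \<open>Bi-Lipschitz equivalence and rewirings\<close>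

definition bilipschitz :: "nat \<Rightarrow> ('v \<times> 'v) set \<Rightarrow> ('v \<times> 'v) set \<Rightarrow> bool" where
  "bilipschitz L E H \<longleftrightarrow> (\<forall>x y. (x, y) \<in> H \<longrightarrow> y \<in> ball_vertices E L x) \<and>
     (\<forall>x y. (x, y) \<in> E \<longrightarrow> y \<in> ball_vertices H L x)"

text \<open>This is why \<open>bilipschitz\<close> may constrain edges only, a condition that local
  rules can enforce: concatenating the paths that replace the edges of a shortest path gives the
  bound for all pairs.\<close>

lemma graph_dist_le_mult:
  assumes "\<And>x y. (x, y) \<in> E \<Longrightarrow> y \<in> ball_vertices H L x" "0 < L"
  shows "graph_dist H x y \<le> enat L * graph_dist E x y"
proof (cases "graph_dist E x y")
  case (enat n)
  then have "y \<in> ball_vertices E n x" by (simp add: ball_vertices_def)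
  then have "y \<in> ball_vertices H (n * L) x" using ball_vertices_subst[of E H L n x] assms(1) by blast
  then show ?thesis using enat by (simp add: ball_vertices_def mult.commute)
next
  case infinity
  \<comment> \<open>In \<open>enat\<close> the product of 0 and infinity is 0, so an infinite
    distance needs \<open>0 < L\<close>.\<close>
  then show ?thesis using assms(2) by (simp add: imult_is_infinity zero_enat_def)
qed

lemma rewiring_iff_bilipschitz:
  assumes "\<And>n. simple_graph (V n) (G n)"
  shows "rewiring V G H \<longleftrightarrow>
    (\<forall>n. simple_graph (V n) (H n)) \<and> (\<exists>L>0. \<forall>n. bilipschitz L (G n) (H n))"
proof (intro iffI conjI)
  assume R: "rewiring V G H"
  then show simp: "\<forall>n. simple_graph (V n) (H n)" by (simp add: rewiring_def)
  obtain L :: nat where L: "L > 0" "\<And>n x y. x \<in> V n \<Longrightarrow> y \<in> V n \<Longrightarrow>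
    graph_dist (H n) x y \<le> enat L * graph_dist (G n) x y \<and>
    graph_dist (G n) x y \<le> enat L * graph_dist (H n) x y"
    using R unfolding rewiring_def by blast
  have one: "enat L * graph_dist R x y \<le> enat L" if "(x, y) \<in> R" for R and x y :: 'a
  proof -
    have "graph_dist R x y \<le> enat 1" using ball_vertices_edge[OF that, of 1] by (simp add: ball_vertices_def)
    then show ?thesis using mult_left_mono[of "graph_dist R x y" "enat 1" "enat L"] by (simp add: one_enat_def[symmetric])
  qed
  have "bilipschitz L (G n) (H n)" for n
  proof -
    have V: "x \<in> V n \<and> y \<in> V n" if "(x, y) \<in> G n \<or> (x, y) \<in> H n" for x y
      using that assms[of n] simp by (auto simp: simple_graph_def)
    then have "graph_dist (G n) x y \<le> enat L" if "(x, y) \<in> H n" for x y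
      using L(2)[of x n y] one[OF that] that order_trans by blast
    moreover have "graph_dist (H n) x y \<le> enat L" if "(x, y) \<in> G n" for x y
      using V[of x y] L(2)[of x n y] one[OF that] that order_trans by blast
    ultimately show ?thesis by (simp add: bilipschitz_def ball_vertices_def)
  qed
  then show "\<exists>L>0. \<forall>n. bilipschitz L (G n) (H n)" using L(1) by blast
next
  assume R: "(\<forall>n. simple_graph (V n) (H n)) \<and> (\<exists>L>0. \<forall>n. bilipschitz L (G n) (H n))"
  then obtain L where L: "L > 0" "\<And>n. bilipschitz L (G n) (H n)" by blast
  have "graph_dist (H n) x y \<le> enat L * graph_dist (G n) x y"
    "graph_dist (G n) x y \<le> enat L * graph_dist (H n) x y" for n x y
    using L(2)[of n] graph_dist_le_mult[of "G n" "H n" L x y, OF _ L(1)]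
      graph_dist_le_mult[of "H n" "G n" L x y, OF _ L(1)] unfolding bilipschitz_def by simp_all
  then show "rewiring V G H"
    using R L(1) unfolding rewiring_def by blast
qed

lemma bilipschitz_component:
  assumes "bilipschitz L E H"
  shows "component E x = component H x"
proof -
  have "E\<^sup>* \<subseteq> H\<^sup>*" if "bilipschitz L E H" for E H :: "('a \<times> 'a) set"
  proof (rule rtrancl_subset_rtrancl)
    show "E \<subseteq> H\<^sup>*"
      using that relpow_imp_rtrancl unfolding bilipschitz_def mem_ball_vertices by fast
  qed
  moreover have "bilipschitz L H E" using assms by (auto simp: bilipschitz_def)
  ultimately show ?thesis using assms unfolding component_eq by blast
qed

text \<open>Defined for an arbitrary colouring and an arbitrary relation \<open>P\<close> on
  colours, because a colouring found by matching statistics need not encode any graph.\<close>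

definition decoded :: "(nat \<Rightarrow> nat \<Rightarrow> bool) \<Rightarrow> nat \<Rightarrow> ('v \<times> 'v) set \<Rightarrow> ('v \<Rightarrow> nat) \<Rightarrow> ('v \<times> 'v) set" where
  "decoded P L E \<phi> = {(x, y). x \<noteq> y \<and> y \<in> ball_vertices E L x \<and> P (\<phi> x) (\<phi> y)}"

definition repaired :: "nat \<Rightarrow> ('v \<times> 'v) set \<Rightarrow> ('v \<times> 'v) set \<Rightarrow> ('v \<times> 'v) set" where
  "repaired L E K = K \<union> {(x, y) \<in> E. y \<notin> ball_vertices K L x}"

lemma decoded_vertices:
  assumes "E \<subseteq> V \<times> V"
  shows "decoded P L E \<phi> \<subseteq> V \<times> V"
proof (rule subrelI)
  fix x y assume "(x, y) \<in> decoded P L E \<phi>"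
  then have "y \<in> ball_vertices E L x" "x \<noteq> y" by (auto simp: decoded_def)
  then show "(x, y) \<in> V \<times> V" using ball_vertices_in[OF assms] by blast
qed

lemma simple_graph_decoded:
  assumes "simple_graph V E" "symp P"
  shows "simple_graph V (decoded P L E \<phi>)"
proof -
  have "sym (decoded P L E \<phi>)"
    using assms ball_vertices_sym[of E] by (auto simp: sym_def decoded_def simple_graph_def symp_def)
  then show ?thesis
    using decoded_vertices[of E V] assms(1) by (auto simp: simple_graph_def irrefl_def decoded_def)
qed

lemma simple_graph_repaired:
  assumes "simple_graph V E" "simple_graph V K"
  shows "simple_graph V (repaired L E K)"
proof -
  have "sym (repaired L E K)"
  proof (rule symI)
    fix x y assume "(x, y) \<in> repaired L E K"
    then show "(y, x) \<in> repaired L E K"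
      using assms ball_vertices_sym[of K x L y] by (auto simp: repaired_def simple_graph_def dest: symD)
  qed
  then show ?thesis using assms by (auto simp: simple_graph_def irrefl_def repaired_def)
qed

text \<open>An edge of \<open>E\<close> either has a short path in \<open>K\<close>, which survives,
  or is itself added; an added edge has length 1 in \<open>E\<close>.\<close>

lemma bilipschitz_repaired:
  assumes "0 < L" "\<And>x y. (x, y) \<in> K \<Longrightarrow> y \<in> ball_vertices E L x"
  shows "bilipschitz L E (repaired L E K)"
  unfolding bilipschitz_def
proof (intro conjI allI impI)
  fix x y
  show "y \<in> ball_vertices E L x" if "(x, y) \<in> repaired L E K"
    using that assms ball_vertices_edge[of x y E L] by (auto simp: repaired_def)
  have "ball_vertices K L x \<subseteq> ball_vertices (repaired L E K) L x"
    by (intro ball_vertices_mono) (auto simp: repaired_def)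
  then show "y \<in> ball_vertices (repaired L E K) L x" if "(x, y) \<in> E"
    using that assms(1) ball_vertices_edge[of x y "repaired L E K" L] by (auto simp: repaired_def)
qed

lemma repaired_bilipschitz: "bilipschitz L E H \<Longrightarrow> repaired L E H = H"
  by (auto simp: bilipschitz_def repaired_def)

lemma bilipschitz_repaired_decoded:
  "0 < L \<Longrightarrow> bilipschitz L E (repaired L E (decoded P L E \<phi>))"
  by (rule bilipschitz_repaired) (auto simp: decoded_def)

subsection \<open>Encoding a graph by a colouring\<close>

text \<open>A colour \<open>a > 0\<close> stands for the pair of the label \<open>(a - 1) mod m < m\<close> and the set of labels
  of neighbours coded by \<open>(a - 1) div m\<close>.\<close>

definition colour_edge :: "nat \<Rightarrow> nat \<Rightarrow> nat \<Rightarrow> bool" where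
  "colour_edge m a b \<longleftrightarrow> (b - 1) mod m \<in> set_decode ((a - 1) div m) \<and> (a - 1) mod m \<in> set_decode ((b - 1) div m)"

definition encode_graph :: "nat \<Rightarrow> ('v \<times> 'v) set \<Rightarrow> ('v \<Rightarrow> nat) \<Rightarrow> 'v \<Rightarrow> nat" where
  "encode_graph m H c x = Suc (c x + m * set_encode (c ` (H `` {x})))"

lemma symp_colour_edge: "symp (colour_edge m)"
  by (auto simp: symp_def colour_edge_def)

lemma set_encode_less:
  assumes "S \<subseteq> {..<m}"
  shows "set_encode S < 2 ^ m"
proof -
  have "set_encode S \<le> (\<Sum>i<m. 2 ^ i)"
    unfolding set_encode_def using assms by (intro sum_mono2) auto
  also have "\<dots> < 2 ^ m" by (induction m) auto
  finally show ?thesis .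
qed

lemma encode_graph_bound:
  assumes "c x < m" "c ` (H `` {x}) \<subseteq> {..<m}"
  shows "encode_graph m H c x \<in> {1..m * 2 ^ m}"
proof -
  have "c x + m * set_encode (c ` (H `` {x})) < m * Suc (set_encode (c ` (H `` {x})))"
    using assms(1) by simp
  also have "\<dots> \<le> m * 2 ^ m" using set_encode_less[OF assms(2)] by (intro mult_le_mono2) simp
  finally show ?thesis by (simp add: encode_graph_def)
qed

text \<open>The labels are injective on balls of radius \<open>2 * L\<close>, so a label identifies at most one
  vertex at distance at most \<open>L\<close>.\<close>

lemma decoded_encode_graph:
  assumes E: "simple_graph V E" and H: "simple_graph V H"
    and near: "\<And>x y. (x, y) \<in> H \<Longrightarrow> y \<in> ball_vertices E L x"
    and c: "\<And>x y. x \<in> V \<Longrightarrow> y \<in> ball_vertices E (2 * L) x \<Longrightarrow> y \<noteq> x \<Longrightarrow> c x \<noteq> c y"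
    and m: "\<And>x. x \<in> V \<Longrightarrow> c x < m" and fin: "\<And>x. x \<in> V \<Longrightarrow> finite (H `` {x})"
  shows "decoded (colour_edge m) L E (encode_graph m H c) = H"
proof -
  have dec: "set_decode ((encode_graph m H c x - 1) div m) = c ` (H `` {x})"
    "(encode_graph m H c x - 1) mod m = c x" if "x \<in> V" for x
    using m[OF that] fin[OF that] unfolding encode_graph_def by auto
  have inV: "x \<in> V" "y \<in> V" if "(x, y) \<in> H" for x y using H that by (auto simp: simple_graph_def)
  show ?thesis
  proof (intro equalityI subrelI)
    fix x y assume xy: "(x, y) \<in> decoded (colour_edge m) L E (encode_graph m H c)"
    then have xy': "x \<noteq> y" "y \<in> ball_vertices E L x"
      "colour_edge m (encode_graph m H c x) (encode_graph m H c y)" by (auto simp: decoded_def)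
    have V: "x \<in> V" "y \<in> V" using ball_vertices_in[OF _ xy'(2,1)] E by (auto simp: simple_graph_def)
    then obtain z where z: "(x, z) \<in> H" "c y = c z"
      using xy'(3) dec[OF V(1)] dec[OF V(2)] unfolding colour_edge_def by auto
    have "y \<in> ball_vertices E (L + L) z"
      using ball_vertices_trans[OF _ xy'(2)] near[OF z(1)] ball_vertices_sym[of E x L z] E
      by (auto simp: simple_graph_def)
    then have "y = z" using c[OF inV(2)[OF z(1)], of y] z(2) by (auto simp: mult_2)
    then show "(x, y) \<in> H" using z by simp
  next
    fix x y assume xy: "(x, y) \<in> H"
    then have "(y, x) \<in> H" "x \<noteq> y" using H by (auto simp: simple_graph_def sym_def irrefl_def)
    then show "(x, y) \<in> decoded (colour_edge m) L E (encode_graph m H c)"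
      using near[OF xy] xy dec[OF inV(1)[OF xy]] dec[OF inV(2)[OF xy]]
      unfolding decoded_def colour_edge_def by auto
  qed
qed

subsection \<open>Locality and isomorphism invariance\<close>

text \<open>The outcome of the local rule at the root, computed from the ball as a graph in its own
  right. Its cardinality is thereby a function of the class in \<open>U_classes\<close>.\<close>

definition root_neighbours :: "(nat \<Rightarrow> nat \<Rightarrow> bool) \<Rightarrow> nat \<Rightarrow> 'v rc_graph \<Rightarrow> 'v set" where
  "root_neighbours P L B = repaired L (edges B) (decoded P L (edges B) (colour B)) `` {rc_root B}"

text \<open>A path of length n that starts within distance m of the centre never gets farther than m
  + n from it.\<close>

lemma relpow_restrict_ball:
  assumes "(z, y) \<in> E ^^ n" "z \<in> ball_vertices E m x" "m + n \<le> r"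
  shows "(z, y) \<in> (E \<inter> (ball_vertices E r x \<times> ball_vertices E r x)) ^^ n"
  using assms(1,3)
proof (induction n arbitrary: y)
  case 0
  then show ?case by simp
next
  case (Suc n)
  then obtain w where w: "(z, w) \<in> E ^^ n" "(w, y) \<in> E" by auto
  have near: "u \<in> ball_vertices E r x" if "(z, u) \<in> E ^^ k" "k \<le> Suc n" for u k
  proof -
    have "u \<in> ball_vertices E k z" using that unfolding mem_ball_vertices by blast
    then show ?thesis
      using ball_vertices_trans[OF assms(2)] ball_vertices_mono[of "m + k" r E E x] that Suc.prems by auto
  qed
  have "w \<in> ball_vertices E r x" "y \<in> ball_vertices E r x"
    using near[OF w(1)] near[OF Suc.prems(1)] by auto
  then show ?case using Suc w by auto
qed

lemma ball_vertices_restrict_ball: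
  assumes "z \<in> ball_vertices E m x" "m + n \<le> r"
  shows "ball_vertices (E \<inter> (ball_vertices E r x \<times> ball_vertices E r x)) n z = ball_vertices E n z"
proof
  show "ball_vertices (E \<inter> (ball_vertices E r x \<times> ball_vertices E r x)) n z \<subseteq> ball_vertices E n z"
    by (intro ball_vertices_mono) auto
  show "ball_vertices E n z \<subseteq> ball_vertices (E \<inter> (ball_vertices E r x \<times> ball_vertices E r x)) n z"
  proof
    fix y assume "y \<in> ball_vertices E n z"
    then obtain k where "k \<le> n" "(z, y) \<in> E ^^ k" unfolding mem_ball_vertices by blast
    then show "y \<in> ball_vertices (E \<inter> (ball_vertices E r x \<times> ball_vertices E r x)) n z"
      using relpow_restrict_ball[OF _ assms(1), of y k r] assms(2) unfolding mem_ball_vertices by auto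
  qed
qed

text \<open>After n < L decoded pairs from x one is within n * L of x, and verifying the next pair
  needs a path of length at most L in \<open>E\<close>. In total this stays within (n + 1) * L,
  hence within radius \<open>L * L\<close>.\<close>

lemma root_neighbours_coloured_ball:
  assumes "0 < L"
  shows "root_neighbours P L (coloured_ball E \<phi> (L * L) x) = repaired L E (decoded P L E \<phi>) `` {x}"
proof -
  let ?r = "L * L"
  let ?b = "ball_vertices E ?r x"
  define F where "F = E \<inter> (?b \<times> ?b)"
  let ?K = "decoded P L E \<phi>" and ?K' = "decoded P L F \<phi>"
  have K'K: "?K' \<subseteq> ?K"
    using ball_vertices_mono[of L L F E] unfolding decoded_def F_def by blast
  have K: "(z, y) \<in> ?K'" if "(z, y) \<in> ?K" "z \<in> ball_vertices E m x" "m + L \<le> ?r" for z y m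
    using that ball_vertices_restrict_ball[OF that(2,3)] by (auto simp: decoded_def F_def)
  have KE: "b \<in> ball_vertices E L a" if "(a, b) \<in> ?K" for a b using that by (simp add: decoded_def)
  have pow: "(x, y) \<in> ?K' ^^ n" if "(x, y) \<in> ?K ^^ n" "n \<le> L" for y n
    using that
  proof (induction n arbitrary: y)
    case 0
    then show ?case by simp
  next
    case (Suc n)
    then obtain w where w: "(x, w) \<in> ?K ^^ n" "(w, y) \<in> ?K" by auto
    have "w \<in> ball_vertices E (n * L) x" using ball_vertices_relpow_subst[OF KE w(1)] .
    moreover have "n * L + L \<le> ?r" using mult_le_mono1[OF Suc.prems(2), of L] by simp
    ultimately show ?case using K[OF w(2)] Suc.IH[OF w(1)] Suc.prems by auto
  qed
  have ball: "ball_vertices ?K' L x = ball_vertices ?K L x"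
  proof
    show "ball_vertices ?K' L x \<subseteq> ball_vertices ?K L x" using K'K by (intro ball_vertices_mono) auto
    show "ball_vertices ?K L x \<subseteq> ball_vertices ?K' L x"
      unfolding subset_iff mem_ball_vertices using pow by blast
  qed
  have "L \<le> ?r" "1 \<le> ?r" using assms by auto
  then have "(x, y) \<in> F \<longleftrightarrow> (x, y) \<in> E" for y
    using ball_vertices_edge[of x y E ?r] by (auto simp: F_def)
  moreover have "(x, y) \<in> ?K' \<longleftrightarrow> (x, y) \<in> ?K" for y
    using K[of x y 0] K'K \<open>L \<le> ?r\<close> by auto
  ultimately have "repaired L F ?K' `` {x} = repaired L E ?K `` {x}"
    using ball by (auto simp: repaired_def)
  then show ?thesis by (simp add: root_neighbours_def coloured_ball_def F_def)
qed

lemma relpow_bij_iff: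
  assumes f: "bij_betw f V W" and E: "E \<subseteq> V \<times> V" and F: "F \<subseteq> W \<times> W"
    and iff: "\<And>x y. x \<in> V \<Longrightarrow> y \<in> V \<Longrightarrow> (x, y) \<in> E \<longleftrightarrow> (f x, f y) \<in> F"
    and "x \<in> V" "y \<in> V"
  shows "(x, y) \<in> E ^^ n \<longleftrightarrow> (f x, f y) \<in> F ^^ n"
  using \<open>y \<in> V\<close>
proof (induction n arbitrary: y)
  case 0
  then show ?case using f \<open>x \<in> V\<close> by (auto simp: bij_betw_def inj_on_def)
next
  case (Suc n)
  have "(x, y) \<in> E ^^ Suc n \<longleftrightarrow> (\<exists>z\<in>V. (x, z) \<in> E ^^ n \<and> (z, y) \<in> E)" using E by auto
  also have "\<dots> \<longleftrightarrow> (\<exists>z\<in>V. (f x, f z) \<in> F ^^ n \<and> (f z, f y) \<in> F)" using Suc iff by blast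
  also have "\<dots> \<longleftrightarrow> (\<exists>w\<in>W. (f x, w) \<in> F ^^ n \<and> (w, f y) \<in> F)" using f by (auto simp: bij_betw_def)
  also have "\<dots> \<longleftrightarrow> (f x, f y) \<in> F ^^ Suc n" using F by auto
  finally show ?case .
qed

lemma ball_vertices_bij_iff:
  assumes "bij_betw f V W" "E \<subseteq> V \<times> V" "F \<subseteq> W \<times> W"
    "\<And>x y. x \<in> V \<Longrightarrow> y \<in> V \<Longrightarrow> (x, y) \<in> E \<longleftrightarrow> (f x, f y) \<in> F" "x \<in> V" "y \<in> V"
  shows "y \<in> ball_vertices E n x \<longleftrightarrow> f y \<in> ball_vertices F n (f x)"
  unfolding mem_ball_vertices using relpow_bij_iff[OF assms] by simp

text \<open>The isomorphism is transported in two rounds: \<open>ball_vertices_bij_iff\<close> for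
  the edges gives invariance of the decoded graph, and the same lemma for the decoded graph gives
  invariance of the repair.\<close>

lemma card_root_neighbours_iso:
  assumes iso: "rc_iso G H" and wf: "rc_wf G" "rc_wf H"
  shows "card (root_neighbours P L G) = card (root_neighbours P L H)"
proof -
  obtain f where f: "bij_betw f (verts G) (verts H)" "f (rc_root G) = rc_root H"
    "\<And>x y. x \<in> verts G \<Longrightarrow> y \<in> verts G \<Longrightarrow> (x, y) \<in> edges G \<longleftrightarrow> (f x, f y) \<in> edges H"
    "\<And>x. x \<in> verts G \<Longrightarrow> colour H (f x) = colour G x"
    using iso unfolding rc_iso_def by blast
  have G: "edges G \<subseteq> verts G \<times> verts G" "rc_root G \<in> verts G"
    and H: "edges H \<subseteq> verts H \<times> verts H"
    using wf by (auto simp: rc_wf_def simple_graph_def)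
  have inj: "inj_on f (verts G)" and im: "f ` verts G = verts H" using f(1) by (auto simp: bij_betw_def)
  let ?K = "\<lambda>B. decoded P L (edges B) (colour B)"
  let ?R = "\<lambda>B. repaired L (edges B) (?K B)"
  have KV: "?K G \<subseteq> verts G \<times> verts G" "?K H \<subseteq> verts H \<times> verts H"
    using decoded_vertices[OF G(1)] decoded_vertices[OF H] by blast+
  have K: "(x, y) \<in> ?K G \<longleftrightarrow> (f x, f y) \<in> ?K H" if "x \<in> verts G" "y \<in> verts G" for x y
    using ball_vertices_bij_iff[OF f(1) G(1) H f(3) that] f(4) that inj
    by (auto simp: decoded_def inj_on_def)
  have R: "(x, y) \<in> ?R G \<longleftrightarrow> (f x, f y) \<in> ?R H" if "x \<in> verts G" "y \<in> verts G" for x y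
    using ball_vertices_bij_iff[OF f(1) KV K that] K[OF that] f(3)[OF that]
    by (auto simp: repaired_def)
  have RV: "?R G \<subseteq> verts G \<times> verts G" "?R H \<subseteq> verts H \<times> verts H"
    using KV G(1) H by (auto simp: repaired_def)
  have "f ` (?R G `` {rc_root G}) = ?R H `` {rc_root H}"
  proof (intro equalityI subsetI)
    fix w assume "w \<in> ?R H `` {rc_root H}"
    then have w: "(f (rc_root G), w) \<in> ?R H" using f(2) by simp
    then have "w \<in> f ` verts G" using RV(2) im by blast
    then obtain y where y: "y \<in> verts G" "w = f y" by blast
    then have "(rc_root G, y) \<in> ?R G" using R[OF G(2) y(1)] w by simp
    then show "w \<in> f ` (?R G `` {rc_root G})" using y(2) by blast
  next
    fix w assume "w \<in> f ` (?R G `` {rc_root G})"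
    then obtain y where y: "(rc_root G, y) \<in> ?R G" "w = f y" by blast
    then have "y \<in> verts G" using RV(1) by blast
    then have "(f (rc_root G), f y) \<in> ?R H" using R[OF G(2)] y by blast
    then show "w \<in> ?R H `` {rc_root H}" using y f(2) by simp
  qed
  moreover have "inj_on f (?R G `` {rc_root G})" using RV(1) by (intro inj_on_subset[OF inj]) blast
  ultimately show ?thesis unfolding root_neighbours_def by (metis card_image)
qed

section \<open>Graphs enumerated by measurable functions\<close>

text \<open>Tested along pairs of measurable self-maps rather than in a product sigma-algebra. This
  fits walks, which are such maps, and treats finite graphs and graphings alike; for relations of
  bounded range a Borel subset of the square is recovered in
  \<open>graphing_subrelation\<close>.\<close>

definition measurable_relation :: "'v measure \<Rightarrow> ('v \<times> 'v) set \<Rightarrow> bool" where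
  "measurable_relation M R \<longleftrightarrow>
     (\<forall>f\<in>M \<rightarrow>\<^sub>M M. \<forall>g\<in>M \<rightarrow>\<^sub>M M. Measurable.pred M (\<lambda>x. (f x, g x) \<in> R))"

lemma measurable_relationD:
  "measurable_relation M R \<Longrightarrow> f \<in> M \<rightarrow>\<^sub>M M \<Longrightarrow> g \<in> M \<rightarrow>\<^sub>M M \<Longrightarrow> Measurable.pred M (\<lambda>x. (f x, g x) \<in> R)"
  by (simp add: measurable_relation_def)

text \<open>\<open>F\<close> factors through the finite set of truth patterns, each pattern occurs
  on a measurable set, and so every preimage is a finite union of measurable sets.\<close>

lemma measurable_finite_pattern:
  fixes P :: "'i \<Rightarrow> 'v \<Rightarrow> bool"
  assumes "finite I" "\<And>i. i \<in> I \<Longrightarrow> Measurable.pred M (P i)" and N: "F \<in> space M \<rightarrow> space N"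
    and pattern: "\<And>x y. x \<in> space M \<Longrightarrow> y \<in> space M \<Longrightarrow> (\<And>i. i \<in> I \<Longrightarrow> P i x = P i y) \<Longrightarrow> F x = F y"
  shows "F \<in> M \<rightarrow>\<^sub>M N"
proof (rule measurableI)
  fix A
  define p where "p x = {i \<in> I. P i x}" for x
  have S: "{x \<in> space M. p x = J} \<in> sets M" if "J \<subseteq> I" for J
  proof -
    have "{x \<in> space M. p x = J} = {x \<in> space M. \<forall>i\<in>I. P i x \<longleftrightarrow> i \<in> J}" using that by (auto simp: p_def)
    moreover have "Measurable.pred M (\<lambda>x. P i x \<longleftrightarrow> i \<in> J)" if "i \<in> I" for i
      using assms(2)[OF that] by (cases "i \<in> J") auto
    then have "Measurable.pred M (\<lambda>x. \<forall>i\<in>I. P i x \<longleftrightarrow> i \<in> J)"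
      using assms(1) by (intro pred_intros_finite)
    ultimately show ?thesis by (simp add: pred_def)
  qed
  have pF: "F x = F y" if "x \<in> space M" "y \<in> space M" "p x = p y" for x y
    using pattern[OF that(1,2)] that(3) by (auto simp: p_def)
  have "F -` A \<inter> space M = (\<Union>J\<in>{J. J \<subseteq> I \<and> (\<exists>y\<in>space M. p y = J \<and> F y \<in> A)}. {x \<in> space M. p x = J})"
  proof (intro equalityI subsetI)
    fix x assume "x \<in> F -` A \<inter> space M"
    then show "x \<in> (\<Union>J\<in>{J. J \<subseteq> I \<and> (\<exists>y\<in>space M. p y = J \<and> F y \<in> A)}. {x \<in> space M. p x = J})"
      by (auto simp: p_def)
  next
    fix x assume "x \<in> (\<Union>J\<in>{J. J \<subseteq> I \<and> (\<exists>y\<in>space M. p y = J \<and> F y \<in> A)}. {x \<in> space M. p x = J})"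
    then obtain y where "x \<in> space M" "y \<in> space M" "p x = p y" "F y \<in> A" by auto
    then show "x \<in> F -` A \<inter> space M" using pF[of x y] by simp
  qed
  also have "\<dots> \<in> sets M"
  proof (rule sets.finite_UN)
    show "finite {J. J \<subseteq> I \<and> (\<exists>y\<in>space M. p y = J \<and> F y \<in> A)}"
      by (rule finite_subset[of _ "Pow I"]) (use assms(1) in auto)
  qed (use S in blast)
  finally show "F -` A \<inter> space M \<in> sets M" .
qed (use N in blast)

text \<open>Applied to the end points of the same walks from two different vertices: equal
  coincidences among the walks yield a bijection between the sets reached.\<close>

lemma bij_betw_same_kernel:
  assumes "\<And>u v. u \<in> W \<Longrightarrow> v \<in> W \<Longrightarrow> f u = f v \<longleftrightarrow> g u = g v"
  shows "\<exists>h. (\<forall>u\<in>W. h (f u) = g u) \<and> bij_betw h (f ` W) (g ` W)"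
proof -
  define h where "h z = g (SOME u. u \<in> W \<and> f u = z)" for z
  have h: "h (f u) = g u" if "u \<in> W" for u
  proof -
    have "(SOME v. v \<in> W \<and> f v = f u) \<in> W \<and> f (SOME v. v \<in> W \<and> f v = f u) = f u"
      by (rule someI[of _ u]) (use that in simp)
    then show ?thesis using assms that unfolding h_def by blast
  qed
  then have "bij_betw h (f ` W) (g ` W)"
    using assms by (auto simp: bij_betw_def inj_on_def image_iff)
  then show ?thesis using h by blast
qed

text \<open>Just enough structure to make local rules measurable. The D + 1 maps \<open>nb i\<close>
  list a vertex together with its neighbours, repetitions allowed; the countable family
  \<open>B\<close> stands in for a basis of the topology, isolating a vertex from any finite set of
  others.\<close>

locale enumerated_graph = prob_space M for M :: "'v measure" +
  fixes D :: nat and E :: "('v \<times> 'v) set" and nb :: "nat \<Rightarrow> 'v \<Rightarrow> 'v" and B :: "nat \<Rightarrow> 'v set"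
  assumes simple: "simple_graph (space M) E"
    and degree: "degree_bounded D (space M) E"
    and nb_measurable [measurable]: "nb i \<in> M \<rightarrow>\<^sub>M M"
    and nb_image: "x \<in> space M \<Longrightarrow> (\<lambda>i. nb i x) ` {..D} = insert x (E `` {x})"
    and B_sets [measurable]: "B n \<in> sets M"
    and B_separates: "x \<in> space M \<Longrightarrow> finite F \<Longrightarrow> x \<notin> F \<Longrightarrow> \<exists>n. x \<in> B n \<and> F \<inter> B n = {}"
begin

lemma nb_space: "x \<in> space M \<Longrightarrow> nb i x \<in> space M"
  using nb_measurable[of i] by (rule measurable_space)

definition walks :: "nat \<Rightarrow> nat list set" where
  "walks r = {ws. set ws \<subseteq> {..D} \<and> length ws = r}"

abbreviation walk :: "nat list \<Rightarrow> 'v \<Rightarrow> 'v" where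
  "walk ws \<equiv> fold nb ws"

lemma finite_walks: "finite (walks r)"
  unfolding walks_def by (rule finite_lists_length_eq) simp

lemma walk_measurable [measurable]: "walk ws \<in> M \<rightarrow>\<^sub>M M"
proof (induction ws)
  case Nil
  then show ?case by (simp add: id_def)
next
  case (Cons i ws)
  then show ?case unfolding fold.simps by (rule measurable_comp[OF nb_measurable])
qed

lemma walk_space: "x \<in> space M \<Longrightarrow> walk ws x \<in> space M"
  using walk_measurable by (rule measurable_space)

lemma ball_subset_space: "x \<in> space M \<Longrightarrow> ball_vertices E r x \<subseteq> space M"
  using ball_vertices_bound[OF simple degree] by blast

lemma finite_ball: "x \<in> space M \<Longrightarrow> finite (ball_vertices E r x)"
  using ball_vertices_bound[OF simple degree] by blast

text \<open>At each vertex some \<open>nb i\<close> stays put, so walks of length exactly r reach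
  everything at distance at most r.\<close>

lemma ball_eq_walks:
  assumes "x \<in> space M"
  shows "ball_vertices E r x = (\<lambda>ws. walk ws x) ` walks r"
proof (induction r)
  case 0
  then show ?case by (auto simp: ball_vertices_0 walks_def)
next
  case (Suc r)
  have "ball_vertices E (Suc r) x = (\<Union>y\<in>ball_vertices E r x. insert y (E `` {y}))"
    (is "_ = ?U")
  proof
    show "ball_vertices E (Suc r) x \<subseteq> ?U" unfolding ball_vertices_Suc using ball_vertices_self[of x E r] by blast
    have "ball_vertices E r x \<subseteq> ball_vertices E (Suc r) x" by (intro ball_vertices_mono) auto
    then show "?U \<subseteq> ball_vertices E (Suc r) x" unfolding ball_vertices_Suc by blast
  qed
  also have "\<dots> = (\<Union>ws\<in>walks r. (\<lambda>i. nb i (walk ws x)) ` {..D})"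
    unfolding Suc using nb_image[OF walk_space[OF assms]] by auto
  also have "\<dots> = (\<lambda>ws. walk ws x) ` walks (Suc r)"
  proof (intro equalityI subsetI)
    fix y assume "y \<in> (\<Union>ws\<in>walks r. (\<lambda>i. nb i (walk ws x)) ` {..D})"
    then obtain ws i where "ws \<in> walks r" "i \<le> D" "y = nb i (walk ws x)" by auto
    then show "y \<in> (\<lambda>ws. walk ws x) ` walks (Suc r)"
      by (intro image_eqI[of _ _ "ws @ [i]"]) (auto simp: walks_def)
  next
    fix y assume "y \<in> (\<lambda>ws. walk ws x) ` walks (Suc r)"
    then obtain ws where ws: "ws \<in> walks (Suc r)" "y = walk ws x" by auto
    then obtain us i where "ws = us @ [i]" by (cases ws rule: rev_cases) (auto simp: walks_def)
    then show "y \<in> (\<Union>ws\<in>walks r. (\<lambda>i. nb i (walk ws x)) ` {..D})"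
      using ws by (auto simp: walks_def)
  qed
  finally show ?case .
qed

text \<open>The sets \<open>B n\<close> separate points, which turns equality into a countable
  conjunction of measurable conditions.\<close>

lemma pred_eq [measurable (raw)]:
  assumes [measurable]: "f \<in> N \<rightarrow>\<^sub>M M" "g \<in> N \<rightarrow>\<^sub>M M"
  shows "Measurable.pred N (\<lambda>x. f x = g x)"
proof -
  have "f x = g x \<longleftrightarrow> (\<forall>n. f x \<in> B n \<longleftrightarrow> g x \<in> B n)" if "x \<in> space N" for x
  proof
    assume *: "\<forall>n. f x \<in> B n \<longleftrightarrow> g x \<in> B n"
    show "f x = g x"
      using B_separates[of "f x" "{g x}"] measurable_space[OF assms(1) that] * by auto
  qed simp
  then have "Measurable.pred N (\<lambda>x. f x = g x) \<longleftrightarrow> Measurable.pred N (\<lambda>x. \<forall>n. f x \<in> B n \<longleftrightarrow> g x \<in> B n)"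
    by (intro measurable_cong) auto
  moreover have "Measurable.pred N (\<lambda>x. \<forall>n. f x \<in> B n \<longleftrightarrow> g x \<in> B n)" by measurable
  ultimately show ?thesis by simp
qed

section \<open>Measurability of relations of bounded range\<close>

lemma in_edges_iff:
  assumes "x \<in> space M"
  shows "(x, y) \<in> E \<longleftrightarrow> x \<noteq> y \<and> (\<exists>i\<in>{..D}. nb i x = y)"
proof -
  have "y \<in> insert x (E `` {x}) \<longleftrightarrow> (\<exists>i\<in>{..D}. nb i x = y)"
    unfolding nb_image[OF assms, symmetric] by auto
  then show ?thesis using simple by (auto simp: simple_graph_def irrefl_def)
qed

lemma in_ball_iff:
  "x \<in> space M \<Longrightarrow> y \<in> ball_vertices E r x \<longleftrightarrow> (\<exists>ws\<in>walks r. walk ws x = y)"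
  by (auto simp: ball_eq_walks)

lemma measurable_relation_edges: "measurable_relation M E"
  unfolding measurable_relation_def
proof (intro ballI)
  fix f g assume [measurable]: "f \<in> M \<rightarrow>\<^sub>M M" "g \<in> M \<rightarrow>\<^sub>M M"
  have "Measurable.pred M (\<lambda>x. f x \<noteq> g x \<and> (\<exists>i\<in>{..D}. nb i (f x) = g x))" by measurable
  then show "Measurable.pred M (\<lambda>x. (f x, g x) \<in> E)"
    by (rule measurable_cong[THEN iffD2, rotated]) (simp add: in_edges_iff measurable_space[of f M M])
qed

text \<open>Bounded range makes the intermediate vertex the end of one of finitely many walks, so
  the existential quantifier becomes a finite one. The first step is split off because the walk then
  starts at \<open>f x\<close>, and the induction generalises over \<open>f\<close>.\<close>

lemma measurable_relation_relpow:
  assumes R: "measurable_relation M R" and near: "\<And>x y. (x, y) \<in> R \<Longrightarrow> y \<in> ball_vertices E r x"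
  shows "measurable_relation M (R ^^ n)"
  unfolding measurable_relation_def
proof (intro ballI)
  fix f g assume fg [measurable]: "f \<in> M \<rightarrow>\<^sub>M M" "g \<in> M \<rightarrow>\<^sub>M M"
  show "Measurable.pred M (\<lambda>x. (f x, g x) \<in> R ^^ n)"
    using fg
  proof (induction n arbitrary: f)
    case 0
    then show ?case by simp measurable
  next
    case (Suc n)
    have f [measurable]: "f \<in> M \<rightarrow>\<^sub>M M" by fact
    have [measurable]: "Measurable.pred M (\<lambda>x. (f x, walk ws (f x)) \<in> R)" for ws
      by (rule measurable_relationD[OF R]) measurable
    have [measurable]: "Measurable.pred M (\<lambda>x. (walk ws (f x), g x) \<in> R ^^ n)" for ws
      by (rule Suc.IH) (use Suc.prems in measurable)
    have "(f x, g x) \<in> R ^^ Suc n \<longleftrightarrow> (\<exists>ws\<in>walks r. (f x, walk ws (f x)) \<in> R \<and> (walk ws (f x), g x) \<in> R ^^ n)"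
      if x: "x \<in> space M" for x
    proof
      assume "(f x, g x) \<in> R ^^ Suc n"
      then obtain y where y: "(f x, y) \<in> R" "(y, g x) \<in> R ^^ n" by (blast dest: relpow_Suc_D2)
      then obtain ws where "ws \<in> walks r" "walk ws (f x) = y"
        using near[OF y(1)] in_ball_iff measurable_space[OF f x] by blast
      then show "\<exists>ws\<in>walks r. (f x, walk ws (f x)) \<in> R \<and> (walk ws (f x), g x) \<in> R ^^ n"
        using y by blast
    qed (blast intro: relpow_Suc_I2)
    moreover have "Measurable.pred M (\<lambda>x. \<exists>ws\<in>walks r. (f x, walk ws (f x)) \<in> R \<and> (walk ws (f x), g x) \<in> R ^^ n)"
      by (intro pred_intros_finite finite_walks) measurable
    ultimately show ?case by (subst measurable_cong)
  qed
qed

lemma measurable_relation_ball: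
  assumes "measurable_relation M R" "\<And>x y. (x, y) \<in> R \<Longrightarrow> y \<in> ball_vertices E r x"
  shows "measurable_relation M {(x, y). y \<in> ball_vertices R n x}"
  unfolding measurable_relation_def
proof (intro ballI)
  fix f g assume fg: "f \<in> M \<rightarrow>\<^sub>M M" "g \<in> M \<rightarrow>\<^sub>M M"
  have "Measurable.pred M (\<lambda>x. (f x, g x) \<in> R ^^ k)" for k
    by (rule measurable_relationD[OF measurable_relation_relpow[OF assms] fg])
  then have "Measurable.pred M (\<lambda>x. \<exists>k\<in>{..n}. (f x, g x) \<in> R ^^ k)"
    by (intro pred_intros_finite) auto
  then show "Measurable.pred M (\<lambda>x. (f x, g x) \<in> {(x, y). y \<in> ball_vertices R n x})"
    unfolding mem_Collect_eq prod.case mem_ball_vertices by (simp only: Bex_def atMost_iff)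
qed

lemma measurable_relation_repaired:
  assumes "measurable_relation M K" "\<And>x y. (x, y) \<in> K \<Longrightarrow> y \<in> ball_vertices E r x"
  shows "measurable_relation M (repaired L E K)"
  unfolding measurable_relation_def
proof (intro ballI)
  fix f g assume fg: "f \<in> M \<rightarrow>\<^sub>M M" "g \<in> M \<rightarrow>\<^sub>M M"
  note [measurable] = measurable_relationD[OF assms(1) fg] measurable_relationD[OF measurable_relation_edges fg]
    measurable_relationD[OF measurable_relation_ball[OF assms, of L] fg, simplified]
  have "Measurable.pred M (\<lambda>x. (f x, g x) \<in> K \<or> (f x, g x) \<in> E \<and> g x \<notin> ball_vertices K L (f x))"
    by measurable
  then show "Measurable.pred M (\<lambda>x. (f x, g x) \<in> repaired L E K)"
    by (simp add: repaired_def)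
qed

lemma measurable_relation_decoded:
  assumes \<phi> [measurable]: "\<phi> \<in> M \<rightarrow>\<^sub>M count_space UNIV"
  shows "measurable_relation M (decoded P L E \<phi>)"
  unfolding measurable_relation_def
proof (intro ballI)
  fix f g assume fg [measurable]: "f \<in> M \<rightarrow>\<^sub>M M" "g \<in> M \<rightarrow>\<^sub>M M"
  note [measurable] = measurable_relationD[OF measurable_relation_ball[OF measurable_relation_edges, of 1 L] fg, simplified]
  have "y \<in> ball_vertices E 1 x" if "(x, y) \<in> E" for x y using that by (simp add: ball_vertices_edge)
  note [measurable] = measurable_relationD[OF measurable_relation_ball[OF measurable_relation_edges this, of L] fg, simplified]
  have "Measurable.pred M (\<lambda>x. f x \<noteq> g x \<and> g x \<in> ball_vertices E L (f x) \<and> P (\<phi> (f x)) (\<phi> (g x)))"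
    by measurable
  then show "Measurable.pred M (\<lambda>x. (f x, g x) \<in> decoded P L E \<phi>)"
    by (simp add: decoded_def)
qed

lemma finite_neighbours:
  assumes "\<And>x y. (x, y) \<in> R \<Longrightarrow> y \<in> ball_vertices E r x" "x \<in> space M"
  shows "finite (R `` {x})" "card (R `` {x}) \<le> ball_bound D r"
proof -
  have *: "R `` {x} \<subseteq> ball_vertices E r x" using assms(1) by auto
  then show "finite (R `` {x})" using finite_ball[OF assms(2)] finite_subset by blast
  show "card (R `` {x}) \<le> ball_bound D r"
    using card_mono[OF finite_ball[OF assms(2)] *] ball_vertices_bound[OF simple degree assms(2), of r] by linarith
qed

text \<open>The number of neighbours is determined by which walks end at a neighbour and which of
  these coincide. The conjunction \<open>?P\<close> records both: for us = vs it says that the walk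
  ends at a neighbour.\<close>

lemma card_neighbours_measurable:
  assumes R: "measurable_relation M R" and near: "\<And>x y. (x, y) \<in> R \<Longrightarrow> y \<in> ball_vertices E r x"
  shows "(\<lambda>x. card (R `` {x})) \<in> M \<rightarrow>\<^sub>M count_space UNIV"
proof -
  let ?P = "\<lambda>(us, vs) x. walk us x = walk vs x \<and> (x, walk us x) \<in> R"
  show ?thesis
  proof (rule measurable_finite_pattern[where I="walks r \<times> walks r" and P="?P"])
    show "finite (walks r \<times> walks r)" by (simp add: finite_walks)
    show "Measurable.pred M (?P i)" for i
    proof (cases i)
      case (Pair us vs)
      have "Measurable.pred M (\<lambda>x. (x, walk us x) \<in> R)"
        by (rule measurable_relationD[OF R]) simp_all
      moreover have "Measurable.pred M (\<lambda>x. walk us x = walk vs x)" by measurable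
      ultimately show ?thesis unfolding Pair prod.case by (intro pred_intros_logic)
    qed
  next
    fix x y assume xy: "x \<in> space M" "y \<in> space M"
      and P: "\<And>i. i \<in> walks r \<times> walks r \<Longrightarrow> ?P i x = ?P i y"
    have pat: "walk us x = walk vs x \<and> (x, walk us x) \<in> R \<longleftrightarrow> walk us y = walk vs y \<and> (y, walk us y) \<in> R"
      if "us \<in> walks r" "vs \<in> walks r" for us vs
      using P[of "(us, vs)"] that by simp
    define W where "W = {us \<in> walks r. (x, walk us x) \<in> R}"
    have W: "W = {us \<in> walks r. (y, walk us y) \<in> R}" using pat[of us us for us] by (auto simp: W_def)
    have nbs: "R `` {z} = (\<lambda>us. walk us z) ` {us \<in> walks r. (z, walk us z) \<in> R}" if "z \<in> space M" for z
      using near[of z] in_ball_iff[OF that] by (auto simp: image_iff)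
    have ker: "walk us x = walk vs x \<longleftrightarrow> walk us y = walk vs y" if "us \<in> W" "vs \<in> W" for us vs
      using pat[of us vs] that W unfolding W_def by blast
    obtain h where "bij_betw h ((\<lambda>us. walk us x) ` W) ((\<lambda>us. walk us y) ` W)"
      using bij_betw_same_kernel[of W "\<lambda>us. walk us x" "\<lambda>us. walk us y"] ker by metis
    then have "bij_betw h (R `` {x}) (R `` {y})"
      unfolding nbs[OF xy(1)] nbs[OF xy(2)] W_def[symmetric] W[symmetric] .
    then show "card (R `` {x}) = card (R `` {y})" by (rule bij_betw_same_card)
  qed simp
qed

end

text \<open>With a mean written as a sum of tail probabilities, a total variation bound can be
  applied to each tail event separately.\<close>

lemma (in prob_space) integral_bounded_nat:
  assumes [measurable]: "X \<in> M \<rightarrow>\<^sub>M count_space UNIV" and K: "\<And>x. x \<in> space M \<Longrightarrow> X x \<le> K"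
  shows "(\<integral>x. real (X x) \<partial>M) = (\<Sum>d=1..K. measure M {x \<in> space M. d \<le> X x})"
proof -
  have "real (X x) = (\<Sum>d=1..K. indicator {x \<in> space M. d \<le> X x} x)" if x: "x \<in> space M" for x
  proof -
    have "(\<Sum>d=1..K. indicator {x \<in> space M. d \<le> X x} x :: real) = (\<Sum>d=1..K. if d \<le> X x then 1 else 0)"
      using x by (intro sum.cong) (auto simp: indicator_def)
    also have "\<dots> = real (card ({1..K} \<inter> {d. d \<le> X x}))" by (simp add: sum.If_cases)
    also have "{1..K} \<inter> {d. d \<le> X x} = {1..X x}" using K[OF x] by auto
    finally show ?thesis by simp
  qed
  then have "(\<integral>x. real (X x) \<partial>M) = (\<integral>x. (\<Sum>d=1..K. indicator {x \<in> space M. d \<le> X x} x) \<partial>M)"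
    by (intro Bochner_Integration.integral_cong) auto
  also have "\<dots> = (\<Sum>d=1..K. (\<integral>x. indicator {x \<in> space M. d \<le> X x} x \<partial>M))"
    by (intro Bochner_Integration.integral_sum integrable_real_indicator) (auto simp: emeasure_eq_measure)
  also have "\<dots> = (\<Sum>d=1..K. measure M {x \<in> space M. d \<le> X x})"
    by (simp add: Int_absorb2)
  finally show ?thesis .
qed

lemma measurable_count_space_weaken: "f \<in> M \<rightarrow>\<^sub>M count_space A \<Longrightarrow> f \<in> M \<rightarrow>\<^sub>M count_space UNIV"
  by (rule measurable_compose[of f M "count_space A" "\<lambda>x. x"]) simp_all

lemma rc_wf_coloured_ball: "simple_graph V E \<Longrightarrow> rc_wf (coloured_ball E \<phi> r x)"
  by (auto simp: rc_wf_def coloured_ball_def simple_graph_def sym_def irrefl_def)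

section \<open>Local statistics, proper colourings and encodings\<close>

context enumerated_graph
begin

text \<open>Which walks coincide, which return to the root, which end at adjacent vertices and how
  their ends are coloured determine the coloured ball up to isomorphism; these are finitely many
  measurable conditions.\<close>

lemma iso_class_coloured_ball_measurable:
  assumes \<phi>: "\<phi> \<in> M \<rightarrow>\<^sub>M count_space {1..k}"
  shows "(\<lambda>x. iso_class (coloured_ball E \<phi> r x)) \<in> M \<rightarrow>\<^sub>M count_space (U_classes D r k)"
proof -
  note \<phi>' [measurable] = measurable_count_space_weaken[OF \<phi>]
  let ?eq = "\<lambda>us vs x. walk us x = walk vs x" and ?root = "\<lambda>us x. walk us x = x"
    and ?edge = "\<lambda>us vs x. (walk us x, walk vs x) \<in> E" and ?col = "\<lambda>us j x. \<phi> (walk us x) = j"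
  \<comment> \<open>The entry i selects one of the four kinds of condition, and j is read only for
    the colour condition.\<close>
  let ?P = "\<lambda>(us, vs, i, j) x. if i = (0::nat) then ?eq us vs x else if i = 1 then ?root us x
    else if i = 2 then ?edge us vs x else ?col us j x"
  show ?thesis
  proof (rule measurable_finite_pattern[where I="walks r \<times> walks r \<times> {..3} \<times> {1..k}" and P="?P"])
    show "finite (walks r \<times> walks r \<times> {..3::nat} \<times> {1..k})" by (simp add: finite_walks)
    show "Measurable.pred M (?P i)" for i
    proof (cases i)
      case (fields us vs i j)
      have "Measurable.pred M (?edge us vs)"
        by (rule measurable_relationD[OF measurable_relation_edges]) simp_all
      moreover have "Measurable.pred M (?eq us vs)" "Measurable.pred M (?root us)" "Measurable.pred M (?col us j)"
        by measurable
      ultimately show ?thesis unfolding fields prod.case by (cases "i = 0"; cases "i = 1"; cases "i = 2") simp_all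
    qed
    show "(\<lambda>x. iso_class (coloured_ball E \<phi> r x)) \<in> space M \<rightarrow> space (count_space (U_classes D r k))"
      using iso_class_coloured_ball[OF simple degree _, of _ \<phi> k r] measurable_space[OF \<phi>] by auto
  next
    fix x y assume xy: "x \<in> space M" "y \<in> space M"
      and P: "\<And>i. i \<in> walks r \<times> walks r \<times> {..3} \<times> {1..k} \<Longrightarrow> ?P i x = ?P i y"
    have col: "\<phi> z \<in> {1..k}" if "z \<in> space M" for z using measurable_space[OF \<phi> that] by simp
    \<comment> \<open>There is a vertex and it has a colour, so 1 is available as a dummy value of
      j.\<close>
    then have k: "1 \<in> {1..k}" using xy(1) by (meson atLeastAtMost_iff le_refl order_trans)
    have eq: "?eq us vs x = ?eq us vs y" and root: "?root us x = ?root us y" and edge: "?edge us vs x = ?edge us vs y"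
      if "us \<in> walks r" "vs \<in> walks r" for us vs
      using P[of "(us, vs, 0, 1)"] P[of "(us, vs, 1, 1)"] P[of "(us, vs, 2, 1)"] that k by auto
    have colour: "\<phi> (walk us x) = \<phi> (walk us y)" if "us \<in> walks r" for us
      using P[of "(us, us, 3, \<phi> (walk us y))"] that col[OF walk_space[OF xy(2)], of us] by auto
    obtain h where h: "\<And>us. us \<in> walks r \<Longrightarrow> h (walk us x) = walk us y"
      and bij: "bij_betw h (ball_vertices E r x) (ball_vertices E r y)"
      using bij_betw_same_kernel[of "walks r" "\<lambda>us. walk us x" "\<lambda>us. walk us y"] eq
      unfolding ball_eq_walks[OF xy(1)] ball_eq_walks[OF xy(2)] by blast
    have rep: "\<exists>us\<in>walks r. walk us x = z" if "z \<in> ball_vertices E r x" for z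
      using that in_ball_iff[OF xy(1)] by blast
    have "h x = y"
    proof -
      obtain us where us: "us \<in> walks r" "walk us x = x" using rep[OF ball_vertices_self] by blast
      then show ?thesis using h[OF us(1)] root[OF us(1) us(1)] by simp
    qed
    moreover have "(a, b) \<in> E \<longleftrightarrow> (h a, h b) \<in> E \<and> h a \<in> ball_vertices E r y \<and> h b \<in> ball_vertices E r y"
      if ab: "a \<in> ball_vertices E r x" "b \<in> ball_vertices E r x" for a b
    proof -
      obtain us vs where "us \<in> walks r" "walk us x = a" "vs \<in> walks r" "walk vs x = b"
        using rep[OF ab(1)] rep[OF ab(2)] by blast
      moreover have "h a \<in> ball_vertices E r y" "h b \<in> ball_vertices E r y"
        using bij_betwE[OF bij] ab by blast+
      ultimately show ?thesis using h edge by metis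
    qed
    moreover have "\<phi> (h a) = \<phi> a" if a: "a \<in> ball_vertices E r x" for a
      using rep[OF a] h colour by metis
    ultimately have "rc_iso (coloured_ball E \<phi> r x) (coloured_ball E \<phi> r y)"
      unfolding rc_iso_def coloured_ball_def using bij by (intro exI[of _ h]) simp
    then show "iso_class (coloured_ball E \<phi> r x) = iso_class (coloured_ball E \<phi> r y)"
      by (rule iso_class_eq) (simp add: coloured_ball_def)
  qed
qed

lemma ball_distr_prob:
  assumes "\<phi> \<in> M \<rightarrow>\<^sub>M count_space {1..k}"
  shows "ball_distr D r k M E \<phi> \<in> prob_measures (U_classes D r k)"
  using prob_space_distr[OF iso_class_coloured_ball_measurable[OF assms]]
  by (simp add: ball_distr_def space_prob_algebra)

lemma ball_distr_in_Q_set: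
  assumes "\<phi> \<in> M \<rightarrow>\<^sub>M count_space {1..k}"
  shows "ball_distr D r k M E \<phi> \<in> Q_set D r k M E"
proof -
  interpret U: Metric_space "prob_measures (U_classes D r k)" "tv_dist (U_classes D r k)"
    by (rule Metric_space_tv_dist[OF finite_U_classes])
  have "ball_distr D r k M E ` (M \<rightarrow>\<^sub>M count_space {1..k}) \<subseteq> topspace U.mtopology"
    using ball_distr_prob by auto
  then show ?thesis unfolding Q_set_def using closure_of_subset assms by blast
qed

lemma Q_set_approx:
  assumes "q \<in> Q_set D r k M E" "0 < e"
  shows "q \<in> prob_measures (U_classes D r k)"
    "\<exists>\<phi>\<in>M \<rightarrow>\<^sub>M count_space {1..k}. tv_dist (U_classes D r k) q (ball_distr D r k M E \<phi>) < e"
proof -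
  interpret U: Metric_space "prob_measures (U_classes D r k)" "tv_dist (U_classes D r k)"
    by (rule Metric_space_tv_dist[OF finite_U_classes])
  show "q \<in> prob_measures (U_classes D r k)"
    "\<exists>\<phi>\<in>M \<rightarrow>\<^sub>M count_space {1..k}. tv_dist (U_classes D r k) q (ball_distr D r k M E \<phi>) < e"
    using assms unfolding Q_set_def U.metric_closure_of by auto
qed

text \<open>Vertices in the same class of a countable proper colouring are coloured simultaneously,
  each with the least colour not used in its ball by vertices of earlier classes.\<close>

lemma proper_colouring:
  obtains c where "c \<in> M \<rightarrow>\<^sub>M count_space UNIV" "\<And>x. x \<in> space M \<Longrightarrow> c x < ball_bound D r"
    "\<And>x y. x \<in> space M \<Longrightarrow> y \<in> ball_vertices E r x \<Longrightarrow> y \<noteq> x \<Longrightarrow> c x \<noteq> c y"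
proof -
  \<comment> \<open>The least n for which \<open>B n\<close> isolates x within its ball: a proper
    colouring, but with infinitely many colours.\<close>
  define c0 where "c0 x = (LEAST n. x \<in> B n \<and> (\<forall>ws\<in>walks r. walk ws x \<noteq> x \<longrightarrow> walk ws x \<notin> B n))" for x
  have [measurable]: "c0 \<in> M \<rightarrow>\<^sub>M count_space UNIV" unfolding c0_def by measurable
  have c0: "x \<in> B (c0 x) \<and> (\<forall>ws\<in>walks r. walk ws x \<noteq> x \<longrightarrow> walk ws x \<notin> B (c0 x))" if x: "x \<in> space M" for x
  proof -
    obtain n where n: "x \<in> B n" "(ball_vertices E r x - {x}) \<inter> B n = {}"
      using B_separates[OF x, of "ball_vertices E r x - {x}"] finite_ball[OF x] by auto
    then have "x \<in> B n \<and> (\<forall>ws\<in>walks r. walk ws x \<noteq> x \<longrightarrow> walk ws x \<notin> B n)"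
      unfolding ball_eq_walks[OF x] by blast
    then show ?thesis unfolding c0_def by (rule LeastI)
  qed
  have c0_proper: "c0 x \<noteq> c0 y" if xy: "x \<in> space M" "y \<in> ball_vertices E r x" "y \<noteq> x" for x y
  proof -
    obtain ws where "ws \<in> walks r" "walk ws x = y" using xy in_ball_iff[OF xy(1)] by blast
    then have "y \<notin> B (c0 x)" using c0[OF xy(1)] xy(3) by blast
    moreover have "y \<in> space M" using ball_subset_space xy by blast
    then have "y \<in> B (c0 y)" using c0 by blast
    ultimately show ?thesis by metis
  qed
  \<comment> \<open>Stage n has final values exactly where \<open>c0\<close> is below n. The default
    0 elsewhere is never consulted, since the recursion only looks at walks ending at vertices of
    earlier classes.\<close>
  define g where "g = rec_nat (\<lambda>x. 0::nat) (\<lambda>n gn x. if c0 x = n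
    then (LEAST j. \<forall>ws\<in>walks r. c0 (walk ws x) < n \<longrightarrow> gn (walk ws x) \<noteq> j) else gn x)"
  have g_Suc: "g (Suc n) x = (if c0 x = n
    then (LEAST j. \<forall>ws\<in>walks r. c0 (walk ws x) < n \<longrightarrow> g n (walk ws x) \<noteq> j) else g n x)" for n x
    by (simp add: g_def)
  have [measurable]: "g n \<in> M \<rightarrow>\<^sub>M count_space UNIV" for n
  proof (induction n)
    case 0
    then show ?case by (simp add: g_def)
  next
    case (Suc n)
    note [measurable] = this
    have "(\<lambda>x. if c0 x = n then (LEAST j. \<forall>ws\<in>walks r. c0 (walk ws x) < n \<longrightarrow> g n (walk ws x) \<noteq> j) else g n x)
      \<in> M \<rightarrow>\<^sub>M count_space UNIV" by measurable
    then show ?case unfolding g_Suc[abs_def] .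
  qed
  define c where "c x = g (Suc (c0 x)) x" for x
  have g_c: "g m x = c x" if "c0 x < m" for m x
    using that
  proof (induction m)
    case (Suc m)
    show ?case
    proof (cases "c0 x = m")
      case True
      then show ?thesis by (simp add: c_def)
    next
      case False
      then show ?thesis using Suc g_Suc[of m x] by auto
    qed
  qed simp
  have c_eq: "c x = (LEAST j. \<forall>ws\<in>walks r. c0 (walk ws x) < c0 x \<longrightarrow> c (walk ws x) \<noteq> j)" for x
  proof -
    have "c x = (LEAST j. \<forall>ws\<in>walks r. c0 (walk ws x) < c0 x \<longrightarrow> g (c0 x) (walk ws x) \<noteq> j)"
      by (simp add: c_def g_Suc)
    also have "\<dots> = (LEAST j. \<forall>ws\<in>walks r. c0 (walk ws x) < c0 x \<longrightarrow> c (walk ws x) \<noteq> j)"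
      using g_c by (intro arg_cong[where f=Least]) (auto simp: fun_eq_iff)
    finally show ?thesis .
  qed
  have c: "c x < ball_bound D r \<and> (\<forall>ws\<in>walks r. c0 (walk ws x) < c0 x \<longrightarrow> c (walk ws x) \<noteq> c x)"
    if x: "x \<in> space M" for x
  proof -
    \<comment> \<open>Without x the ball has fewer than \<open>ball_bound D r\<close> vertices, so
      some colour below that bound is free, and the least admissible colour is no larger.\<close>
    let ?N = "ball_vertices E r x - {x}"
    have "card (ball_vertices E r x) \<le> ball_bound D r"
      using ball_vertices_bound[OF simple degree x] by blast
    moreover have "card ?N < card (ball_vertices E r x)"
      using finite_ball[OF x] by (intro psubset_card_mono) auto
    moreover have "card (c ` ?N) \<le> card ?N" using finite_ball[OF x] by (intro card_image_le) auto
    ultimately have "card (c ` ?N) < card {..<ball_bound D r}" by simp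
    moreover have "finite (c ` ?N)" using finite_ball[OF x] by simp
    ultimately have "\<not> {..<ball_bound D r} \<subseteq> c ` ?N" using card_mono leD by blast
    then obtain j where j: "j < ball_bound D r" "j \<notin> c ` ?N" by auto
    have ok: "\<forall>ws\<in>walks r. c0 (walk ws x) < c0 x \<longrightarrow> c (walk ws x) \<noteq> j"
    proof (intro ballI impI)
      fix ws assume "ws \<in> walks r" "c0 (walk ws x) < c0 x"
      then have "walk ws x \<in> ?N" unfolding ball_eq_walks[OF x] by auto
      then show "c (walk ws x) \<noteq> j" using j(2) by blast
    qed
    show ?thesis
      using LeastI[of "\<lambda>j. \<forall>ws\<in>walks r. c0 (walk ws x) < c0 x \<longrightarrow> c (walk ws x) \<noteq> j", OF ok]
        Least_le[of "\<lambda>j. \<forall>ws\<in>walks r. c0 (walk ws x) < c0 x \<longrightarrow> c (walk ws x) \<noteq> j", OF ok] j(1)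
      unfolding c_eq[of x, symmetric] by linarith
  qed
  have "c x \<noteq> c y" if xy: "x \<in> space M" "y \<in> ball_vertices E r x" "y \<noteq> x" for x y
  proof -
    have y: "y \<in> space M" "x \<in> ball_vertices E r y"
      using xy ball_subset_space ball_vertices_sym[of E y r x] simple by (auto simp: simple_graph_def)
    consider "c0 y < c0 x" | "c0 x < c0 y" using c0_proper[OF xy] by linarith
    then show ?thesis
    proof cases
      case 1
      then show ?thesis using c[OF xy(1)] in_ball_iff[OF xy(1), of y r] xy(2) by metis
    next
      case 2
      then show ?thesis using c[OF y(1)] in_ball_iff[OF y(1), of x r] y(2) by metis
    qed
  qed
  moreover have "c \<in> M \<rightarrow>\<^sub>M count_space UNIV"
    unfolding c_def by (rule measurable_compose_countable[of "\<lambda>n. g (Suc n)"]) measurable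
  ultimately show thesis using c by (intro that[of c]) auto
qed

text \<open>Measurability of the encoding is again a finite pattern: the label of the vertex and,
  for each walk and each label j, whether the walk ends at an \<open>H\<close>-neighbour labelled
  j.\<close>

lemma exists_encoding:
  assumes H: "simple_graph (space M) H" "measurable_relation M H"
    and near: "\<And>x y. (x, y) \<in> H \<Longrightarrow> y \<in> ball_vertices E L x" and m: "m = ball_bound D (2 * L)"
  shows "\<exists>\<phi>\<in>M \<rightarrow>\<^sub>M count_space {1..m * 2 ^ m}. decoded (colour_edge m) L E \<phi> = H"
proof -
  obtain c where c: "c \<in> M \<rightarrow>\<^sub>M count_space UNIV" "\<And>x. x \<in> space M \<Longrightarrow> c x < m"
    "\<And>x y. x \<in> space M \<Longrightarrow> y \<in> ball_vertices E (2 * L) x \<Longrightarrow> y \<noteq> x \<Longrightarrow> c x \<noteq> c y"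
    unfolding m using proper_colouring[of "2 * L"] by metis
  note [measurable] = c(1)
  have HV: "H \<subseteq> space M \<times> space M" using H(1) by (simp add: simple_graph_def)
  let ?e = "encode_graph m H c"
  have labels: "c ` (H `` {x}) = {j\<in>{..<m}. \<exists>us\<in>walks L. (x, walk us x) \<in> H \<and> c (walk us x) = j}"
    if x: "x \<in> space M" for x
  proof (intro equalityI subsetI)
    fix j assume "j \<in> c ` (H `` {x})"
    then obtain y where y: "(x, y) \<in> H" "j = c y" by auto
    then obtain us where "us \<in> walks L" "walk us x = y" using near[OF y(1)] in_ball_iff[OF x] by blast
    then show "j \<in> {j\<in>{..<m}. \<exists>us\<in>walks L. (x, walk us x) \<in> H \<and> c (walk us x) = j}"
      using y c(2)[of y] HV by auto
  qed auto
  let ?P = "\<lambda>(us, j, b) x. if b then c x = j else (x, walk us x) \<in> H \<and> c (walk us x) = j"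
  have "?e \<in> M \<rightarrow>\<^sub>M count_space {1..m * 2 ^ m}"
  proof (rule measurable_finite_pattern[where I="walks L \<times> {..<m} \<times> UNIV" and P="?P"])
    show "finite (walks L \<times> {..<m} \<times> (UNIV :: bool set))" by (simp add: finite_walks)
    show "Measurable.pred M (?P i)" for i
    proof (cases i)
      case (fields us j b)
      have "Measurable.pred M (\<lambda>x. (x, walk us x) \<in> H)"
        by (rule measurable_relationD[OF H(2)]) simp_all
      moreover have "Measurable.pred M (\<lambda>x. c (walk us x) = j)" "Measurable.pred M (\<lambda>x. c x = j)"
        by measurable
      ultimately show ?thesis unfolding fields prod.case by (cases b) (simp_all add: pred_intros_logic)
    qed
    show "?e \<in> space M \<rightarrow> space (count_space {1..m * 2 ^ m})"
    proof
      fix x assume x: "x \<in> space M"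
      have "c ` (H `` {x}) \<subseteq> {..<m}" unfolding labels[OF x] by auto
      then show "?e x \<in> space (count_space {1..m * 2 ^ m})" using encode_graph_bound[of c x m H] c(2)[OF x] by simp
    qed
  next
    fix x y assume xy: "x \<in> space M" "y \<in> space M"
      and P: "\<And>i. i \<in> walks L \<times> {..<m} \<times> UNIV \<Longrightarrow> ?P i x = ?P i y"
    \<comment> \<open>Some walk is needed to form an index triple, although \<open>?P\<close> does
      not read it when its flag is \<open>True\<close>.\<close>
    obtain us where us: "us \<in> walks L" using in_ball_iff[OF xy(1), of x L] by auto
    have "c x = c y" using P[of "(us, c x, True)"] us c(2)[OF xy(1)] by auto
    moreover have "c ` (H `` {x}) = c ` (H `` {y})"
    proof -
      have "(x, walk us x) \<in> H \<and> c (walk us x) = j \<longleftrightarrow> (y, walk us y) \<in> H \<and> c (walk us y) = j"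
        if "us \<in> walks L" "j < m" for us j
        using P[of "(us, j, False)"] that by simp
      then show ?thesis unfolding labels[OF xy(1)] labels[OF xy(2)] by blast
    qed
    ultimately show "?e x = ?e y" by (simp add: encode_graph_def)
  qed
  moreover have "decoded (colour_edge m) L E ?e = H"
    using finite_neighbours[of H L, OF near] by (intro decoded_encode_graph[OF simple H(1) near c(3) c(2)]) auto
  ultimately show ?thesis by blast
qed

text \<open>The recovered degree is isomorphism invariant, so any representative of a class gives
  it, and a class of a finite ball has a representative on \<open>nat\<close>. The degree tail is
  therefore an event of the local statistics.\<close>

lemma measure_ball_distr_degree:
  assumes \<phi>: "\<phi> \<in> M \<rightarrow>\<^sub>M count_space {1..k}" and L: "0 < L"
  shows "measure (ball_distr D (L * L) k M E \<phi>)
      {u \<in> U_classes D (L * L) k. \<exists>H\<in>u. d \<le> card (root_neighbours P L H)} =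
    measure M {x \<in> space M. d \<le> card (repaired L E (decoded P L E \<phi>) `` {x})}"
proof -
  let ?F = "\<lambda>x. iso_class (coloured_ball E \<phi> (L * L) x)"
  let ?U = "U_classes D (L * L) k"
  let ?S = "{u \<in> ?U. \<exists>H\<in>u. d \<le> card (root_neighbours P L H)}"
  have "?F x \<in> ?S \<longleftrightarrow> d \<le> card (repaired L E (decoded P L E \<phi>) `` {x})" if x: "x \<in> space M" for x
  proof -
    let ?B = "coloured_ball E \<phi> (L * L) x"
    have wf: "rc_wf ?B" using rc_wf_coloured_ball[OF simple] .
    have eq: "card (root_neighbours P L H) = card (repaired L E (decoded P L E \<phi>) `` {x})" if "H \<in> ?F x" for H
      using card_root_neighbours_iso[of ?B H P L] that wf root_neighbours_coloured_ball[OF L, of P E \<phi> x]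
      by (auto simp: iso_class_def)
    have fin: "finite (verts ?B)" using finite_ball[OF x] by (simp add: coloured_ball_def)
    have "\<exists>H. H \<in> ?F x" by (rule rc_copy[OF wf fin]) (auto simp: iso_class_def)
    moreover have "?F x \<in> ?U"
      using measurable_space[OF iso_class_coloured_ball_measurable[OF \<phi>] x] by simp
    ultimately show ?thesis using eq by auto
  qed
  then have "?F -` ?S \<inter> space M = {x \<in> space M. d \<le> card (repaired L E (decoded P L E \<phi>) `` {x})}" by blast
  then show ?thesis
    unfolding ball_distr_def
    by (subst measure_distr[OF iso_class_coloured_ball_measurable[OF \<phi>]]) auto
qed

end

section \<open>Transfer of rewirings\<close>

lemma tv_dist_upper:
  assumes "finite U" "A \<subseteq> U"
  shows "\<bar>measure P A - measure Q A\<bar> \<le> tv_dist U P Q"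
  unfolding tv_dist_def using assms by (intro cSUP_upper bdd_above_finite) auto

lemma tv_dist_commute: "tv_dist U P Q = tv_dist U Q P"
  by (simp add: tv_dist_def abs_minus_commute)

lemma tv_dist_prob_le_1:
  assumes "P \<in> prob_measures U" "Q \<in> prob_measures U"
  shows "tv_dist U P Q \<le> 1"
  unfolding tv_dist_def
proof (rule cSUP_least)
  fix A
  interpret P: prob_space P using assms(1) by (simp add: space_prob_algebra)
  interpret Q: prob_space Q using assms(2) by (simp add: space_prob_algebra)
  show "\<bar>measure P A - measure Q A\<bar> \<le> 1"
    using P.prob_le_1[of A] Q.prob_le_1[of A] measure_nonneg[of P A] measure_nonneg[of Q A] by linarith
qed (rule Pow_not_empty)

lemma hausdorff_dist_swap: "hausdorff_dist d A B = hausdorff_dist (\<lambda>a b. d b a) B A"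
  by (simp add: hausdorff_dist_def max.commute)

lemma hausdorff_dist_tv_commute:
  "hausdorff_dist (tv_dist U) A B = hausdorff_dist (tv_dist U) B A"
proof -
  have "(\<lambda>P Q. tv_dist U Q P) = tv_dist U" by (intro ext tv_dist_commute)
  then show ?thesis by (subst hausdorff_dist_swap) (simp only:)
qed

text \<open>The bounds on \<open>d\<close> are what makes the real-valued \<open>INF\<close> and
  \<open>SUP\<close> behave as genuine bounds.\<close>

lemma hausdorff_dist_lessD:
  assumes "hausdorff_dist d A B < \<delta>" "a \<in> A" "B \<noteq> {}"
    and d: "\<And>a b. a \<in> A \<Longrightarrow> b \<in> B \<Longrightarrow> 0 \<le> d a b \<and> d a b \<le> 1"
  shows "\<exists>b\<in>B. d a b < \<delta>"
proof -
  obtain b0 where b0: "b0 \<in> B" using assms(3) by blast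
  have bdd: "bdd_below (d a' ` B)" if "a' \<in> A" for a'
    by (rule bdd_belowI[of _ 0]) (use d[OF that] in blast)
  have "(INF b\<in>B. d a' b) \<le> 1" if "a' \<in> A" for a'
    using cINF_lower2[OF bdd[OF that] b0] d[OF that b0] by blast
  then have "bdd_above ((\<lambda>a. INF b\<in>B. d a b) ` A)" by (rule bdd_aboveI2)
  then have "(INF b\<in>B. d a b) \<le> (SUP a\<in>A. INF b\<in>B. d a b)" by (rule cSUP_upper[OF assms(2)])
  also have "\<dots> < \<delta>" using assms(1) by (simp add: hausdorff_dist_def)
  finally show ?thesis using cInf_lessD[of "d a ` B" \<delta>] assms(3) by auto
qed

section \<open>The transfer principle\<close>

lemma ball_bound_pos: "0 < ball_bound D r"
  by (cases r) auto

text \<open>Pairs of a label below m = \<open>ball_bound D (2 * L)\<close> and a set of such labels,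
  as in \<open>encode_graph_bound\<close>.\<close>

definition colour_count :: "nat \<Rightarrow> nat \<Rightarrow> nat" where
  "colour_count D L = ball_bound D (2 * L) * 2 ^ ball_bound D (2 * L)"

lemma colour_count_pos: "0 < colour_count D L"
  by (simp add: colour_count_def ball_bound_pos)

text \<open>The radius is the one at which \<open>root_neighbours_coloured_ball\<close> sees the
  whole rule, and the colours are those of the encoding.\<close>

definition Q_dist :: "nat \<Rightarrow> nat \<Rightarrow> 'v measure \<Rightarrow> ('v \<times> 'v) set \<Rightarrow> 'w measure \<Rightarrow> ('w \<times> 'w) set \<Rightarrow> real" where
  "Q_dist D L M E M' E' = hausdorff_dist (tv_dist (U_classes D (L * L) (colour_count D L)))
     (Q_set D (L * L) (colour_count D L) M E) (Q_set D (L * L) (colour_count D L) M' E')"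

lemma Q_dist_commute: "Q_dist D L M E M' E' = Q_dist D L M' E' M E"
  unfolding Q_dist_def by (rule hausdorff_dist_tv_commute)

text \<open>The first graph is encoded by a colouring, which is replaced by a colouring of the second
  graph with almost the same local statistics. Decoding the latter and adding the missing edges is
  a local rule that always produces a bi-Lipschitz equivalent graph.\<close>

lemma transfer_bilipschitz:
  fixes M1 :: "'v measure" and M2 :: "'w measure"
  assumes "enumerated_graph M1 D E1 nb1 B1" and "enumerated_graph M2 D E2 nb2 B2" and L: "0 < L"
    and H1: "simple_graph (space M1) H1" "measurable_relation M1 H1" "bilipschitz L E1 H1"
    and \<delta>: "Q_dist D L M1 E1 M2 E2 < \<delta>"
  obtains H2 where "simple_graph (space M2) H2" "measurable_relation M2 H2" "bilipschitz L E2 H2"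
    "\<bar>(\<integral>x. real (card (H2 `` {x})) \<partial>M2) - (\<integral>x. real (card (H1 `` {x})) \<partial>M1)\<bar> \<le> real (ball_bound D L) * \<delta>"
proof -
  interpret G1: enumerated_graph M1 D E1 nb1 B1 by fact
  interpret G2: enumerated_graph M2 D E2 nb2 B2 by fact
  define m where "m = ball_bound D (2 * L)"
  define k where "k = colour_count D L"
  define U where "U = U_classes D (L * L) k"
  interpret U: Metric_space "prob_measures U" "tv_dist U"
    unfolding U_def by (rule Metric_space_tv_dist[OF finite_U_classes])
  have k: "k = m * 2 ^ m" "0 < k" by (simp_all add: k_def m_def colour_count_def ball_bound_pos)
  define P where "P = colour_edge m"
  define T1 where "T1 \<phi> = repaired L E1 (decoded P L E1 \<phi>)" for \<phi>
  define T2 where "T2 \<phi> = repaired L E2 (decoded P L E2 \<phi>)" for \<phi>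
  obtain \<phi>1 where \<phi>1: "\<phi>1 \<in> M1 \<rightarrow>\<^sub>M count_space {1..k}" "decoded P L E1 \<phi>1 = H1"
    using G1.exists_encoding[OF H1(1,2) _ m_def] H1(3) unfolding P_def bilipschitz_def k by blast
  have T1: "T1 \<phi>1 = H1" using \<phi>1(2) repaired_bilipschitz[OF H1(3)] by (simp add: T1_def)
  let ?b1 = "ball_distr D (L * L) k M1 E1" and ?b2 = "ball_distr D (L * L) k M2 E2"
  let ?Q1 = "Q_set D (L * L) k M1 E1" and ?Q2 = "Q_set D (L * L) k M2 E2"
  have Q1: "?Q1 \<subseteq> prob_measures U" and Q2: "?Q2 \<subseteq> prob_measures U"
    using G1.Q_set_approx(1)[of _ "L * L" k 1] G2.Q_set_approx(1)[of _ "L * L" k 1] by (auto simp: U_def)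
  have b1: "?b1 \<phi>1 \<in> ?Q1" using G1.ball_distr_in_Q_set \<phi>1(1) .
  have "(\<lambda>_. 1) \<in> M2 \<rightarrow>\<^sub>M count_space {1..k}" using k(2) by (intro measurable_const) simp
  then have ne: "?Q2 \<noteq> {}" using G2.ball_distr_in_Q_set by blast
  have "0 \<le> tv_dist U a b \<and> tv_dist U a b \<le> 1" if "a \<in> ?Q1" "b \<in> ?Q2" for a b
    using U.nonneg tv_dist_prob_le_1[OF subsetD[OF Q1 that(1)] subsetD[OF Q2 that(2)]] by simp
  then obtain q where q: "q \<in> ?Q2" "tv_dist U (?b1 \<phi>1) q < \<delta>"
    using hausdorff_dist_lessD[OF \<delta>[unfolded Q_dist_def, folded k_def, folded U_def] b1 ne] by blast
  \<comment> \<open>The Hausdorff bound only provides a point q of the closure; the slack in the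
    strict inequality pays for replacing q by the statistics of an actual colouring.\<close>
  have gap: "0 < \<delta> - tv_dist U (?b1 \<phi>1) q" using q(2) by simp
  obtain \<phi>2 where \<phi>2: "\<phi>2 \<in> M2 \<rightarrow>\<^sub>M count_space {1..k}" "tv_dist U q (?b2 \<phi>2) < \<delta> - tv_dist U (?b1 \<phi>1) q"
    by (rule bexE[OF G2.Q_set_approx(2)[OF q(1) gap, folded U_def]])
  have b2: "?b2 \<phi>2 \<in> prob_measures U" using G2.ball_distr_prob[OF \<phi>2(1)] by (simp add: U_def)
  have "tv_dist U (?b1 \<phi>1) (?b2 \<phi>2) \<le> tv_dist U (?b1 \<phi>1) q + tv_dist U q (?b2 \<phi>2)"
    by (rule U.triangle[OF subsetD[OF Q1 b1] subsetD[OF Q2 q(1)] b2])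
  then have tv: "tv_dist U (?b1 \<phi>1) (?b2 \<phi>2) \<le> \<delta>" using \<phi>2(2) by linarith
  have dec1: "\<And>x y. (x, y) \<in> decoded P L E1 \<phi>1 \<Longrightarrow> y \<in> ball_vertices E1 L x"
    and dec2: "\<And>x y. (x, y) \<in> decoded P L E2 \<phi>2 \<Longrightarrow> y \<in> ball_vertices E2 L x" by (auto simp: decoded_def)
  have rel: "measurable_relation M1 (T1 \<phi>1)" "measurable_relation M2 (T2 \<phi>2)"
    unfolding T1_def T2_def
    using G1.measurable_relation_repaired[OF G1.measurable_relation_decoded dec1] dec1
      G2.measurable_relation_repaired[OF G2.measurable_relation_decoded dec2] dec2
      measurable_count_space_weaken[OF \<phi>1(1)] measurable_count_space_weaken[OF \<phi>2(1)] by auto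
  have bl: "bilipschitz L E1 (T1 \<phi>1)" "bilipschitz L E2 (T2 \<phi>2)"
    unfolding T1_def T2_def using bilipschitz_repaired_decoded[OF L] by blast+
  then have near: "\<And>x y. (x, y) \<in> T1 \<phi>1 \<Longrightarrow> y \<in> ball_vertices E1 L x"
    "\<And>x y. (x, y) \<in> T2 \<phi>2 \<Longrightarrow> y \<in> ball_vertices E2 L x" by (auto simp: bilipschitz_def)
  let ?K = "ball_bound D L"
  have int1: "(\<integral>x. real (card (T1 \<phi>1 `` {x})) \<partial>M1) = (\<Sum>d=1..?K. measure M1 {x \<in> space M1. d \<le> card (T1 \<phi>1 `` {x})})"
    by (rule G1.integral_bounded_nat[OF G1.card_neighbours_measurable[OF rel(1) near(1)] G1.finite_neighbours(2)[OF near(1)]])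
  have int2: "(\<integral>x. real (card (T2 \<phi>2 `` {x})) \<partial>M2) = (\<Sum>d=1..?K. measure M2 {x \<in> space M2. d \<le> card (T2 \<phi>2 `` {x})})"
    by (rule G2.integral_bounded_nat[OF G2.card_neighbours_measurable[OF rel(2) near(2)] G2.finite_neighbours(2)[OF near(2)]])
  have "\<bar>measure M2 {x \<in> space M2. d \<le> card (T2 \<phi>2 `` {x})} - measure M1 {x \<in> space M1. d \<le> card (T1 \<phi>1 `` {x})}\<bar> \<le> \<delta>" for d
  proof -
    let ?S = "{u \<in> U_classes D (L * L) k. \<exists>H\<in>u. d \<le> card (root_neighbours P L H)}"
    have "\<bar>measure (?b1 \<phi>1) ?S - measure (?b2 \<phi>2) ?S\<bar> \<le> tv_dist U (?b1 \<phi>1) (?b2 \<phi>2)"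
      by (rule tv_dist_upper) (auto simp: U_def finite_U_classes)
    then show ?thesis
      using tv G1.measure_ball_distr_degree[OF \<phi>1(1) L, of d P] G2.measure_ball_distr_degree[OF \<phi>2(1) L, of d P]
      unfolding T1_def T2_def by linarith
  qed
  then have "(\<Sum>d=1..?K. \<bar>measure M2 {x \<in> space M2. d \<le> card (T2 \<phi>2 `` {x})} - measure M1 {x \<in> space M1. d \<le> card (T1 \<phi>1 `` {x})}\<bar>)
    \<le> (\<Sum>d=1..?K. \<delta>)" by (intro sum_mono)
  then have "\<bar>(\<integral>x. real (card (T2 \<phi>2 `` {x})) \<partial>M2) - (\<integral>x. real (card (T1 \<phi>1 `` {x})) \<partial>M1)\<bar> \<le> real ?K * \<delta>"
    unfolding int1 int2 sum_subtractf[symmetric] using order_trans[OF sum_abs] by simp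
  moreover have "simple_graph (space M2) (T2 \<phi>2)"
    unfolding T2_def P_def by (intro simple_graph_repaired simple_graph_decoded G2.simple symp_colour_edge)
  ultimately show thesis using that[of "T2 \<phi>2"] rel(2) bl(2) unfolding T1 by blast
qed

section \<open>Conservation of mass\<close>

definition mass_conserving :: "'v measure \<Rightarrow> ('v \<times> 'v) set \<Rightarrow> bool" where
  "mass_conserving M R \<longleftrightarrow> (\<forall>A\<in>sets M. \<forall>B\<in>sets M.
     (\<integral>\<^sup>+x\<in>A. of_nat (card (R `` {x} \<inter> B)) \<partial>M) = (\<integral>\<^sup>+x\<in>B. of_nat (card (R `` {x} \<inter> A)) \<partial>M))"

text \<open>Injectivity on the whole set keeps the images of the pieces disjoint, so measures add up
  on both sides.\<close>

lemma measure_image_pieces: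
  fixes f :: "'v \<Rightarrow> 'v" and l :: "'v \<Rightarrow> nat"
  assumes "finite I" "l ` A \<subseteq> I" "inj_on f A"
    and pieces: "\<And>i. i \<in> I \<Longrightarrow> {x \<in> A. l x = i} \<in> sets M"
    and image: "\<And>i. i \<in> I \<Longrightarrow> f ` {x \<in> A. l x = i} \<in> sets M \<and>
      emeasure M (f ` {x \<in> A. l x = i}) = emeasure M {x \<in> A. l x = i}"
  shows "f ` A \<in> sets M \<and> emeasure M (f ` A) = emeasure M A"
proof -
  let ?A = "\<lambda>i. {x \<in> A. l x = i}"
  have A: "A = (\<Union>i\<in>I. ?A i)" using assms(2) by auto
  then have fA: "f ` A = (\<Union>i\<in>I. f ` ?A i)" by blast
  have "disjoint_family_on ?A I" by (auto simp: disjoint_family_on_def)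
  then have 1: "(\<Sum>i\<in>I. emeasure M (?A i)) = emeasure M A"
    using A pieces assms(1) by (subst (2) A) (intro sum_emeasure, auto)
  have "disjoint_family_on (\<lambda>i. f ` ?A i) I"
    using assms(3) by (auto simp: disjoint_family_on_def inj_on_def)
  then have 2: "(\<Sum>i\<in>I. emeasure M (f ` ?A i)) = emeasure M (f ` A)"
    unfolding fA using image assms(1) by (intro sum_emeasure) auto
  have "f ` A \<in> sets M" unfolding fA using image assms(1) by (intro sets.finite_UN) auto
  moreover have "emeasure M (f ` A) = emeasure M A" using 1 2 image by (metis (no_types, lifting) sum.cong)
  ultimately show ?thesis by blast
qed

section \<open>Measure preservation along walks\<close>

context enumerated_graph
begin

text \<open>Images under measurable maps are not measurable in general. Here the edge relation is
  symmetric, so every preimage of y under \<open>nb i\<close> is among the finitely many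
  \<open>nb j y\<close>.\<close>

lemma nb_image_sets:
  assumes [measurable]: "A \<in> sets M" and i: "i \<le> D"
  shows "nb i ` A \<in> sets M"
proof -
  have A: "A \<subseteq> space M" using assms(1) by (rule sets.sets_into_space)
  have "nb i ` A = {y \<in> space M. \<exists>j\<in>{..D}. nb j y \<in> A \<and> nb i (nb j y) = y}"
  proof (intro equalityI subsetI)
    fix y assume "y \<in> nb i ` A"
    then obtain x where x: "x \<in> A" "y = nb i x" by blast
    then have xM: "x \<in> space M" "y \<in> space M" using A nb_space by auto
    then have "y \<in> insert x (E `` {x})" using nb_image[OF xM(1)] i x by blast
    then have "x \<in> insert y (E `` {y})" using simple by (auto simp: simple_graph_def dest: symD)
    then obtain j where "j \<le> D" "nb j y = x" using nb_image[OF xM(2)] by (metis atMost_iff imageE)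
    then have "nb j y \<in> A \<and> nb i (nb j y) = y" using x by metis
    then show "y \<in> {y \<in> space M. \<exists>j\<in>{..D}. nb j y \<in> A \<and> nb i (nb j y) = y}"
      using xM(2) \<open>j \<le> D\<close> by blast
  next
    fix y assume "y \<in> {y \<in> space M. \<exists>j\<in>{..D}. nb j y \<in> A \<and> nb i (nb j y) = y}"
    then obtain j where "nb j y \<in> A" "nb i (nb j y) = y" by blast
    then show "y \<in> nb i ` A" by (metis imageI)
  qed
  also have "\<dots> \<in> sets M" by measurable
  finally show ?thesis .
qed

text \<open>A set of vertices moved along edges injectively is split according to the colour of the
  target in a proper colouring of the square of the graph, so that all edges between a piece and
  its image are the ones moved along.\<close>

lemma nb_measure:
  assumes mass: "mass_conserving M E" and A [measurable]: "A \<in> sets M" and i: "i \<le> D" and inj: "inj_on (nb i) A"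
  shows "nb i ` A \<in> sets M \<and> emeasure M (nb i ` A) = emeasure M A"
proof -
  obtain c where c [measurable]: "c \<in> M \<rightarrow>\<^sub>M count_space UNIV" and c_less: "\<And>x. x \<in> space M \<Longrightarrow> c x < ball_bound D 2"
    and proper: "\<And>x y. x \<in> space M \<Longrightarrow> y \<in> ball_vertices E 2 x \<Longrightarrow> y \<noteq> x \<Longrightarrow> c x \<noteq> c y"
    using proper_colouring[of 2] by metis
  let ?m = "ball_bound D 2"
  \<comment> \<open>The value \<open>?m\<close> lies above all colours used by \<open>c\<close> and
    marks the vertices that stay put.\<close>
  define l where "l x = (if nb i x = x then ?m else c (nb i x))" for x
  have AM: "A \<subseteq> space M" using A by (rule sets.sets_into_space)
  have E: "sym E" "irrefl E" using simple by (auto simp: simple_graph_def)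
  have near: "z = y" if "(x, y) \<in> E" "(x, z) \<in> E" "c y = c z" for x y z
  proof -
    have "y \<in> space M" using that(1) simple by (auto simp: simple_graph_def)
    moreover have "z \<in> ball_vertices E (1 + 1) y"
      using that(1,2) E(1) by (intro ball_vertices_trans[of x]) (auto intro: ball_vertices_edge dest: symD)
    ultimately show ?thesis using proper[of y z] that(3) by (auto simp: numeral_2_eq_2)
  qed
  show ?thesis
  proof (rule measure_image_pieces[where I="{..?m}" and l=l, OF _ _ inj])
    show "l ` A \<subseteq> {..?m}" using c_less[OF nb_space] AM by (auto simp: l_def less_imp_le)
    have [measurable]: "l \<in> M \<rightarrow>\<^sub>M count_space UNIV" unfolding l_def by measurable
    show pieces: "{x \<in> A. l x = b} \<in> sets M" for b by measurable
    fix b assume b: "b \<in> {..?m}"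
    let ?A = "{x \<in> A. l x = b}" and ?C = "nb i ` {x \<in> A. l x = b}"
    have C: "?C \<in> sets M" using nb_image_sets[OF pieces i] .
    show "?C \<in> sets M \<and> emeasure M ?C = emeasure M ?A"
    proof (cases "b = ?m")
      case True
      then have "nb i x = x" if "x \<in> ?A" for x
        using that c_less[OF nb_space, of x i] AM by (auto simp: l_def split: if_splits)
      then have "?C = ?A" by force
      then show ?thesis using C by simp
    next
      case False
      then have step: "nb i x \<noteq> x" "(x, nb i x) \<in> E" "c (nb i x) = b" if "x \<in> ?A" for x
      proof -
        have x: "x \<in> space M" using that AM by auto
        show "nb i x \<noteq> x" "c (nb i x) = b" using that False by (auto simp: l_def split: if_splits)
        then show "(x, nb i x) \<in> E" using nb_image[OF x] i by blast
      qed
      have "E `` {x} \<inter> ?C = {nb i x}" if x: "x \<in> ?A" for x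
      proof (intro equalityI subsetI)
        fix z assume z: "z \<in> E `` {x} \<inter> ?C"
        then have "c z = c (nb i x)" using step(3) x by auto
        then show "z \<in> {nb i x}" using near[OF step(2)[OF x], of z] z by auto
      qed (use step(2)[OF x] x in blast)
      then have "(\<integral>\<^sup>+x\<in>?A. of_nat (card (E `` {x} \<inter> ?C)) \<partial>M) = (\<integral>\<^sup>+x\<in>?A. 1 \<partial>M)"
        by (intro nn_integral_cong) (auto simp: indicator_def)
      then have 1: "(\<integral>\<^sup>+x\<in>?A. of_nat (card (E `` {x} \<inter> ?C)) \<partial>M) = emeasure M ?A"
        using pieces by simp
      have "E `` {y} \<inter> ?A = {x}" if x: "x \<in> ?A" "y = nb i x" for x y
      proof (intro equalityI subsetI)
        fix x' assume x': "x' \<in> E `` {y} \<inter> ?A"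
        then have "(x', y) \<in> E" using E(1) by (auto dest: symD)
        moreover have A': "x' \<in> ?A" using x' by blast
        ultimately have "nb i x' = nb i x"
          using near[of x' y "nb i x'"] step(2,3)[OF A'] step(3)[OF x(1)] x(2) by metis
        then show "x' \<in> {x}" using inj_onD[OF inj] x(1) A' by blast
      next
        fix x' assume "x' \<in> {x}"
        then show "x' \<in> E `` {y} \<inter> ?A" using symD[OF E(1) step(2)[OF x(1)]] x by blast
      qed
      then have "card (E `` {y} \<inter> ?A) = 1" if "y \<in> ?C" for y using that by (auto simp del: Int_iff)
      then have "(\<integral>\<^sup>+y\<in>?C. of_nat (card (E `` {y} \<inter> ?A)) \<partial>M) = (\<integral>\<^sup>+y\<in>?C. 1 \<partial>M)"
        by (intro nn_integral_cong) (simp add: indicator_def)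
      then have 2: "(\<integral>\<^sup>+y\<in>?C. of_nat (card (E `` {y} \<inter> ?A)) \<partial>M) = emeasure M ?C"
        using C by simp
      show ?thesis
        using mass[unfolded mass_conserving_def, rule_format, OF pieces[of b] C] C unfolding 1 2 by simp
    qed
  qed simp
qed

lemma walk_measure:
  assumes mass: "mass_conserving M E" and "A \<in> sets M" "set ws \<subseteq> {..D}" "inj_on (walk ws) A"
  shows "walk ws ` A \<in> sets M \<and> emeasure M (walk ws ` A) = emeasure M A"
  using assms(2-4)
proof (induction ws arbitrary: A)
  case Nil
  then show ?case by simp
next
  case (Cons i ws)
  have inj: "inj_on (walk ws \<circ> nb i) A" using Cons.prems(3) by (simp only: fold.simps)
  have eq: "walk (i # ws) ` A = walk ws ` (nb i ` A)" by (simp only: fold.simps image_comp)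
  then have "nb i ` A \<in> sets M \<and> emeasure M (nb i ` A) = emeasure M A"
    using Cons.prems(1,2) by (intro nb_measure[OF mass _ _ inj_on_imageI2[OF inj]]) auto
  then show ?case using Cons.IH[of "nb i ` A"] Cons.prems inj_on_imageI[OF inj] unfolding eq by simp
qed

lemma piecewise_walk_measure:
  assumes mass: "mass_conserving M E" and A: "A \<in> sets M" and inj: "inj_on f A"
    and f: "\<And>x. x \<in> A \<Longrightarrow> \<exists>ws\<in>walks r. f x = walk ws x"
    and meas: "\<And>ws. ws \<in> walks r \<Longrightarrow> {x \<in> A. f x = walk ws x} \<in> sets M"
  shows "f ` A \<in> sets M \<and> emeasure M (f ` A) = emeasure M A"
proof -
  obtain W where W: "set W = walks r" using finite_list[OF finite_walks] by blast
  \<comment> \<open>Choosing the first walk in a fixed list that agrees with \<open>f\<close> makes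
    the pieces disjoint.\<close>
  define l where "l x = (LEAST n. n < length W \<and> f x = walk (W ! n) x)" for x
  have l: "l x < length W \<and> f x = walk (W ! l x) x" if x: "x \<in> A" for x
  proof -
    obtain ws where ws: "ws \<in> set W" "f x = walk ws x" using f[OF x] W by blast
    obtain n where "n < length W" "W ! n = ws" using ws(1) by (metis in_set_conv_nth)
    then have "n < length W \<and> f x = walk (W ! n) x" using ws(2) by simp
    then show ?thesis unfolding l_def by (rule LeastI)
  qed
  have AM: "A \<subseteq> space M" using A by (rule sets.sets_into_space)
  show ?thesis
  proof (rule measure_image_pieces[where I="{..<length W}" and l=l, OF _ _ inj])
    show "l ` A \<subseteq> {..<length W}" using l by auto
    fix n assume n: "n \<in> {..<length W}"
    have Wn: "W ! j \<in> walks r" if "j < length W" for j using that W nth_mem by blast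
    have [measurable]: "{x \<in> A. f x = walk (W ! j) x} \<in> sets M" if "j < length W" for j using meas[OF Wn[OF that]] .
    have "{x \<in> A. l x = n} = {x \<in> A. f x = walk (W ! n) x} - (\<Union>j\<in>{..<n}. {x \<in> A. f x = walk (W ! j) x})"
    proof (intro equalityI subsetI)
      fix x assume x: "x \<in> {x \<in> A. l x = n}"
      have "f x \<noteq> walk (W ! j) x" if "j < n" for j
        using not_less_Least[of j "\<lambda>n. n < length W \<and> f x = walk (W ! n) x"] that n x unfolding l_def by auto
      then show "x \<in> {x \<in> A. f x = walk (W ! n) x} - (\<Union>j\<in>{..<n}. {x \<in> A. f x = walk (W ! j) x})"
        using l x by auto
    next
      fix x assume x: "x \<in> {x \<in> A. f x = walk (W ! n) x} - (\<Union>j\<in>{..<n}. {x \<in> A. f x = walk (W ! j) x})"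
      then have "l x = n" unfolding l_def using n by (intro Least_equality) (auto simp: not_less[symmetric])
      then show "x \<in> {x \<in> A. l x = n}" using x by auto
    qed
    also have "\<dots> \<in> sets M" using n by (intro sets.Diff sets.finite_UN) auto
    finally show piece: "{x \<in> A. l x = n} \<in> sets M" .
    have eq: "f ` {x \<in> A. l x = n} = walk (W ! n) ` {x \<in> A. l x = n}"
      using l by (intro image_cong) auto
    have "inj_on f {x \<in> A. l x = n}" using inj by (rule inj_on_subset) auto
    then have "inj_on (walk (W ! n)) {x \<in> A. l x = n}"
      using l by (subst inj_on_cong[of _ _ f]) auto
    then show "f ` {x \<in> A. l x = n} \<in> sets M \<and> emeasure M (f ` {x \<in> A. l x = n}) = emeasure M {x \<in> A. l x = n}"
      unfolding eq using Wn n by (intro walk_measure[OF mass piece]) (auto simp: walks_def)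
  qed simp
qed

text \<open>A colouring proper up to distance 2 * r leaves each vertex at most one
  \<open>K\<close>-neighbour of a given colour. The pairs of \<open>K\<close> from \<open>A\<close>
  to \<open>B\<close> with colours a and b thus form a partial injection, given piecewise by walks;
  its domain is \<open>P A B a b\<close> and its image \<open>P B A b a\<close>, so these have equal
  measure. Summing over a and b gives the claim.\<close>

lemma mass_conserving_subrelation:
  assumes mass: "mass_conserving M E" and K: "simple_graph (space M) K" "measurable_relation M K"
    and near: "\<And>x y. (x, y) \<in> K \<Longrightarrow> y \<in> ball_vertices E r x"
  shows "mass_conserving M K"
proof -
  obtain c where c [measurable]: "c \<in> M \<rightarrow>\<^sub>M count_space UNIV"
    and c_less: "\<And>x. x \<in> space M \<Longrightarrow> c x < ball_bound D (2 * r)"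
    and proper: "\<And>x y. x \<in> space M \<Longrightarrow> y \<in> ball_vertices E (2 * r) x \<Longrightarrow> y \<noteq> x \<Longrightarrow> c x \<noteq> c y"
    using proper_colouring[of "2 * r"] by metis
  define m where "m = ball_bound D (2 * r)"
  have sym: "sym K" "sym E" and KV: "K \<subseteq> space M \<times> space M" using K(1) simple by (auto simp: simple_graph_def)
  have uniq: "z = y" if "(x, y) \<in> K" "(x, z) \<in> K" "c y = c z" for x y z
  proof -
    have "y \<in> space M" using that(1) KV by auto
    moreover have "z \<in> ball_vertices E (r + r) y"
      using near[OF that(1)] near[OF that(2)] ball_vertices_sym[OF sym(2)] by (intro ball_vertices_trans[of x]) auto
    ultimately show ?thesis using proper[of y z] that(3) by (auto simp: mult_2)
  qed
  define P where "P A B a b = {x \<in> A. c x = a \<and> (\<exists>y\<in>B. (x, y) \<in> K \<and> c y = b)}" for A B a b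
  have K_walk: "Measurable.pred M (\<lambda>x. (x, walk ws x) \<in> K)" for ws
    by (rule measurable_relationD[OF K(2)]) simp_all
  note [measurable] = K_walk
  have P_eq: "P A B a b = {x \<in> A. c x = a \<and> (\<exists>ws\<in>walks r. walk ws x \<in> B \<and> (x, walk ws x) \<in> K \<and> c (walk ws x) = b)}"
    for A B a b
  proof -
    have "(\<exists>y\<in>B. (x, y) \<in> K \<and> c y = b) \<longleftrightarrow>
      (\<exists>ws\<in>walks r. walk ws x \<in> B \<and> (x, walk ws x) \<in> K \<and> c (walk ws x) = b)" if "x \<in> A" for x
    proof
      assume "\<exists>y\<in>B. (x, y) \<in> K \<and> c y = b"
      then obtain y where y: "y \<in> B" "(x, y) \<in> K" "c y = b" by blast
      then obtain ws where "ws \<in> walks r" "walk ws x = y"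
        using near[OF y(2)] in_ball_iff[of x y r] subsetD[OF KV y(2)] by auto
      then show "\<exists>ws\<in>walks r. walk ws x \<in> B \<and> (x, walk ws x) \<in> K \<and> c (walk ws x) = b" using y by blast
    qed blast
    then show ?thesis unfolding P_def by (intro Collect_cong conj_cong refl)
  qed
  have P_sets: "P A B a b \<in> sets M" if [measurable]: "A \<in> sets M" "B \<in> sets M" for A B a b
    unfolding P_eq by measurable
  have P_measure: "emeasure M (P A B a b) = emeasure M (P B A b a)" if AB [measurable]: "A \<in> sets M" "B \<in> sets M" for A B a b
  proof -
    define f where "f x = (THE y. y \<in> B \<and> (x, y) \<in> K \<and> c y = b)" for x
    have f: "f x = y" if "y \<in> B" "(x, y) \<in> K" "c y = b" for x y
      unfolding f_def using that uniq by (intro the_equality) auto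
    have im: "f ` P A B a b = P B A b a"
    proof (intro equalityI subsetI)
      fix y assume "y \<in> f ` P A B a b"
      then obtain x z where "x \<in> A" "c x = a" "z \<in> B" "(x, z) \<in> K" "c z = b" "y = f x" by (auto simp: P_def)
      then show "y \<in> P B A b a" using f[of z x] sym(1) by (auto simp: P_def dest: symD)
    next
      fix y assume "y \<in> P B A b a"
      then obtain x where x: "y \<in> B" "c y = b" "x \<in> A" "(x, y) \<in> K" "c x = a"
        using sym(1) by (auto simp: P_def dest: symD)
      then have "x \<in> P A B a b" "f x = y" using f by (auto simp: P_def)
      then show "y \<in> f ` P A B a b" by blast
    qed
    have injf: "inj_on f (P A B a b)"
    proof (rule inj_onI)
      fix x x' assume x: "x \<in> P A B a b" "x' \<in> P A B a b" "f x = f x'"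
      then obtain y y' where "y \<in> B" "(x, y) \<in> K" "c y = b" "y' \<in> B" "(x', y') \<in> K" "c y' = b"
        unfolding P_def by blast
      moreover from this have "y = y'" using f[of y x] f[of y' x'] x(3) by simp
      ultimately have "(x, y) \<in> K" "(x', y) \<in> K" "c x = c x'" using x by (simp_all add: P_def)
      then show "x = x'" using uniq[of y x' x] sym(1) by (auto dest: symD)
    qed
    have wf: "\<exists>ws\<in>walks r. f x = walk ws x" if "x \<in> P A B a b" for x
      using that f unfolding P_eq by blast
    have "{x \<in> P A B a b. f x = walk ws x} \<in> sets M" for ws
    proof -
      have "{x \<in> P A B a b. f x = walk ws x} =
        {x \<in> P A B a b. walk ws x \<in> B \<and> (x, walk ws x) \<in> K \<and> c (walk ws x) = b}"
        using f by (auto simp: P_def)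
      also have "\<dots> \<in> sets M" using P_sets[OF AB, measurable] by measurable
      finally show ?thesis .
    qed
    then show ?thesis using piecewise_walk_measure[OF mass P_sets[OF AB] injf wf] unfolding im by simp
  qed
  have count: "(\<integral>\<^sup>+x\<in>A. of_nat (card (K `` {x} \<inter> B)) \<partial>M) = (\<Sum>a<m. \<Sum>b<m. emeasure M (P A B a b))"
    if AB: "A \<in> sets M" "B \<in> sets M" for A B
  proof -
    \<comment> \<open>For x in \<open>A\<close> only a = \<open>c x\<close> contributes, and each b
      occurring among the neighbours in \<open>B\<close> contributes 1, as \<open>c\<close> is
      injective on the neighbours of x.\<close>
    have "of_nat (card (K `` {x} \<inter> B)) * indicator A x = (\<Sum>a<m. \<Sum>b<m. indicator (P A B a b) x :: ennreal)"
      if x: "x \<in> space M" for x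
    proof (cases "x \<in> A")
      case True
      let ?S = "K `` {x} \<inter> B"
      have fin: "finite ?S" using finite_neighbours(1)[OF near x] by (rule finite_Int[OF disjI1])
      have ind: "indicator (P A B a b) x = (if a = c x then (if b \<in> c ` ?S then 1 else 0) else 0 :: ennreal)" for a b
        using True by (auto simp: P_def indicator_def)
      have "(\<Sum>a<m. \<Sum>b<m. indicator (P A B a b) x :: ennreal) =
        (\<Sum>a<m. if a = c x then \<Sum>b<m. (if b \<in> c ` ?S then 1 else 0) else 0)"
        unfolding ind by (intro sum.cong refl) simp
      also have "\<dots> = (\<Sum>b<m. (if b \<in> c ` ?S then 1 else 0))"
        using c_less[OF x] by (simp add: m_def)
      also have "\<dots> = of_nat (card ({..<m} \<inter> c ` ?S))"
        by (simp add: sum.If_cases)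
      also have "{..<m} \<inter> c ` ?S = c ` ?S" using c_less KV by (auto simp: m_def)
      also have "card (c ` ?S) = card ?S"
      proof (rule card_image, rule inj_onI)
        fix y z assume "y \<in> ?S" "z \<in> ?S" "c y = c z"
        then show "y = z" using uniq[of x z y] by simp
      qed
      finally show ?thesis using True by simp
    qed (simp add: P_def)
    then have "(\<integral>\<^sup>+x\<in>A. of_nat (card (K `` {x} \<inter> B)) \<partial>M) = (\<integral>\<^sup>+x. (\<Sum>a<m. \<Sum>b<m. indicator (P A B a b) x) \<partial>M)"
      by (intro nn_integral_cong) auto
    also have "\<dots> = (\<Sum>a<m. \<Sum>b<m. emeasure M (P A B a b))"
      using P_sets[OF AB] by (simp add: nn_integral_sum)
    finally show ?thesis .
  qed
  show ?thesis
    unfolding mass_conserving_def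
  proof (intro ballI)
    fix A B assume AB: "A \<in> sets M" "B \<in> sets M"
    have "(\<Sum>a<m. \<Sum>b<m. emeasure M (P A B a b)) = (\<Sum>a<m. \<Sum>b<m. emeasure M (P B A b a))"
      using P_measure[OF AB] by simp
    also have "\<dots> = (\<Sum>a<m. \<Sum>b<m. emeasure M (P B A a b))" by (rule sum.swap)
    finally show "(\<integral>\<^sup>+x\<in>A. of_nat (card (K `` {x} \<inter> B)) \<partial>M) = (\<integral>\<^sup>+x\<in>B. of_nat (card (K `` {x} \<inter> A)) \<partial>M)"
      unfolding count[OF AB] count[OF AB(2,1)] .
  qed
qed

end

section \<open>Graphings and finite graphs as enumerated graphs\<close>

lemma graphing_enumerated:
  fixes M :: "'a::polish_space measure"
  assumes "graphing D M E"
  obtains nb B where "enumerated_graph M D E nb B"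
proof -
  have M: "prob_space M" "sets M = sets borel" and simple: "simple_graph UNIV E" and E: "E \<in> sets borel"
    and deg: "degree_bounded D UNIV E"
    using assms by (auto simp: graphing_def)
  have space: "space M = UNIV" using sets_eq_imp_space_eq[OF M(2)] by simp
  obtain f :: "nat \<Rightarrow> 'a \<Rightarrow> 'a" where f: "\<And>i. f i \<in> borel_measurable borel" "\<And>x. E `` {x} \<subseteq> (\<lambda>i. f i x) ` {..<D}"
    using bounded_sections_enumeration[OF E, of D] deg by (auto simp: degree_bounded_def)
  \<comment> \<open>The covering functions may leave the section of x, in which case they are reset
    to the identity; index D is always the identity, so x itself is listed.\<close>
  define nb where "nb i x = (if i < D \<and> (x, f i x) \<in> E then f i x else x)" for i x
  obtain \<B>' :: "'a set set" where \<B>': "countable \<B>'" "topological_basis \<B>'"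
    using ex_countable_basis by blast
  define B where "B = from_nat_into (insert UNIV \<B>')"
  have range: "range B = insert UNIV \<B>'" unfolding B_def using \<B>'(1) by (intro range_from_nat_into) auto
  have "enumerated_graph_axioms M D E nb B"
  proof
    show "simple_graph (space M) E" "degree_bounded D (space M) E" using simple deg space by simp_all
    show "nb i \<in> M \<rightarrow>\<^sub>M M" for i
    proof -
      note [measurable] = f(1) E
      have "(\<lambda>x. (x, f i x)) \<in> borel \<rightarrow>\<^sub>M borel" by measurable
      then have [measurable]: "Measurable.pred borel (\<lambda>x. (x, f i x) \<in> E)" using E by measurable
      have "nb i \<in> borel \<rightarrow>\<^sub>M borel" unfolding nb_def by measurable
      then show ?thesis using measurable_cong_sets[OF M(2) M(2)] by blast
    qed
    show "(\<lambda>i. nb i x) ` {..D} = insert x (E `` {x})" if "x \<in> space M" for x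
    proof (intro equalityI subsetI)
      fix y assume "y \<in> insert x (E `` {x})"
      then consider "y = x" | "(x, y) \<in> E" by blast
      then show "y \<in> (\<lambda>i. nb i x) ` {..D}"
      proof cases
        case 1
        then have "y = nb D x" by (simp add: nb_def)
        then show ?thesis by blast
      next
        case 2
        then obtain i where "i < D" "y = f i x" using f(2)[of x] by blast
        then show ?thesis using 2 by (intro image_eqI[of _ _ i]) (auto simp: nb_def)
      qed
    qed (auto simp: nb_def)
    show "B n \<in> sets M" for n
    proof -
      have "open (B n)"
        using range \<B>'(2) topological_basis_open[of \<B>'] by (metis insert_iff open_UNIV rangeI)
      then show ?thesis using M(2) by simp
    qed
    show "\<exists>n. x \<in> B n \<and> F \<inter> B n = {}" if F: "finite F" "x \<notin> F" for x F
    proof -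
      have "open (- F)" using F(1) by (simp add: finite_imp_closed open_Compl)
      then obtain W where W: "W \<in> \<B>'" "x \<in> W" "W \<subseteq> - F" using topological_basisE[OF \<B>'(2), of "- F" x] F(2) by auto
      then obtain n where "B n = W" using range by (metis insertCI rangeE)
      then show ?thesis using W by blast
    qed
  qed
  then have "enumerated_graph M D E nb B" using M(1) by (simp add: enumerated_graph_def)
  then show thesis by (rule that)
qed

lemma measurable_relation_borel:
  fixes M :: "'a::polish_space measure"
  assumes "sets M = sets borel" and H [measurable]: "H \<in> sets borel"
  shows "measurable_relation M H"
  unfolding measurable_relation_def
proof (intro ballI)
  fix f g assume "f \<in> M \<rightarrow>\<^sub>M M" "g \<in> M \<rightarrow>\<^sub>M M"
  then have [measurable]: "f \<in> borel_measurable M" "g \<in> borel_measurable M"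
    using measurable_cong_sets[OF refl assms(1), of M] by auto
  show "Measurable.pred M (\<lambda>x. (f x, g x) \<in> H)" by measurable
qed

lemma graphing_subrelation:
  fixes M :: "'a::polish_space measure"
  assumes G: "graphing D M E" and K: "simple_graph UNIV K" "measurable_relation M K"
    and near: "\<And>x y. (x, y) \<in> K \<Longrightarrow> y \<in> ball_vertices E r x"
  shows "graphing (ball_bound D r) M K"
proof -
  obtain nb B where "enumerated_graph M D E nb B" using graphing_enumerated[OF G] .
  then interpret enumerated_graph M D E nb B .
  have sets: "sets M = sets borel" using G by (simp add: graphing_def)
  have space: "space M = UNIV" using sets_eq_imp_space_eq[OF sets] by simp
  have "mass_conserving M E" using G by (simp add: graphing_def mass_conserving_def)
  then have mass: "mass_conserving M K"
    using mass_conserving_subrelation[OF _ _ K(2) near] K(1) space by simp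
  have "K \<in> sets (borel \<Otimes>\<^sub>M borel)"
  proof -
    let ?N = "borel \<Otimes>\<^sub>M borel :: ('a \<times> 'a) measure"
    have [measurable]: "fst \<in> ?N \<rightarrow>\<^sub>M M" "snd \<in> ?N \<rightarrow>\<^sub>M M"
      using measurable_cong_sets[OF refl sets, of ?N] by auto
    have [measurable]: "Measurable.pred M (\<lambda>x. (x, walk ws x) \<in> K)" for ws
      by (rule measurable_relationD[OF K(2)]) simp_all
    have [measurable]: "Measurable.pred ?N (\<lambda>p. (fst p, walk ws (fst p)) \<in> K)" for ws
      by measurable
    have [measurable]: "Measurable.pred ?N (\<lambda>p. walk ws (fst p) = snd p)" for ws
      by measurable
    have "Measurable.pred ?N (\<lambda>p. \<exists>ws\<in>walks r. walk ws (fst p) = snd p \<and> (fst p, walk ws (fst p)) \<in> K)"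
      by measurable
    \<comment> \<open>By bounded range the second coordinate is the end of a walk from the first,
      and membership in \<open>K\<close> is then tested by a condition on the first coordinate
      alone.\<close>
    moreover have "K = {p \<in> space ?N. \<exists>ws\<in>walks r. walk ws (fst p) = snd p \<and> (fst p, walk ws (fst p)) \<in> K}"
    proof (intro equalityI subsetI)
      fix p assume p: "p \<in> K"
      then obtain x y where xy: "p = (x, y)" "(x, y) \<in> K" by (cases p) auto
      then obtain ws where "ws \<in> walks r" "walk ws x = y" using near in_ball_iff space by blast
      then show "p \<in> {p \<in> space ?N. \<exists>ws\<in>walks r. walk ws (fst p) = snd p \<and> (fst p, walk ws (fst p)) \<in> K}"
        using xy by (auto simp: space_pair_measure)
    qed auto
    ultimately show ?thesis by (simp add: pred_def)
  qed
  then have "K \<in> sets borel" by (metis borel_prod)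
  moreover have "degree_bounded (ball_bound D r) UNIV K"
    using finite_neighbours[OF near] space by (simp add: degree_bounded_def)
  ultimately show ?thesis
    using mass K(1) sets prob_space_axioms unfolding graphing_def mass_conserving_def by blast
qed

section \<open>Finite graphs with the uniform measure\<close>

lemma finite_graph_enumerated:
  assumes V: "finite V" "V \<noteq> {}" and G: "simple_graph V G" "degree_bounded D V G"
  obtains nb B where "enumerated_graph (uniform_count_measure V) D G nb B"
proof -
  let ?M = "uniform_count_measure V"
  have "\<exists>f::nat \<Rightarrow> 'a. f ` {..D} = insert x (G `` {x})" if x: "x \<in> V" for x
  proof -
    let ?S = "insert x (G `` {x})"
    have fin: "finite ?S" and card: "card ?S \<le> Suc D"
      using G(2) x by (auto simp: degree_bounded_def card_insert_if)
    obtain h where h: "bij_betw h {0..<card ?S} ?S" using ex_bij_betw_nat_finite[OF fin] by blast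
    have "0 < card ?S" using fin by (simp add: card_gt_0_iff)
    \<comment> \<open>An enumeration with fewer than D + 1 entries is padded with its first
      entry.\<close>
    then have "(\<lambda>i. if i < card ?S then h i else h 0) ` {..D} = h ` {0..<card ?S}"
      using card by (auto simp: image_iff)
    then have "(\<lambda>i. if i < card ?S then h i else h 0) ` {..D} = ?S"
      by (rule trans[OF _ bij_betw_imp_surj_on[OF h]])
    then show ?thesis by (rule exI[of _ "\<lambda>i. if i < card ?S then h i else h 0"])
  qed
  then obtain nb where nb: "\<And>x. x \<in> V \<Longrightarrow> nb x ` {..D} = insert x (G `` {x})" by metis
  define nb' where "nb' i x = (if i \<le> D then nb x i else x)" for i x
  have "enumerated_graph_axioms ?M D G nb' (\<lambda>n. {from_nat_into V n})"
  proof
    show "nb' i \<in> ?M \<rightarrow>\<^sub>M ?M" for i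
    proof -
      have "nb' i x \<in> V" if x: "x \<in> V" for x
      proof (cases "i \<le> D")
        case True
        then have "nb x i \<in> insert x (G `` {x})" using nb[OF x] by blast
        then show ?thesis using True G(1) x by (auto simp: nb'_def simple_graph_def)
      qed (simp add: nb'_def x)
      then show ?thesis
        by (auto simp: measurable_def space_uniform_count_measure sets_uniform_count_measure)
    qed
    show "(\<lambda>i. nb' i x) ` {..D} = insert x (G `` {x})" if "x \<in> space ?M" for x
      using nb[of x] that by (simp add: nb'_def space_uniform_count_measure cong: image_cong_simp)
    show "{from_nat_into V n} \<in> sets ?M" for n
      using from_nat_into[OF V(2)] by (simp add: sets_uniform_count_measure)
    show "\<exists>n. x \<in> {from_nat_into V n} \<and> F \<inter> {from_nat_into V n} = {}"
      if "x \<in> space ?M" "finite F" "x \<notin> F" for x F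
      using from_nat_into_surj[OF countable_finite[OF V(1)], of x] that by (auto simp: space_uniform_count_measure)
  qed (use G in \<open>simp_all add: space_uniform_count_measure\<close>)
  then have "enumerated_graph ?M D G nb' (\<lambda>n. {from_nat_into V n})"
    using prob_space_uniform_count_measure[OF V] by (simp add: enumerated_graph_def)
  then show thesis by (rule that)
qed

lemma measurable_relation_uniform_count: "measurable_relation (uniform_count_measure V) R"
  by (simp add: measurable_relation_def pred_def sets_uniform_count_measure space_uniform_count_measure)

text \<open>Without loops every undirected edge is the image of exactly two ordered pairs, whence
  the factor 1/2.\<close>

lemma edge_density_eq_integral:
  assumes "finite V" "simple_graph V H"
  shows "edge_density V H = 1/2 * (\<integral>x. real (card (H `` {x})) \<partial>uniform_count_measure V)"
proof -
  have H: "H \<subseteq> V \<times> V" "sym H" "irrefl H" using assms(2) by (auto simp: simple_graph_def)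
  have fin: "finite H" using finite_subset[OF H(1)] assms(1) by simp
  let ?f = "\<lambda>(x, y). {x, y}"
  have "card {p \<in> H. ?f p = e} = 2" if e: "e \<in> ?f ` H" for e
  proof -
    obtain x y where xy: "(x, y) \<in> H" "e = {x, y}" using e by auto
    then have "{p \<in> H. ?f p = e} = {(x, y), (y, x)}" "x \<noteq> y"
      using H by (auto simp: doubleton_eq_iff irrefl_def dest: symD)
    then show ?thesis by simp
  qed
  then have "(\<Sum>e\<in>?f ` H. card {p \<in> H. ?f p = e}) = 2 * card (undirected_edges H)"
    by (simp add: undirected_edges_def)
  then have card: "card H = 2 * card (undirected_edges H)"
    using sum.image_gen[OF fin, of "\<lambda>_. 1::nat" ?f] by simp
  have "H = (SIGMA x:V. H `` {x})" using H(1) by auto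
  then have "card H = (\<Sum>x\<in>V. card (H `` {x}))"
    using card_SigmaI[OF assms(1), of "\<lambda>x. H `` {x}"] fin by (metis finite_Image)
  then have "(\<Sum>x\<in>V. real (card (H `` {x}))) = 2 * real (card (undirected_edges H))"
    using card by (metis of_nat_mult of_nat_numeral of_nat_sum)
  then show ?thesis using assms(1) by (simp add: edge_density_def integral_uniform_count_measure)
qed

section \<open>Approximation by bi-Lipschitz equivalent graphings\<close>

text \<open>Edges of \<open>H\<close> between vertices far apart in \<open>E\<close> are dropped, and edges of \<open>E\<close> are added where
  the remaining graph does not connect their end points by a short path. By dominated
  convergence few edges are added if the bound on the distances is large.\<close>

lemma bilipschitz_approximation:
  fixes M :: "'a::polish_space measure"
  assumes E: "graphing D M E" and H: "graphing D' M H" and comp: "AE x in M. component E x = component H x"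
    and \<epsilon>: "0 < \<epsilon>"
  obtains L K where "0 < L" "simple_graph UNIV K" "measurable_relation M K" "bilipschitz L E K"
    "(\<integral>x. real (card (K `` {x})) \<partial>M) \<le> (\<integral>x. real (card (H `` {x})) \<partial>M) + \<epsilon>"
proof -
  obtain nb B where "enumerated_graph M D E nb B" using graphing_enumerated[OF E] .
  then interpret E: enumerated_graph M D E nb B .
  obtain nb' B' where "enumerated_graph M D' H nb' B'" using graphing_enumerated[OF H] .
  then interpret H: enumerated_graph M D' H nb' B' .
  have sets: "sets M = sets borel" using E by (simp add: graphing_def)
  have space: "space M = UNIV" using sets_eq_imp_space_eq[OF sets] by simp
  have simple: "simple_graph UNIV E" "simple_graph UNIV H" and sym: "sym E" "sym H"
    using E H by (auto simp: graphing_def simple_graph_def)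
  define near where "near L = {(x, y) \<in> H. y \<in> ball_vertices E L x}" for L
  define far where "far L = {(x, y) \<in> E. y \<notin> ball_vertices (near L) L x}" for L
  have near_E: "y \<in> ball_vertices E L x" if "(x, y) \<in> near L" for x y L using that by (simp add: near_def)
  have far_E: "y \<in> ball_vertices E 1 x" if "(x, y) \<in> far L" for x y L
    using that by (simp add: far_def ball_vertices_edge)
  have E1: "y \<in> ball_vertices E 1 x" if "(x, y) \<in> E" for x y using that by (simp add: ball_vertices_edge)
  have near_simple: "simple_graph UNIV (near L)" for L
    using simple(2) ball_vertices_sym[OF sym(1)] by (auto simp: near_def simple_graph_def sym_def irrefl_def)
  have H_rel: "measurable_relation M H" using measurable_relation_borel[OF sets] H by (simp add: graphing_def)
  have near_rel: "measurable_relation M (near L)" for L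
    unfolding measurable_relation_def
  proof (intro ballI)
    fix f g assume fg: "f \<in> M \<rightarrow>\<^sub>M M" "g \<in> M \<rightarrow>\<^sub>M M"
    note [measurable] = measurable_relationD[OF H_rel fg]
      measurable_relationD[OF E.measurable_relation_ball[OF E.measurable_relation_edges E1, of L] fg, simplified]
    have "Measurable.pred M (\<lambda>x. (f x, g x) \<in> H \<and> g x \<in> ball_vertices E L (f x))" by measurable
    then show "Measurable.pred M (\<lambda>x. (f x, g x) \<in> near L)" by (simp add: near_def)
  qed
  have far_rel: "measurable_relation M (far L)" for L
    unfolding measurable_relation_def
  proof (intro ballI)
    fix f g assume fg: "f \<in> M \<rightarrow>\<^sub>M M" "g \<in> M \<rightarrow>\<^sub>M M"
    note [measurable] = measurable_relationD[OF E.measurable_relation_edges fg]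
      measurable_relationD[OF E.measurable_relation_ball[OF near_rel near_E, of L L] fg, simplified]
    have "Measurable.pred M (\<lambda>x. (f x, g x) \<in> E \<and> g x \<notin> ball_vertices (near L) L (f x))" by measurable
    then show "Measurable.pred M (\<lambda>x. (f x, g x) \<in> far L)" by (simp add: far_def)
  qed
  have far_sub: "far L `` {x} \<subseteq> E `` {x}" for L x by (auto simp: far_def)
  have fin: "finite (E `` {x})" "card (E `` {x}) \<le> D" "finite (H `` {x})" "card (H `` {x}) \<le> D'" for x
    using E.degree H.degree by (auto simp: space degree_bounded_def)
  have far_card: "card (far L `` {x}) \<le> D" for L x
    using card_mono[OF fin(1) far_sub] fin(2) order_trans by blast
  have far_meas [measurable]: "(\<lambda>x. card (far L `` {x})) \<in> M \<rightarrow>\<^sub>M count_space UNIV" for L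
    using E.card_neighbours_measurable[OF far_rel far_E] .
  have H_meas [measurable]: "(\<lambda>x. card (H `` {x})) \<in> M \<rightarrow>\<^sub>M count_space UNIV"
    by (rule H.card_neighbours_measurable[OF H.measurable_relation_edges, of 1]) (simp add: ball_vertices_edge)
  have "AE x in M. (\<lambda>L. real (card (far L `` {x}))) \<longlonglongrightarrow> 0"
    using comp
  proof eventually_elim
    case (elim x)
    \<comment> \<open>On a path of \<open>H\<close> inside a common component every edge has finite
      length in \<open>E\<close>, so the whole path lies in \<open>near L\<close> once L exceeds
      these lengths.\<close>
    have reach: "\<exists>L0. \<forall>L\<ge>L0. (x, z) \<in> near L ^^ n" if "(x, z) \<in> H ^^ n" for n z
      using that
    proof (induction n arbitrary: z)
      case 0
      then show ?case by simp
    next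
      case (Suc n)
      then obtain w where w: "(x, w) \<in> H ^^ n" "(w, z) \<in> H" by auto
      obtain L0 where L0: "\<And>L. L \<ge> L0 \<Longrightarrow> (x, w) \<in> near L ^^ n" using Suc.IH[OF w(1)] by blast
      have "(x, w) \<in> H\<^sup>*" "(x, z) \<in> H\<^sup>*" using w by (auto dest: relpow_imp_rtrancl)
      then have "(x, w) \<in> E\<^sup>*" "(x, z) \<in> E\<^sup>*" using elim unfolding component_eq by blast+
      then have "(w, z) \<in> E\<^sup>*" using sym_rtrancl[OF sym(1)] by (meson rtrancl_trans symD)
      then obtain k where "(w, z) \<in> E ^^ k" using rtrancl_imp_relpow by blast
      then have "(w, z) \<in> near L" if "L \<ge> k" for L
        using w(2) that unfolding near_def mem_ball_vertices by blast
      then have "(x, z) \<in> near L ^^ Suc n" if "L \<ge> max L0 k" for L using L0[of L] that by auto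
      then show ?case by blast
    qed
    have "eventually (\<lambda>L. y \<notin> far L `` {x}) sequentially" if "y \<in> E `` {x}" for y
    proof -
      have "(x, y) \<in> E\<^sup>*" using that by auto
      then have "(x, y) \<in> H\<^sup>*" using elim unfolding component_eq by blast
      then obtain n where "(x, y) \<in> H ^^ n" using rtrancl_imp_relpow by blast
      then obtain L0 where "\<And>L. L \<ge> L0 \<Longrightarrow> (x, y) \<in> near L ^^ n" using reach by blast
      then have "y \<in> ball_vertices (near L) L x" if "L \<ge> max L0 n" for L
        using that unfolding mem_ball_vertices by auto
      then show ?thesis
        unfolding eventually_sequentially far_def by (intro exI[of _ "max L0 n"]) auto
    qed
    then have "eventually (\<lambda>L. \<forall>y\<in>E `` {x}. y \<notin> far L `` {x}) sequentially"
      by (intro eventually_ball_finite fin) auto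
    then have "eventually (\<lambda>L. real (card (far L `` {x})) = 0) sequentially"
    proof eventually_elim
      case (elim L)
      then have "far L `` {x} = {}" using far_sub by blast
      then show ?case by simp
    qed
    then show ?case by (rule tendsto_eventually)
  qed
  then have "(\<lambda>L. \<integral>x. real (card (far L `` {x})) \<partial>M) \<longlonglongrightarrow> (\<integral>x. 0 \<partial>M)"
    by (intro integral_dominated_convergence[where w="\<lambda>_. real D"]) (use far_card in auto)
  then have "eventually (\<lambda>L. (\<integral>x. real (card (far L `` {x})) \<partial>M) < \<epsilon>) sequentially"
    using \<epsilon> by (intro order_tendstoD) auto
  then have "eventually (\<lambda>L. (\<integral>x. real (card (far L `` {x})) \<partial>M) < \<epsilon> \<and> 0 < L) sequentially"
    using eventually_gt_at_top[of 0] by (rule eventually_conj)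
  then obtain L where L: "(\<integral>x. real (card (far L `` {x})) \<partial>M) < \<epsilon>" "0 < L"
    using eventually_happens'[OF sequentially_bot] by blast
  define K where "K = repaired L E (near L)"
  have K: "K = near L \<union> far L" by (auto simp: K_def repaired_def far_def)
  have card_K: "card (K `` {x}) \<le> card (H `` {x}) + card (far L `` {x})" for x
  proof -
    have "K `` {x} \<subseteq> H `` {x} \<union> far L `` {x}" by (auto simp: K near_def)
    then have "card (K `` {x}) \<le> card (H `` {x} \<union> far L `` {x})"
      using fin(3)[of x] finite_subset[OF far_sub fin(1)] by (intro card_mono) auto
    then show ?thesis using card_Un_le order_trans by blast
  qed
  have K_bl: "bilipschitz L E K" unfolding K_def using L(2) near_E by (rule bilipschitz_repaired)
  have K_rel: "measurable_relation M K"
    unfolding K_def by (rule E.measurable_relation_repaired[OF near_rel near_E])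
  have [measurable]: "(\<lambda>x. card (K `` {x})) \<in> M \<rightarrow>\<^sub>M count_space UNIV"
    using K_bl by (intro E.card_neighbours_measurable[OF K_rel, of L]) (simp add: bilipschitz_def)
  have int: "integrable M (\<lambda>x. real (card (H `` {x})))" "integrable M (\<lambda>x. real (card (far L `` {x})))"
    by (rule E.integrable_const_bound[where B="real D'"] E.integrable_const_bound[where B="real D"];
      use fin(4) far_card in simp)+
  have "integrable M (\<lambda>x. real (card (K `` {x})))"
  proof (rule E.integrable_const_bound[where B="real (D' + D)"])
    have "card (K `` {x}) \<le> D' + D" for x using card_K[of x] fin(4)[of x] far_card[of L x] by linarith
    then show "AE x in M. norm (real (card (K `` {x}))) \<le> real (D' + D)" by (simp del: of_nat_add)
  qed measurable
  then have "(\<integral>x. real (card (K `` {x})) \<partial>M) \<le> (\<integral>x. real (card (H `` {x})) + real (card (far L `` {x})) \<partial>M)"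
    using int card_K by (intro integral_mono Bochner_Integration.integrable_add) (simp_all flip: of_nat_add)
  also have "\<dots> = (\<integral>x. real (card (H `` {x})) \<partial>M) + (\<integral>x. real (card (far L `` {x})) \<partial>M)"
    using int by (rule Bochner_Integration.integral_add)
  also have "\<dots> \<le> (\<integral>x. real (card (H `` {x})) \<partial>M) + \<epsilon>" using L(1) by simp
  finally have "(\<integral>x. real (card (K `` {x})) \<partial>M) \<le> (\<integral>x. real (card (H `` {x})) \<partial>M) + \<epsilon>" .
  moreover have "simple_graph UNIV K" unfolding K_def by (rule simple_graph_repaired[OF simple(1) near_simple])
  ultimately show thesis using that L(2) K_rel K_bl by blast
qed

section \<open>Cost and combinatorial cost\<close>

lemma cost_le:
  assumes "graphing D M H" "AE x in M. component E x = component H x"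
  shows "cost M E \<le> 1/2 * (\<integral>x. real (card (H `` {x})) \<partial>M)"
proof -
  have "Inf {\<integral>x. real (card (H `` {x})) \<partial>M | H D. graphing D M H \<and> (AE x in M. component E x = component H x)}
    \<le> (\<integral>x. real (card (H `` {x})) \<partial>M)"
    using assms by (intro cInf_lower) (auto intro!: bdd_belowI[of _ 0])
  then show ?thesis by (simp add: cost_def)
qed

lemma cost_approx:
  assumes "graphing D M E" "0 < \<epsilon>"
  obtains D' H where "graphing D' M H" "AE x in M. component E x = component H x"
    "1/2 * (\<integral>x. real (card (H `` {x})) \<partial>M) < cost M E + \<epsilon>"
proof -
  let ?S = "{\<integral>x. real (card (H `` {x})) \<partial>M | H D. graphing D M H \<and> (AE x in M. component E x = component H x)}"
  have ne: "?S \<noteq> {}" using assms(1) by auto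
  have less: "Inf ?S < 2 * (cost M E + \<epsilon>)" using assms(2) by (simp add: cost_def)
  obtain s where s: "s \<in> ?S" "s < 2 * (cost M E + \<epsilon>)" by (rule bexE[OF cInf_lessD[OF ne less]])
  from s(1) show thesis
  proof (elim CollectE exE conjE)
    fix H D' assume "s = (\<integral>x. real (card (H `` {x})) \<partial>M)" "graphing D' M H" "AE x in M. component E x = component H x"
    then show thesis using s(2) by (intro that[of D' H]) simp_all
  qed
qed

theorem theorem1:
  fixes D :: nat
    and V :: "nat \<Rightarrow> 'v set" and G :: "nat \<Rightarrow> ('v \<times> 'v) set"
    and M :: "'a::polish_space measure" and E :: "('a \<times> 'a) set"
  assumes "\<And>n. finite (V n)" and "\<And>n. V n \<noteq> {}"
    and "\<And>n. simple_graph (V n) (G n)"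
    and "\<And>n. degree_bounded D (V n) (G n)"
    and "filterlim (\<lambda>n. card (V n)) at_top sequentially"
    and "local_global_convergent D V G"
    and "graphing D M E"
    and "local_global_limit D V G M E"
  shows "ereal (cost M E) = combinatorial_cost V G \<and>
    (\<forall>\<epsilon>::real. \<epsilon> > 0 \<longrightarrow>
      (\<exists>H l. rewiring V G H \<and> (\<lambda>n. edge_density (V n) (H n)) \<longlonglongrightarrow> l \<and>
        ereal l \<le> combinatorial_cost V G + ereal \<epsilon>))"
proof -
  note fin = assms(1) and ne = assms(2) and simple = assms(3) and degree = assms(4) and graphing = assms(7)
  define U where "U n = uniform_count_measure (V n)" for n
  have space_U: "space (U n) = V n" for n by (simp add: U_def space_uniform_count_measure)
  have "\<exists>nb B. enumerated_graph (U n) D (G n) nb B" for n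
    using finite_graph_enumerated[OF fin ne simple degree, of n] unfolding U_def by blast
  then obtain nb B where G_enum: "\<And>n. enumerated_graph (U n) D (G n) (nb n) (B n)" by metis
  obtain nb' B' where E_enum: "enumerated_graph M D E nb' B'" using graphing_enumerated[OF graphing] .
  have sets: "sets M = sets borel" using graphing by (simp add: graphing_def)
  have space: "space M = UNIV" using sets_eq_imp_space_eq[OF sets] by simp
  have Q: "(\<lambda>n. Q_dist D L (U n) (G n) M E) \<longlonglongrightarrow> 0" for L
    using assms(8) colour_count_pos[of D L] unfolding local_global_limit_def Q_dist_def U_def by blast
  have density: "edge_density (V n) H = 1/2 * (\<integral>x. real (card (H `` {x})) \<partial>U n)"
    if "simple_graph (V n) H" for n H
    using edge_density_eq_integral[OF fin that] by (simp add: U_def)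

  have lower: "ereal (cost M E) \<le> combinatorial_cost V G"
    unfolding combinatorial_cost_def
  proof (rule Inf_greatest)
    fix c assume "c \<in> {liminf (\<lambda>n. ereal (edge_density (V n) (H n))) |H. rewiring V G H}"
    then obtain H where H: "rewiring V G H" and c: "c = liminf (\<lambda>n. ereal (edge_density (V n) (H n)))" by blast
    obtain L where L: "0 < L" "\<And>n. bilipschitz L (G n) (H n)" and H_simple: "\<And>n. simple_graph (V n) (H n)"
      using H unfolding rewiring_iff_bilipschitz[OF simple] by blast
    show "ereal (cost M E) \<le> c"
    proof (rule ccontr)
      assume "\<not> ?thesis"
      then have "c < ereal (cost M E)" by simp
      then obtain s where s: "c < ereal s" "s < cost M E"
        using ereal_dense2[of c "ereal (cost M E)"] by auto
      \<comment> \<open>A liminf below s leaves infinitely many n with density below s, so one of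
        them also has small \<open>Q_dist\<close>; that single finite graph yields a graphing that
        is too cheap.\<close>
      have "\<not> eventually (\<lambda>n. ereal s \<le> ereal (edge_density (V n) (H n))) sequentially"
        using Liminf_bounded[of "ereal s" "\<lambda>n. ereal (edge_density (V n) (H n))" sequentially] s(1) unfolding c by auto
      then have "frequently (\<lambda>n. edge_density (V n) (H n) < s) sequentially"
        by (simp add: frequently_def not_less)
      moreover define K where "K = real (ball_bound D L)"
      have K: "0 < K" by (simp add: K_def ball_bound_pos)
      \<comment> \<open>Chosen so that the transfer error \<open>K * \<delta>\<close> in the mean
        degree is 2 * (cost - s), which is cost - s in the density.\<close>
      define \<delta> where "\<delta> = 2 * (cost M E - s) / K"
      have "0 < \<delta>" using s(2) K by (simp add: \<delta>_def)
      then have "eventually (\<lambda>n. Q_dist D L (U n) (G n) M E < \<delta>) sequentially"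
        using Q[of L] by (intro order_tendstoD)
      ultimately have "frequently (\<lambda>n. edge_density (V n) (H n) < s \<and> Q_dist D L (U n) (G n) M E < \<delta>) sequentially"
        by (rule frequently_eventually_frequently)
      then obtain n where n: "edge_density (V n) (H n) < s" "Q_dist D L (U n) (G n) M E < \<delta>"
        using frequently_ex by blast
      have "simple_graph (space (U n)) (H n)" using H_simple space_U by simp
      moreover have "measurable_relation (U n) (H n)" unfolding U_def by (rule measurable_relation_uniform_count)
      ultimately obtain H' where H': "simple_graph (space M) H'" "measurable_relation M H'" "bilipschitz L E H'"
        "\<bar>(\<integral>x. real (card (H' `` {x})) \<partial>M) - (\<integral>x. real (card (H n `` {x})) \<partial>U n)\<bar> \<le> K * \<delta>"
        unfolding K_def using transfer_bilipschitz[OF G_enum E_enum L(1) _ _ L(2) n(2)] by metis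
      have "graphing (ball_bound D L) M H'"
        using graphing_subrelation[OF graphing, of H' L] H'(1-3) space by (simp add: bilipschitz_def)
      moreover have "AE x in M. component E x = component H' x"
        using bilipschitz_component[OF H'(3)] by simp
      ultimately have "cost M E \<le> 1/2 * (\<integral>x. real (card (H' `` {x})) \<partial>M)" by (rule cost_le)
      moreover have "(\<integral>x. real (card (H' `` {x})) \<partial>M) \<le> 2 * edge_density (V n) (H n) + 2 * (cost M E - s)"
        using H'(4) K density[OF H_simple, of n] by (simp add: \<delta>_def abs_le_iff)
      ultimately show False using n(1) by simp
    qed
  qed

  have upper: "\<exists>H l. rewiring V G H \<and> (\<lambda>n. edge_density (V n) (H n)) \<longlonglongrightarrow> l \<and> l \<le> cost M E + \<epsilon>"
    if \<epsilon>: "0 < \<epsilon>" for \<epsilon>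
  proof -
    \<comment> \<open>Half of \<epsilon> is spent on the infimum; the bi-Lipschitz approximation
      costs \<epsilon> in the mean degree, hence the other half in the density.\<close>
    obtain D' H where H: "graphing D' M H" "AE x in M. component E x = component H x"
      "1/2 * (\<integral>x. real (card (H `` {x})) \<partial>M) < cost M E + \<epsilon> / 2"
      using cost_approx[OF graphing, of "\<epsilon> / 2"] \<epsilon> by auto
    obtain L K where L: "0 < L" and K: "simple_graph UNIV K" "measurable_relation M K" "bilipschitz L E K"
      "(\<integral>x. real (card (K `` {x})) \<partial>M) \<le> (\<integral>x. real (card (H `` {x})) \<partial>M) + \<epsilon>"
      using bilipschitz_approximation[OF graphing H(1,2) \<epsilon>] .
    define l where "l = 1/2 * (\<integral>x. real (card (K `` {x})) \<partial>M)"
    \<comment> \<open>The added 1/(n+1) gives the strict inequality that the transfer asks for and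
      still tends to 0.\<close>
    define \<delta> where "\<delta> n = Q_dist D L M E (U n) (G n) + 1 / real (Suc n)" for n
    have "Q_dist D L M E (U n) (G n) < \<delta> n" for n by (simp add: \<delta>_def)
    then have "\<exists>H'. simple_graph (V n) H' \<and> bilipschitz L (G n) H' \<and>
      \<bar>(\<integral>x. real (card (H' `` {x})) \<partial>U n) - (\<integral>x. real (card (K `` {x})) \<partial>M)\<bar> \<le> real (ball_bound D L) * \<delta> n" for n
      using transfer_bilipschitz[OF E_enum G_enum L _ K(2,3), of n] K(1) unfolding space space_U by metis
    then obtain H' where H': "\<And>n. simple_graph (V n) (H' n)" "\<And>n. bilipschitz L (G n) (H' n)"
      "\<And>n. \<bar>(\<integral>x. real (card (H' n `` {x})) \<partial>U n) - (\<integral>x. real (card (K `` {x})) \<partial>M)\<bar> \<le> real (ball_bound D L) * \<delta> n"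
      by metis
    have "rewiring V G H'" unfolding rewiring_iff_bilipschitz[OF simple] using H'(1,2) L by blast
    moreover have "(\<lambda>n. edge_density (V n) (H' n)) \<longlonglongrightarrow> l"
    proof -
      have "Q_dist D L M E (U n) (G n) = Q_dist D L (U n) (G n) M E" for n by (rule Q_dist_commute)
      then have "\<delta> \<longlonglongrightarrow> 0 + 0"
        unfolding \<delta>_def using Q[of L] by (intro tendsto_add LIMSEQ_Suc[OF lim_1_over_n]) simp
      then have "(\<lambda>n. real (ball_bound D L) * \<delta> n) \<longlonglongrightarrow> real (ball_bound D L) * 0"
        by (intro tendsto_mult_left) simp
      then have lim: "(\<lambda>n. real (ball_bound D L) * \<delta> n) \<longlonglongrightarrow> 0" by simp
      have "\<bar>edge_density (V n) (H' n) - l\<bar> \<le> real (ball_bound D L) * \<delta> n" for n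
        using H'(3)[of n] unfolding density[OF H'(1)] l_def by linarith
      then have "(\<lambda>n. edge_density (V n) (H' n) - l) \<longlonglongrightarrow> 0"
        by (intro Lim_null_comparison[OF _ lim] always_eventually) simp
      then show ?thesis by (simp add: LIM_zero_iff)
    qed
    moreover have "l \<le> cost M E + \<epsilon>" using K(4) H(3) unfolding l_def by linarith
    ultimately show ?thesis by blast
  qed

  have "combinatorial_cost V G \<le> ereal (cost M E)"
  proof (rule ereal_le_epsilon2)
    fix \<epsilon> :: real assume "0 < \<epsilon>"
    then obtain H l where H: "rewiring V G H" "(\<lambda>n. edge_density (V n) (H n)) \<longlonglongrightarrow> l" "l \<le> cost M E + \<epsilon>"
      using upper by blast
    have "liminf (\<lambda>n. ereal (edge_density (V n) (H n))) = ereal l"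
      using H(2) by (intro lim_imp_Liminf) simp_all
    then have "combinatorial_cost V G \<le> ereal l"
      unfolding combinatorial_cost_def using H(1) by (intro Inf_lower CollectI exI[of _ H]) simp
    then show "combinatorial_cost V G \<le> ereal (cost M E) + ereal \<epsilon>" using H(3) by (metis ereal_less_eq(3) order_trans plus_ereal.simps(1))
  qed
  then have eq: "ereal (cost M E) = combinatorial_cost V G" using lower by (rule antisym[rotated])
  moreover have "\<exists>H l. rewiring V G H \<and> (\<lambda>n. edge_density (V n) (H n)) \<longlonglongrightarrow> l \<and>
    ereal l \<le> combinatorial_cost V G + ereal \<epsilon>" if "0 < \<epsilon>" for \<epsilon>
    using upper[OF that] unfolding eq[symmetric] by simp
  ultimately show ?thesis by blast
qed

end
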